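(* Let $\omega$ be an $\mathcal{A}_2$ weight on $\mathbb{D}$. Then there exist $\epsilon\in(0,1)$ and an $\epsilon$-lattice $\{a_n\}_{n=1}^{\infty}$ in $\mathbb{D}$ such that for each $f\in L_h^2(\omega)$ we have $$f(z)=\sum_{n=1}^\infty c_n (1-|a_n|^2)^2\, |D(a_n, \epsilon)|_\omega^{-\frac{1}{2}}\, R_{a_n}(z)$$ for some sequence $\{c_n\}$ in $\ell^2(\mathbb{N})$.
   Context: $\mathbb{D}$ is the open unit disk in $\mathbb{C}$, $dA$ is Lebesgue area measure on $\mathbb{D}$ normalized so that $\mathbb{D}$ has measure $1$, and $|E|$ is the $dA$-measure of $E$. For a weight $\omega$ put $|E|_\omega=\int_E\omega\,dA$. A function $\omega$ with $0<\omega\in L^1(\mathbb{D},dA)$ is an $\mathcal{A}_2$ weight if $$[\omega]_{\mathcal{A}_2}:=\sup_{a\in\mathbb{D},\,0<r<1}\frac{|B(a,r)|_\omega\,|B(a,r)|_{\omega^{-1}}}{|B(a,r)|^2}<\infty,\qquad B(a,r)=\{z\in\mathbb{D}:|z-a|<r\}.$$ $L_h^2(\omega)$ is the space of harmonic functions $f$ on $\mathbb{D}$ (complex valued) with $\|f\|_{L^2(\omega)}^2=\int_{\mathbb{D}}|f|^2\omega\,dA<\infty$. The pseudohyperbolic disk is $D(a,r)=\{z\in\mathbb{D}:|\frac{z-a}{1-\overline{a}z}|<r\}$, $0<r<1$. For $\epsilon\in(0,1)$, a sequence $\{a_n\}_{n\ge1}\subset\mathbb{D}$ is an $\epsilon$-lattice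 if $\mathbb{D}=\bigcup_{n}D(a_n,\epsilon)$ and $\inf_{n\neq m}\left|\frac{a_n-a_m}{1-\overline{a_n}a_m}\right|\ge\frac{\epsilon}{2}$. For $\lambda\in\mathbb{D}$, $$R_\lambda(z)=\frac{1}{(1-\overline{z}\lambda)^2}+\frac{1}{(1-\overline{\lambda}z)^2}-1$$ is the reproducing kernel at $\lambda$ of the unweighted harmonic Bergman space $L_h^2=L_h^2(dA)$. *)

theory Defs
  imports "HOL-Analysis.Analysis"
begin

abbreviation unit_disk :: "complex set" ("\<D>")
  where "\<D> \<equiv> ball 0 1"

text \<open>The normalized area measure. Its space is the disk itself, so functions on the disk
  are represented by functions on \<^typ>\<open>complex\<close> whose values outside the disk are irrelevant.\<close>

definition dA :: "complex measure"
  where "dA = uniform_measure (lebesgue_on \<D>) \<D>"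

text \<open>The weighted measure is valued in \<^typ>\<open>ennreal\<close>, so that a set on which the weight is not
  integrable has measure infinity (and not zero, as it would with the Bochner integral).\<close>

definition weighted_measure :: "(complex \<Rightarrow> real) \<Rightarrow> complex set \<Rightarrow> ennreal"
  where "weighted_measure \<omega> E = (\<integral>\<^sup>+z\<in>E. ennreal (\<omega> z) \<partial>dA)"

definition A2_const :: "(complex \<Rightarrow> real) \<Rightarrow> ennreal"
  where "A2_const \<omega> =
    (SUP (a, r) \<in> \<D> \<times> {0<..<1}.
       weighted_measure \<omega> (\<D> \<inter> ball a r)
         * weighted_measure (\<lambda>z. inverse (\<omega> z)) (\<D> \<inter> ball a r)
         / (emeasure dA (\<D> \<inter> ball a r))\<^sup>2)"

definition A2_weight :: "(complex \<Rightarrow> real) \<Rightarrow> bool"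
  where "A2_weight \<omega> \<longleftrightarrow>
    integrable dA \<omega> \<and> (AE z in dA. 0 < \<omega> z) \<and> A2_const \<omega> < \<infinity>"

text \<open>Complex-valued harmonic functions: twice continuously differentiable in the real sense,
  with vanishing Laplacian. The witnesses are the partial derivatives with respect to the real
  and imaginary part; they are unique on an open set.\<close>

definition harmonic_on :: "(complex \<Rightarrow> complex) \<Rightarrow> complex set \<Rightarrow> bool"
  where "harmonic_on f S \<longleftrightarrow>
    (\<exists>fx fy fxx fxy fyx fyy.
       (\<forall>z\<in>S. (f has_derivative (\<lambda>h. Re h *\<^sub>R fx z + Im h *\<^sub>R fy z)) (at z)) \<and>
       (\<forall>z\<in>S. (fx has_derivative (\<lambda>h. Re h *\<^sub>R fxx z + Im h *\<^sub>R fxy z)) (at z)) \<and>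
       (\<forall>z\<in>S. (fy has_derivative (\<lambda>h. Re h *\<^sub>R fyx z + Im h *\<^sub>R fyy z)) (at z)) \<and>
       continuous_on S fxx \<and> continuous_on S fxy \<and>
       continuous_on S fyx \<and> continuous_on S fyy \<and>
       (\<forall>z\<in>S. fxx z + fyy z = 0))"

definition harmonic_L2 :: "(complex \<Rightarrow> real) \<Rightarrow> (complex \<Rightarrow> complex) set"
  where "harmonic_L2 \<omega> =
    {f. harmonic_on f \<D> \<and> (\<integral>\<^sup>+z. ennreal ((norm (f z))\<^sup>2 * \<omega> z) \<partial>dA) < \<infinity>}"

definition pseudohyp_dist :: "complex \<Rightarrow> complex \<Rightarrow> real"
  where "pseudohyp_dist z a = norm ((z - a) / (1 - cnj a * z))"

definition pseudohyp_disk :: "complex \<Rightarrow> real \<Rightarrow> complex set"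
  where "pseudohyp_disk a r = {z \<in> \<D>. pseudohyp_dist z a < r}"

definition is_lattice :: "real \<Rightarrow> (nat \<Rightarrow> complex) \<Rightarrow> bool"
  where "is_lattice \<epsilon> a \<longleftrightarrow>
    range a \<subseteq> \<D> \<and>
    \<D> = (\<Union>n. pseudohyp_disk (a n) \<epsilon>) \<and>
    (\<forall>n m. n \<noteq> m \<longrightarrow> \<epsilon> / 2 \<le> pseudohyp_dist (a n) (a m))"

definition harmonic_kernel :: "complex \<Rightarrow> complex \<Rightarrow> complex"
  where "harmonic_kernel w z =
    1 / (1 - cnj z * w)\<^sup>2 + 1 / (1 - cnj w * z)\<^sup>2 - 1"

end

theory Submission
  imports Defs "HOL-Complex_Analysis.Complex_Analysis"
begin

text \<open>
  Harmonic functions in \<open>L\<^sup>1\<close> of the disk are reproduced by the kernel \<open>R\<close>. Replacing the reproducing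
  integral by a Riemann sum over a partition subordinate to a fine pseudohyperbolic lattice gives an
  operator \<open>S\<close> with \<open>|f - S f| \<le> C \<epsilon> P(P|f|)\<close> pointwise, where \<open>P\<close> is the positive Bergman operator with
  kernel \<open>1/|1 - cnj u z|\<^sup>2\<close>. Since \<open>P\<close> is bounded on \<open>L\<^sup>2(\<omega>)\<close> for an \<open>A\<^sub>2\<close> weight, \<open>I - S\<close> is a contraction for
  small \<open>\<epsilon>\<close>, and the Neumann series \<open>f = S (\<Sum>k. (I - S)\<^sup>k f)\<close> is the required expansion.

  Boundedness of \<open>P\<close>: its kernel is dominated by a sum over dyadic Carleson boxes and their neighbours.
  With the dual weight \<open>\<sigma> = 1/\<omega>\<close>, the \<open>A\<^sub>2\<close> condition trades \<open>\<sigma>(Q) \<omega>(Q) / |Q|\<close> for \<open>|T|\<close>, hence for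
  \<open>(\<sigma>(T) \<omega>(T))\<^sup>1\<^sup>/\<^sup>2\<close>, where the top halves \<open>T\<close> of the boxes \<open>Q\<close> are disjoint; Cauchy--Schwarz and the
  Carleson embedding theorem on the dyadic tree, once for \<open>\<sigma>\<close> and once for \<open>\<omega>\<close>, finish the estimate.
\<close>

section \<open>Carleson embedding on a binary tree\<close>

text \<open>Values of \<open>f\<close> at lattice nodes are not directly comparable with the
  weighted norm, so every point value and every oscillation over a cell is first bounded by
  \<open>maj f = P|f|\<close>. In \<open>P(P|f|)\<close> the inner \<open>P\<close> comes from these
  point values and the outer one from integrating them against the kernel. Since
  \<open>wnorm2\<close> is a squared norm, each \<open>P\<close> costs \<open>sqrt op_const\<close>,
  and the two together give the contraction factor \<open>540 * e * op_const\<close>.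

  The iteration runs in the class \<open>reproduced\<close>, defined by the kernel identity and a
  finite weighted norm: this identity passes directly from \<open>f\<close> to
  \<open>f - S f\<close>. Unweighted integrability of \<open>f\<close>, on which the reproducing
  integral depends, comes from Cauchy-Schwarz and the integrability of \<open>1 / w\<close>.

  Neighbouring cells enter because a dyadic tree separates some points that are close together,
  namely those on two sides of a dyadic angle.\<close>

lemma carleson_node:
  fixes s M1 M2 a A1 A2 b :: real
  assumes pos: "s > 0" "M1 > 0" "M2 > 0" and ab: "a\<^sup>2 \<le> b * s"
  shows "s * ((a + A1 + A2) / (s + M1 + M2))\<^sup>2
    \<le> (4 * b - 2 * (a + A1 + A2)\<^sup>2 / (s + M1 + M2)) + 2 * A1\<^sup>2 / M1 + 2 * A2\<^sup>2 / M2"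
proof -
  define x where "x = (a + A1 + A2) / (s + M1 + M2)"
  \<comment> \<open>\<open>d\<close> is the deviation of \<open>a\<close> from the share
    \<open>x * s\<close> that the overall average would give it. The children are merged by
    convexity of \<open>A^2 / M\<close>; in terms of \<open>x\<close> and \<open>d\<close> what
    remains is the square \<open>s * (x + 2 * d / s)^2\<close> plus nonnegative terms.\<close>
  define d where "d = a - x * s"
  have xM: "a + A1 + A2 = x * (s + M1 + M2)" using pos by (simp add: x_def)
  have a: "a = x * s + d" by (simp add: d_def)
  have A': "A1 + A2 = x * (M1 + M2) - d" using xM a by (simp add: algebra_simps)
  have "A1\<^sup>2 / M1 + A2\<^sup>2 / M2 - (A1 + A2)\<^sup>2 / (M1 + M2) = (A1 * M2 - A2 * M1)\<^sup>2 / (M1 * M2 * (M1 + M2))"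
    using pos by (simp add: divide_simps) (simp add: algebra_simps power2_eq_square)
  moreover have "\<dots> \<ge> 0" using pos by simp
  ultimately have 1: "(A1 + A2)\<^sup>2 / (M1 + M2) \<le> A1\<^sup>2 / M1 + A2\<^sup>2 / M2" by linarith
  have 2: "(A1 + A2)\<^sup>2 / (M1 + M2) = x\<^sup>2 * (M1 + M2) - 2 * x * d + d\<^sup>2 / (M1 + M2)"
    unfolding A' using pos by (simp add: field_simps power2_eq_square)
  have 3: "a\<^sup>2 / s \<le> b" using ab pos by (simp add: field_simps)
  have 4: "a\<^sup>2 / s = x\<^sup>2 * s + 2 * x * d + d\<^sup>2 / s"
    unfolding a using pos by (simp add: field_simps power2_eq_square)
  have 5: "(a + A1 + A2)\<^sup>2 / (s + M1 + M2) = x\<^sup>2 * (s + M1 + M2)"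
    unfolding xM using pos by (simp add: field_simps power2_eq_square)
  have "x\<^sup>2 * s + 4 * x * d + 4 * (d\<^sup>2 / s) = s * (x + 2 * d / s)\<^sup>2"
    using pos by (simp add: field_simps power2_eq_square)
  hence 6: "x\<^sup>2 * s + 4 * x * d + 4 * (d\<^sup>2 / s) \<ge> 0" using pos by simp
  have 7: "d\<^sup>2 / (M1 + M2) \<ge> 0" using pos by simp
  have "s * x\<^sup>2 \<le> (4 * b - 2 * (x\<^sup>2 * (s + M1 + M2))) + 2 * (A1\<^sup>2 / M1) + 2 * (A2\<^sup>2 / M2)"
    using 1 2 3 4 6 7 by (simp add: algebra_simps)
  thus ?thesis using 5 by (simp add: x_def)
qed

lemma sum_lessThan_double:
  fixes f :: "nat \<Rightarrow> 'a::comm_monoid_add"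
  shows "(\<Sum>j<2 * n. f j) = (\<Sum>j<n. f (2 * j) + f (2 * j + 1))"
  by (induction n) (simp_all add: add_ac)

text \<open>A Bellman function argument: \<open>4 * B - 2 * A^2 / M\<close> loses at least the
  summand on passing from a node to its two children, so the sum telescopes. \<open>AB\<close> keeps
  it nonnegative at the last level, and at the root it is at most \<open>4 * B\<close>. Here
  \<open>s k j\<close> is the part of \<open>M k j\<close> that the children do not inherit.\<close>

lemma carleson_embedding:
  fixes s M a A b B :: "nat \<Rightarrow> nat \<Rightarrow> real"
  assumes pos: "\<And>k j. j < 2 ^ k \<Longrightarrow> s k j > 0" "\<And>k j. j < 2 ^ k \<Longrightarrow> M k j > 0"
    and ab: "\<And>k j. j < 2 ^ k \<Longrightarrow> (a k j)\<^sup>2 \<le> b k j * s k j"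
    and AB: "\<And>k j. j < 2 ^ k \<Longrightarrow> (A k j)\<^sup>2 \<le> B k j * M k j"
    and M: "\<And>k j. j < 2 ^ k \<Longrightarrow> M k j = s k j + M (Suc k) (2 * j) + M (Suc k) (2 * j + 1)"
    and A: "\<And>k j. j < 2 ^ k \<Longrightarrow> A k j = a k j + A (Suc k) (2 * j) + A (Suc k) (2 * j + 1)"
    and B: "\<And>k j. j < 2 ^ k \<Longrightarrow> B k j = b k j + B (Suc k) (2 * j) + B (Suc k) (2 * j + 1)"
  shows "(\<Sum>k<n. \<Sum>j<2^k. s k j * (A k j / M k j)\<^sup>2) \<le> 4 * B 0 0"
proof -
  define P where "P k j = 4 * B k j - 2 * (A k j)\<^sup>2 / M k j" for k j
  have node: "s k j * (A k j / M k j)\<^sup>2 \<le> P k j - (P (Suc k) (2 * j) + P (Suc k) (2 * j + 1))"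
    if j: "j < 2 ^ k" for k j
  proof -
    have j': "2 * j < 2 ^ Suc k" "2 * j + 1 < 2 ^ Suc k" using j by auto
    show ?thesis
      using carleson_node[OF pos(1)[OF j] pos(2)[OF j'(1)] pos(2)[OF j'(2)] ab[OF j],
        of "A (Suc k) (2 * j)" "A (Suc k) (2 * j + 1)"]
      unfolding P_def A[OF j] M[OF j] B[OF j] by argo
  qed
  have level: "(\<Sum>j<2^k. s k j * (A k j / M k j)\<^sup>2) \<le> (\<Sum>j<2^k. P k j) - (\<Sum>j<2^Suc k. P (Suc k) j)" for k
  proof -
    have "(\<Sum>j<2^k. s k j * (A k j / M k j)\<^sup>2) \<le> (\<Sum>j<2^k. P k j - (P (Suc k) (2 * j) + P (Suc k) (2 * j + 1)))"
      by (intro sum_mono node) auto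
    thus ?thesis using sum_lessThan_double[of "P (Suc k)" "2 ^ k"] by (simp add: sum_subtractf)
  qed
  have "(\<Sum>k<n. \<Sum>j<2^k. s k j * (A k j / M k j)\<^sup>2) \<le> (\<Sum>j<2^0. P 0 j) - (\<Sum>j<2^n. P n j)"
  proof (induction n)
    case (Suc n)
    show ?case using level[of n] Suc by (simp add: algebra_simps)
  qed simp
  moreover have "P n j \<ge> 0" if j: "j < 2 ^ n" for j
  proof -
    have "(A n j)\<^sup>2 / M n j \<le> B n j" using AB[OF j] pos(2)[OF j] by (simp add: field_simps)
    moreover have "0 \<le> (A n j)\<^sup>2 / M n j" using pos(2)[OF j] by simp
    ultimately show ?thesis unfolding P_def by simp
  qed
  hence "(\<Sum>j<2^n. P n j) \<ge> 0" by (intro sum_nonneg) auto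
  moreover have "P 0 0 \<le> 4 * B 0 0" unfolding P_def using pos(2)[of 0 0] by simp
  ultimately show ?thesis by simp
qed

section \<open>Area measure and dyadic Carleson boxes\<close>

lemma space_dA [simp]: "space dA = \<D>"
  by (simp add: dA_def uniform_measure_def)

lemma sets_dA: "sets dA = sets (lebesgue_on \<D>)"
  by (simp add: dA_def uniform_measure_def)

lemma measurable_dA_cong: "measurable dA M = measurable (lebesgue_on \<D>) M"
  by (rule measurable_cong_sets) (simp_all add: sets_dA)

lemma emeasure_disk: "emeasure lebesgue \<D> = ennreal pi"
  using emeasure_ball[of "1::real" "0::complex"] by (simp add: eval_unit_ball_vol)

lemma emeasure_dA:
  assumes "A \<in> sets dA"
  shows "emeasure dA A = emeasure lebesgue A / ennreal pi"
proof -
  have A: "A \<subseteq> \<D>" "A \<in> sets (lebesgue_on \<D>)" using assms sets.sets_into_space[OF assms] by (auto simp: sets_dA)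
  have "\<D> \<in> sets (lebesgue_on \<D>)" using sets.top[of "lebesgue_on \<D>"] by simp
  moreover have "\<D> \<inter> A = A" using A by auto
  ultimately have "emeasure dA A = emeasure (lebesgue_on \<D>) A / emeasure (lebesgue_on \<D>) \<D>"
    unfolding dA_def by (subst emeasure_uniform_measure) (auto simp: A)
  thus ?thesis using A by (simp add: emeasure_restrict_space emeasure_disk)
qed

lemma emeasure_dA_disk [simp]: "emeasure dA \<D> = 1"
  using sets.top[of dA] by (simp add: emeasure_dA emeasure_disk ennreal_divide_self)

interpretation dA: finite_measure dA
  by standard simp

lemma borel_in_sets_dA: "A \<in> sets borel \<Longrightarrow> A \<subseteq> \<D> \<Longrightarrow> A \<in> sets dA"
  by (auto simp: sets_dA sets_restrict_space_iff)

lemma id_measurable_dA [measurable]: "(\<lambda>z. z) \<in> borel_measurable dA"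
  unfolding measurable_dA_cong by (intro measurable_restrict_space1 id_borel_measurable_lebesgue[unfolded id_def])

lemma borel_measurable_dA: "f \<in> borel_measurable borel \<Longrightarrow> f \<in> borel_measurable dA"
  using measurable_compose[OF id_measurable_dA] by simp

lemma continuous_on_measurable_dA: "continuous_on \<D> f \<Longrightarrow> f \<in> borel_measurable dA"
  unfolding measurable_dA_cong by (rule continuous_imp_measurable_on_sets_lebesgue) simp_all

lemma ball_in_sets_dA: "ball a r \<subseteq> \<D> \<Longrightarrow> ball a r \<in> sets dA"
  by (rule borel_in_sets_dA) auto

lemma emeasure_ball_complex: "r \<ge> 0 \<Longrightarrow> emeasure lborel (ball (a::complex) r) = ennreal (pi * r\<^sup>2)"
  using emeasure_ball[of r a] by (simp add: eval_unit_ball_vol)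

lemma emeasure_dA_ball:
  assumes "ball a r \<subseteq> \<D>" "r \<ge> 0"
  shows "emeasure dA (ball a r) = ennreal (r\<^sup>2)"
  using assms by (simp add: emeasure_dA ball_in_sets_dA emeasure_ball_complex divide_ennreal)

lemma emeasure_dA_ball_le:
  assumes "r \<ge> 0"
  shows "emeasure dA (\<D> \<inter> ball a r) \<le> ennreal (r\<^sup>2)"
proof -
  have "emeasure dA (\<D> \<inter> ball a r) = emeasure lebesgue (\<D> \<inter> ball a r) / ennreal pi"
    by (intro emeasure_dA borel_in_sets_dA) auto
  also have "\<dots> \<le> emeasure lebesgue (ball a r) / ennreal pi"
    by (intro divide_right_mono_ennreal emeasure_mono) auto
  also have "\<dots> = ennreal (r\<^sup>2)" using assms by (simp add: emeasure_ball_complex divide_ennreal)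
  finally show ?thesis .
qed

section \<open>Dyadic cells, Carleson boxes and neighbours\<close>

definition disk_angle :: "complex \<Rightarrow> real"
  where "disk_angle z = Arg2pi z / (2 * pi)"

definition cell :: "nat \<Rightarrow> complex \<Rightarrow> nat"
  where "cell k z = nat \<lfloor>2 ^ k * disk_angle z\<rfloor>"

definition box_D :: "nat \<Rightarrow> nat \<Rightarrow> complex set"
  where "box_D k j = {z\<in>\<D>. 1 - norm z \<le> 1 / 2 ^ k \<and> cell k z = j}"

text \<open>What remains of a box once the boxes over the two half-arcs are removed. Its mass is the
  quantity \<open>s\<close> of the tree embedding.\<close>

definition top_D :: "nat \<Rightarrow> nat \<Rightarrow> complex set"
  where "top_D k j = {z\<in>\<D>. 1 / 2 ^ Suc k < 1 - norm z \<and> 1 - norm z \<le> 1 / 2 ^ k \<and> cell k z = j}"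

text \<open>The values 0, 1, 2 of \<^term>\<open>i\<close> give the previous cell, the cell itself and the next cell.\<close>

definition nbr :: "nat \<Rightarrow> nat \<Rightarrow> nat \<Rightarrow> nat"
  where "nbr i k j = (j + i + (2 ^ k - 1)) mod 2 ^ k"

lemma disk_angle_bounds: "0 \<le> disk_angle z" "disk_angle z < 1"
  using Arg2pi[of z] by (auto simp: disk_angle_def)

lemma disk_angle_polar: "z = of_real (norm z) * cis (2 * pi * disk_angle z)"
  using Arg2pi_eq[of z] by (simp add: disk_angle_def cis_conv_exp)

lemma Arg2pi_measurable [measurable]: "Arg2pi \<in> borel_measurable borel"
  unfolding borel_measurable_iff_le
  using closed_Arg2pi2pi_le by simp

lemma disk_angle_measurable [measurable]: "disk_angle \<in> borel_measurable borel"
  unfolding disk_angle_def[abs_def] by measurable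

lemma cell_less: "cell k z < 2 ^ k"
proof -
  have "2 ^ k * disk_angle z < 2 ^ k" using disk_angle_bounds[of z] by simp
  hence "\<lfloor>2 ^ k * disk_angle z\<rfloor> < 2 ^ k" by (simp add: floor_less_iff)
  thus ?thesis using disk_angle_bounds[of z] unfolding cell_def by (simp add: nat_less_iff)
qed

lemma cell_Suc_div: "cell (Suc k) z div 2 = cell k z"
proof -
  define x where "x = 2 ^ k * disk_angle z"
  have x: "x \<ge> 0" using disk_angle_bounds[of z] by (simp add: x_def)
  have "\<lfloor>2 * x\<rfloor> div 2 = \<lfloor>x\<rfloor>" by linarith
  hence "nat \<lfloor>2 * x\<rfloor> div 2 = nat \<lfloor>x\<rfloor>" using x by (metis nat_div_distrib nat_numeral zero_le_numeral floor_mono floor_zero mult_nonneg_nonneg zero_le_floor)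
  thus ?thesis by (simp add: cell_def x_def mult_ac)
qed

lemma cell_measurable [measurable]: "cell k \<in> measurable borel (count_space UNIV)"
  unfolding cell_def[abs_def] by measurable

lemma box_D_measurable [measurable]: "box_D k j \<in> sets dA"
  unfolding box_D_def by (rule borel_in_sets_dA) auto

lemma top_D_measurable [measurable]: "top_D k j \<in> sets dA"
  unfolding top_D_def by (rule borel_in_sets_dA) auto

lemma box_D_0: "box_D 0 0 = \<D>"
  using cell_less[of 0] by (auto simp: box_D_def)

lemma top_subset_box: "top_D k j \<subseteq> box_D k j"
  by (auto simp: top_D_def box_D_def)

lemma box_D_split:
  "box_D k j = top_D k j \<union> (box_D (Suc k) (2 * j) \<union> box_D (Suc k) (2 * j + 1))"
  "top_D k j \<inter> (box_D (Suc k) (2 * j) \<union> box_D (Suc k) (2 * j + 1)) = {}"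
  "box_D (Suc k) (2 * j) \<inter> box_D (Suc k) (2 * j + 1) = {}"
proof -
  have 1: "(1::real) / 2 ^ Suc k \<le> 1 / 2 ^ k" by (simp add: field_simps)
  have 2: "cell k z = j \<longleftrightarrow> cell (Suc k) z = 2 * j \<or> cell (Suc k) z = 2 * j + 1" for z
    unfolding cell_Suc_div[of k z, symmetric] by presburger
  show "box_D k j = top_D k j \<union> (box_D (Suc k) (2 * j) \<union> box_D (Suc k) (2 * j + 1))"
    using 1 unfolding box_D_def top_D_def 2 by (auto simp del: power_Suc)
qed (auto simp: box_D_def top_D_def)

lemma nbr_less: "nbr i k j < 2 ^ k"
  by (simp add: nbr_def)

lemma nbr_1: "j < 2 ^ k \<Longrightarrow> nbr 1 k j = j"
proof -
  assume j: "j < 2 ^ k"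
  have "j + 1 + (2 ^ k - 1) = j + 2 ^ k" by simp
  thus ?thesis using j by (simp add: nbr_def)
qed

lemma int_nbr: "int (nbr i k j) = (int j + int i + (2 ^ k - 1)) mod 2 ^ k"
proof -
  have "int (2 ^ k - 1) = 2 ^ k - 1" by (simp add: of_nat_diff)
  thus ?thesis unfolding nbr_def zmod_int of_nat_add by simp
qed

lemma bij_betw_nbr: "bij_betw (nbr i k) {..<2 ^ k} {..<2 ^ k}"
proof -
  have inj: "inj_on (nbr i k) {..<2 ^ k}"
  proof (rule inj_onI)
    fix x y assume xy: "x \<in> {..<2 ^ k}" "y \<in> {..<2 ^ k}" "nbr i k x = nbr i k y"
    define c where "c = i + (2 ^ k - 1)"
    \<comment> \<open>The shift is undone inside the naturals: adding \<open>(2 ^ k - 1) * c\<close>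
      completes \<open>c\<close> to \<open>2 ^ k * c\<close>, which vanishes modulo
      \<open>2 ^ k\<close>.\<close>
    have shift: "(w + c + (2 ^ k - 1) * c) mod 2 ^ k = w" if "w < 2 ^ k" for w :: nat
    proof -
      have "c + (2 ^ k - 1) * c = 2 ^ k * c" by (simp add: diff_mult_distrib)
      hence "w + c + (2 ^ k - 1) * c = w + 2 ^ k * c" by simp
      thus ?thesis by (simp only:) (use that in simp)
    qed
    have "(x + c) mod 2 ^ k = (y + c) mod 2 ^ k" using xy by (simp add: nbr_def c_def add_ac)
    hence "(x + c + (2 ^ k - 1) * c) mod 2 ^ k = (y + c + (2 ^ k - 1) * c) mod 2 ^ k"
      by (rule mod_add_cong) simp
    thus "x = y" using shift[of x] shift[of y] xy by simp
  qed
  moreover have "nbr i k ` {..<2 ^ k} = {..<2 ^ k}"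
    by (rule endo_inj_surj) (auto simp: nbr_less inj)
  ultimately show ?thesis by (simp add: bij_betw_def)
qed

text \<open>The positions \<open>x\<close> and \<open>y\<close> live on a circle of circumference
  \<open>2 ^ k\<close> cut into unit cells; the second alternative in \<open>xy\<close> is closeness
  across the cut at angle 0.\<close>

lemma nbr_adjacentI:
  assumes x: "0 \<le> x" "x < 2 ^ k" and y: "0 \<le> y" "y < 2 ^ k"
    and xy: "\<bar>x - y\<bar> < 1 \<or> \<bar>x - y\<bar> > 2 ^ k - (1::real)"
  shows "\<exists>i<3. nat \<lfloor>y\<rfloor> = nbr i k (nat \<lfloor>x\<rfloor>)"
proof -
  define N :: int where "N = 2 ^ k"
  define a b where "a = \<lfloor>x\<rfloor>" and "b = \<lfloor>y\<rfloor>"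
  have N: "N \<ge> 1" "real_of_int N = 2 ^ k" by (simp_all add: N_def)
  have ab: "0 \<le> a" "a < N" "0 \<le> b" "b < N"
    using x y N unfolding a_def b_def by (auto simp: floor_less_iff)
  have key: "nat b = nbr i k (nat a)" if "(a + int i + (N - 1)) mod N = b" for i
  proof -
    have "int (nbr i k (nat a)) = b"
      using that ab by (simp add: int_nbr N_def)
    thus ?thesis using ab by simp
  qed
  have "b = a - 1 \<or> b = a \<or> b = a + 1 \<or> (a = N - 1 \<and> b = 0) \<or> (a = 0 \<and> b = N - 1)"
  proof (cases "\<bar>x - y\<bar> < 1")
    case True
    hence "\<bar>a - b\<bar> \<le> 1" unfolding a_def b_def by linarith
    thus ?thesis by linarith
  next
    case False
    hence "x - y > N - 1 \<or> y - x > N - 1" using xy N by linarith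
    moreover have "x < N" "y < N" using x y N by auto
    ultimately have "(x > N - 1 \<and> y < 1) \<or> (y > N - 1 \<and> x < 1)" using x y by linarith
    hence "(a = N - 1 \<and> b = 0) \<or> (a = 0 \<and> b = N - 1)"
      using ab x y unfolding a_def b_def by linarith
    thus ?thesis by blast
  qed
  moreover have "(a + int 0 + (N - 1)) mod N = b" if "b = a - 1"
  proof -
    have "a + int 0 + (N - 1) = b + N" using that by simp
    thus ?thesis using ab by (simp only: mod_add_self2 mod_pos_pos_trivial)
  qed
  moreover have "(a + int 1 + (N - 1)) mod N = b" if "b = a"
    using that ab mod_add_self2[of b N] by (simp add: add_ac)
  moreover have "(a + int 2 + (N - 1)) mod N = b" if "b = a + 1"
    using that ab mod_add_self2[of b N] by (simp add: add_ac)
  moreover have "(a + int 2 + (N - 1)) mod N = b" if "a = N - 1 \<and> b = 0"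
  proof -
    have "a + int 2 + (N - 1) = 2 * N" using that by simp
    thus ?thesis using that by simp
  qed
  moreover have "(a + int 0 + (N - 1)) mod N = b" if "a = 0 \<and> b = N - 1"
  proof -
    have "a + int 0 + (N - 1) = N - 1" using that by simp
    thus ?thesis using that ab by (simp only: mod_pos_pos_trivial)
  qed
  ultimately consider "(a + int 0 + (N - 1)) mod N = b" | "(a + int 1 + (N - 1)) mod N = b"
    | "(a + int 2 + (N - 1)) mod N = b" by blast
  hence "\<exists>i<3. nat b = nbr i k (nat a)"
  proof cases
    case 1 thus ?thesis using key[of 0] by (intro exI[of _ 0]) simp
  next
    case 2 thus ?thesis using key[of 1] by (intro exI[of _ 1]) simp
  next
    case 3 thus ?thesis using key[of 2] by (intro exI[of _ 2]) simp
  qed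
  thus ?thesis unfolding a_def b_def .
qed

text \<open>The integer \<open>m\<close> counts turns around the circle. Up to turns the two floors
  differ by at most 1, which leaves the positions at most 2 apart.\<close>

lemma nbr_adjacentD:
  fixes x y :: real
  assumes "i < 3" and x: "0 \<le> x" and y: "0 \<le> y"
    and xy: "nat \<lfloor>y\<rfloor> = nbr i k (nat \<lfloor>x\<rfloor>)"
  shows "\<exists>m::int. \<bar>y - x - real_of_int m * 2 ^ k\<bar> \<le> 2"
proof -
  define N :: int where "N = 2 ^ k"
  define a b where "a = \<lfloor>x\<rfloor>" and "b = \<lfloor>y\<rfloor>"
  have ab: "0 \<le> a" "0 \<le> b" using x y by (auto simp: a_def b_def)
  have "b = int (nat b)" using ab by simp
  also have "\<dots> = int (nbr i k (nat a))" using xy by (simp only: a_def b_def)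
  also have "\<dots> = (a + int i + (N - 1)) mod N"
    using ab by (simp add: int_nbr N_def)
  also have "\<dots> = a + int i + (N - 1) - N * ((a + int i + (N - 1)) div N)"
    by (simp add: minus_mult_div_eq_mod)
  finally have "b - a - (1 - (a + int i + (N - 1)) div N) * N = int i - 1"
    by (simp add: algebra_simps)
  then obtain m where "b - a - m * N = int i - 1" by blast
  hence "real_of_int (b - a - m * N) = real_of_int (int i - 1)" by simp
  hence m: "real_of_int b - real_of_int a - real_of_int m * 2 ^ k = real i - 1"
    by (simp add: N_def)
  have i: "real i \<le> 2" "0 \<le> real i" using \<open>i < 3\<close> by auto
  have "real_of_int a \<le> x" "x < real_of_int a + 1" "real_of_int b \<le> y" "y < real_of_int b + 1"
    unfolding a_def b_def by linarith+
  hence "\<bar>y - x - real_of_int m * 2 ^ k\<bar> \<le> 2" using m i by linarith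
  thus ?thesis by blast
qed

section \<open>Euclidean geometry of the boxes\<close>

lemma norm_cis_diff: "norm (cis a - cis b) = 2 * \<bar>sin ((a - b) / 2)\<bar>"
proof -
  have "cis a - cis b = cis b * (cis (a - b) - 1)" by (simp add: algebra_simps cis_mult)
  thus ?thesis using dist_exp_i_1[of "a - b"] by (simp add: norm_mult cis_conv_exp)
qed

lemma norm_cis_diff_le: "norm (cis a - cis b) \<le> \<bar>a - b\<bar>"
  unfolding norm_cis_diff using abs_sin_x_le_abs_x[of "(a - b) / 2"] by simp

text \<open>Follows from the cubic Taylor bound, as \<open>x^2 \<le> 3\<close> on the interval.
  Slope \<open>1/2\<close> is enough for \<open>common_box\<close>, which only asks that slope times
  \<open>pi\<close> exceed 1.\<close>

lemma half_le_sin: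
  assumes "0 \<le> x" "x \<le> pi / 2"
  shows "x / 2 \<le> sin x"
proof -
  have "\<bar>sin x - x\<bar> \<le> x ^ 3 / 6"
    using Maclaurin_sin_bound[of x 3] assms
    by (simp add: eval_nat_numeral sin_coeff_def)
  moreover have "x ^ 3 / 6 \<le> x / 2"
  proof -
    have "x \<le> 1.7" using assms pi_less_4 pi_approx by simp
    hence "x * x \<le> 1.7 * 1.7" using assms by (intro mult_mono) auto
    hence "x * (x * x) \<le> x * 3" using assms by (intro mult_left_mono) auto
    thus ?thesis by (simp add: power3_eq_cube)
  qed
  ultimately show ?thesis by linarith
qed

text \<open>The A2 condition speaks of Euclidean balls, so a box and its neighbours have to fit into
  one of comparable radius. Of the 16, at most \<open>2 * 3.5 * 2 = 14\<close> comes from the angle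
  (two cells, \<open>pi \<le> 3.5\<close>) and 1 from the radial direction.\<close>

lemma box_in_ball:
  assumes p: "p \<in> box_D k j" and q: "q \<in> box_D k (nbr i k j)" and i: "i < 3"
  shows "dist p q < 16 / 2 ^ k"
proof -
  have "cell k q = nbr i k (cell k p)" using p q by (simp add: box_D_def)
  hence "\<exists>m::int. \<bar>2 ^ k * disk_angle q - 2 ^ k * disk_angle p - real_of_int m * 2 ^ k\<bar> \<le> 2"
    unfolding cell_def using disk_angle_bounds by (intro nbr_adjacentD[OF i]) auto
  then obtain m :: int where m: "\<bar>2 ^ k * disk_angle q - 2 ^ k * disk_angle p - real_of_int m * 2 ^ k\<bar> \<le> 2"
    by blast
  \<comment> \<open>The angular difference in turns, with full turns removed.\<close>
  define t where "t = disk_angle q - disk_angle p - m"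
  have "2 ^ k * t = 2 ^ k * disk_angle q - 2 ^ k * disk_angle p - m * 2 ^ k"
    by (simp add: t_def algebra_simps)
  hence "\<bar>2 ^ k * t\<bar> \<le> 2" using m by simp
  hence t: "\<bar>t\<bar> \<le> 2 / 2 ^ k" by (simp add: abs_mult field_simps)
  have "cis (2 * pi * disk_angle q) = cis (2 * pi * (disk_angle p + t))"
  proof -
    have "2 * pi * disk_angle q = 2 * pi * (disk_angle p + t) + 2 * pi * m"
      by (simp add: t_def algebra_simps)
    thus ?thesis by (simp add: cis_mult[symmetric] cis_multiple_2pi)
  qed
  hence "norm (cis (2 * pi * disk_angle p) - cis (2 * pi * disk_angle q)) \<le> \<bar>2 * pi * t\<bar>"
    using norm_cis_diff_le[of "2 * pi * disk_angle p" "2 * pi * (disk_angle p + t)"]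
    by (simp add: algebra_simps)
  also have "\<dots> \<le> 2 * 3.5 * (2 / 2 ^ k)"
    unfolding abs_mult using t pi_approx by (intro mult_mono) auto
  finally have A: "norm (cis (2 * pi * disk_angle p) - cis (2 * pi * disk_angle q)) \<le> 14 / 2 ^ k" by simp
  have pq: "norm p < 1" "norm q < 1" "1 - norm p \<le> 1 / 2 ^ k" "1 - norm q \<le> 1 / 2 ^ k"
    using p q by (auto simp: box_D_def)
  have "p - q = of_real (norm p) * (cis (2 * pi * disk_angle p) - cis (2 * pi * disk_angle q))
      + of_real (norm p - norm q) * cis (2 * pi * disk_angle q)"
    using disk_angle_polar[of p] disk_angle_polar[of q] by (simp add: algebra_simps)
  also have "norm \<dots> \<le> norm p * norm (cis (2 * pi * disk_angle p) - cis (2 * pi * disk_angle q)) + \<bar>norm p - norm q\<bar>"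
    by (rule order.trans[OF norm_triangle_ineq]) (simp add: norm_mult)
  also have "\<dots> \<le> 1 * (14 / 2 ^ k) + 1 / 2 ^ k"
    using pq A by (intro add_mono mult_mono) (auto simp: abs_le_iff)
  also have "\<dots> < 16 / 2 ^ k" by (simp add: field_simps)
  finally show ?thesis by (simp add: dist_norm)
qed

text \<open>Projecting \<open>r * cis a\<close> radially onto the circle moves it by
  \<open>1 - r\<close>, which is itself at most the distance from \<open>r * cis a\<close> to 1;
  hence the factor 2.\<close>

lemma norm_one_minus_mult_cis:
  assumes "0 \<le> r" "r \<le> 1"
  shows "norm (1 - cis a) \<le> 2 * norm (1 - of_real r * cis a)"
proof -
  have "norm (of_real r * cis a) = r" using assms by (simp add: norm_mult)
  hence "1 - r \<le> norm (1 - of_real r * cis a)" using norm_triangle_ineq2[of 1 "of_real r * cis a"] by simp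
  moreover have "1 - cis a = (1 - of_real r * cis a) - of_real (1 - r) * cis a" by (simp add: algebra_simps)
  hence "norm (1 - cis a) \<le> norm (1 - of_real r * cis a) + norm (of_real (1 - r) * cis a)"
    by (metis norm_triangle_ineq4)
  moreover have "norm (of_real (1 - r) * cis a) = 1 - r" using assms by (simp add: norm_mult del: of_real_diff)
  ultimately show ?thesis by linarith
qed

text \<open>With \<open>d = |1 - cnj u * z|\<close>, both depths \<open>1 - |z|\<close> and
  \<open>1 - |u|\<close> as well as the angular gap are bounded by \<open>d\<close>. At the dyadic
  scale just above \<open>d\<close> the two points therefore lie in equal or adjacent cells, and the
  size of the kernel can be read off from that scale.\<close>

lemma common_box:
  assumes z: "z \<in> \<D>" and u: "u \<in> \<D>"
  shows "\<exists>k. norm (1 - cnj u * z) > 1 / 2 ^ Suc k \<and> (\<exists>i<3. z \<in> box_D k (cell k z) \<and> u \<in> box_D k (nbr i k (cell k z)))"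
proof -
  define d where "d = norm (1 - cnj u * z)"
  define s where "s = \<bar>disk_angle z - disk_angle u\<bar>"
  have nz: "norm z < 1" "norm u < 1" using z u by auto
  have prod: "norm u * norm z \<le> norm z" "norm u * norm z \<le> norm u"
    using nz by (auto simp: mult_left_le mult_left_le_one_le)
  have "1 - norm (cnj u * z) \<le> d" unfolding d_def using norm_triangle_ineq2[of 1 "cnj u * z"] by simp
  hence d1: "1 - norm z \<le> d" "1 - norm u \<le> d" using prod by (auto simp: norm_mult)
  have dpos: "d > 0" using d1 nz by simp
  have s: "0 \<le> s" "s < 1" using disk_angle_bounds[of z] disk_angle_bounds[of u] unfolding s_def by auto
  have "cnj u * z = of_real (norm u * norm z) * cis (2 * pi * (disk_angle z - disk_angle u))"
    by (subst (1) disk_angle_polar[of z], subst (1) disk_angle_polar[of u]) (simp add: cis_cnj cis_mult algebra_simps)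
  hence "norm (1 - cis (2 * pi * (disk_angle z - disk_angle u))) \<le> 2 * d"
    unfolding d_def using norm_one_minus_mult_cis[of "norm u * norm z"] nz prod by fastforce
  hence "2 * \<bar>sin (pi * (disk_angle z - disk_angle u))\<bar> \<le> 2 * d"
    using norm_cis_diff[of 0 "2 * pi * (disk_angle z - disk_angle u)"] by simp
  moreover have "\<bar>sin (pi * (disk_angle z - disk_angle u))\<bar> = sin (pi * s)"
  proof -
    have "\<bar>sin (pi * (disk_angle z - disk_angle u))\<bar> = \<bar>sin (pi * s)\<bar>"
      unfolding s_def by (cases "disk_angle z \<le> disk_angle u") (auto simp: abs_if algebra_simps sin_diff)
    also have "sin (pi * s) \<ge> 0" using s by (intro sin_ge_zero) auto
    ultimately show ?thesis by simp
  qed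
  ultimately have sd: "sin (pi * s) \<le> d" by simp
  \<comment> \<open>The two cases are arcs avoiding and arcs crossing the cut. Any constant above 1
    would do in place of 1.5, which is below \<open>pi / 2\<close>: it makes
    \<open>2 ^ k * s\<close> strictly less than 1, as \<open>nbr_adjacentI\<close> demands.\<close>
  have near: "s \<le> d / 1.5 \<or> 1 - s \<le> d / 1.5"
  proof (cases "s \<le> 1 / 2")
    case True
    have "pi * s / 2 \<le> sin (pi * s)" using s True by (intro half_le_sin) auto
    moreover have "1.5 * s \<le> pi * s / 2" using s pi_approx by (simp add: mult_right_mono)
    ultimately show ?thesis using sd by simp
  next
    case False
    have "pi * (1 - s) / 2 \<le> sin (pi * (1 - s))" using s False by (intro half_le_sin) auto
    moreover have "sin (pi * (1 - s)) = sin (pi * s)" by (simp add: algebra_simps sin_diff)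
    moreover have "1.5 * (1 - s) \<le> pi * (1 - s) / 2"
      using s pi_approx mult_right_mono[of "1.5" "pi / 2" "1 - s"] by simp
    ultimately show ?thesis using sd by simp
  qed
  show ?thesis
  proof (cases "d > 1")
    case True
    \<comment> \<open>For \<open>d > 1\<close> there is no dyadic scale above \<open>d\<close>; the
      root box contains every point and is its own neighbour.\<close>
    have 0: "cell 0 w = 0" "nbr (Suc 0) 0 0 = 0" for w using cell_less[of 0 w] by (auto simp: nbr_def)
    have "z \<in> box_D 0 (cell 0 z) \<and> u \<in> box_D 0 (nbr 1 0 (cell 0 z))" using z u by (simp add: 0 box_D_0)
    moreover have "d > 1 / 2 ^ Suc 0" using True by simp
    ultimately show ?thesis unfolding d_def by (intro exI[of _ 0] conjI exI[of _ 1]) auto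
  next
    case False
    have "\<exists>n. (1/2) ^ n < d" using dpos by (intro real_arch_pow_inv) auto
    define n where "n = (LEAST n. (1/2::real) ^ n < d)"
    have n: "(1/2) ^ n < d" unfolding n_def by (rule LeastI_ex) fact
    have "n \<noteq> 0" using n False by (intro notI) simp
    then obtain k where k: "n = Suc k" by (cases n) auto
    have "\<not> (1/2) ^ k < d" using not_less_Least[of k "\<lambda>n. (1/2) ^ n < d"] k unfolding n_def by simp
    hence dk: "d \<le> 1 / 2 ^ k" by (simp add: power_divide)
    have dk': "d > 1 / 2 ^ Suc k" using n k by (simp add: power_divide)
    have "2 ^ k * d \<le> 1" using dk by (simp add: field_simps)
    hence "2 ^ k * (d / 1.5) < 1" using dpos by simp
    hence "2 ^ k * s < 1 \<or> 2 ^ k * (1 - s) < 1"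
      using near by (metis mult_left_mono order_le_less_trans zero_le_numeral zero_le_power)
    moreover have "\<bar>2 ^ k * disk_angle z - 2 ^ k * disk_angle u\<bar> = 2 ^ k * s"
      unfolding s_def by (simp add: abs_mult flip: right_diff_distrib)
    ultimately have "\<exists>i<3. cell k u = nbr i k (cell k z)"
      unfolding cell_def using disk_angle_bounds
      by (intro nbr_adjacentI) (auto simp: algebra_simps)
    then obtain i where i: "i < 3" "cell k u = nbr i k (cell k z)" by blast
    have "z \<in> box_D k (cell k z) \<and> u \<in> box_D k (nbr i k (cell k z))"
      using z u d1 dk i by (auto simp: box_D_def)
    thus ?thesis using i dk' unfolding d_def by blast
  qed
qed

lemma top_contains_ball:
  assumes j: "j < 2 ^ k"
  shows "\<exists>c. ball c (1 / (8 * 2 ^ k)) \<subseteq> top_D k j"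
proof -
  define h :: real where "h = 1 / 2 ^ k"
  have h: "0 < h" "h \<le> 1" by (auto simp: h_def)
  \<comment> \<open>The centre of the top half: depth \<open>3/4 * h\<close> lies midway between
    \<open>h / 2\<close> and \<open>h\<close>, and \<open>al\<close> is the angle in the middle of
    the cell.\<close>
  define r where "r = 1 - 3 / 4 * h"
  have r: "r \<ge> 1 / 4" "r < 1" using h by (auto simp: r_def)
  define al where "al = 2 * pi * ((j + 1 / 2) * h)"
  define c where "c = of_real r * cis al"
  have nc: "norm c = r" using r by (simp add: c_def norm_mult)
  have "ball c (h / 8) \<subseteq> top_D k j"
  proof
    fix w assume "w \<in> ball c (h / 8)"
    hence d: "norm (w - c) < h / 8" by (simp add: dist_norm norm_minus_commute)
    have c0: "c \<noteq> 0" using nc r by auto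
    \<comment> \<open>The relative displacement. The imaginary part \<open>b\<close> of the
      logarithm of \<open>1 + e\<close> is the change of angle; it stays below \<open>h\<close>,
      hence below the half-width \<open>pi * h\<close> of the cell.\<close>
    define e where "e = (w - c) / c"
    have w: "w = c * (1 + e)" using c0 by (simp add: e_def field_simps)
    have ne: "norm e < h / 2"
    proof -
      have "norm e = norm (w - c) / r" by (simp add: e_def norm_divide nc)
      also have "\<dots> < (h / 8) / r" using d r by (intro divide_strict_right_mono) auto
      also have "\<dots> \<le> (h / 8) / (1 / 4)" using r h by (intro divide_left_mono) auto
      finally show ?thesis by simp
    qed
    have e1: "1 + e \<noteq> 0"
    proof
      assume "1 + e = 0"
      hence "e = -1" by (simp add: add_eq_0_iff)
      thus False using ne h by simp
    qed
    define b where "b = Im (Ln (1 + e))"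
    have "\<bar>b\<bar> \<le> norm (Ln (1 + e))" unfolding b_def by (rule abs_Im_le_cmod)
    also have "\<dots> \<le> 2 * norm e" using ne h by (intro norm_Ln_le) auto
    also have "\<dots> < h" using ne by simp
    finally have b: "\<bar>b\<bar> < h" .
    have "1 + e = exp (Ln (1 + e))" using e1 by simp
    also have "\<dots> = of_real (norm (1 + e)) * cis b"
    proof -
      have "exp (Ln (1 + e)) = of_real (norm (exp (Ln (1 + e)))) * cis (Im (Ln (1 + e)))"
        by (metis norm_exp_eq_Re exp_eq_polar)
      thus ?thesis using e1 by (simp add: b_def)
    qed
    finally have "w = of_real (r * norm (1 + e)) * cis (al + b)"
      unfolding w c_def by (simp add: cis_mult[symmetric] algebra_simps)
    moreover have "norm w = r * norm (1 + e)" unfolding w by (simp add: norm_mult nc)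
    ultimately have wp: "w = of_real (norm w) * cis (al + b)" by simp
    have wpos: "norm w > 0" using e1 c0 w by simp
    have h3: "h < pi * h" using h pi_approx by (simp add: mult_less_cancel_right1)
    have jh: "real j * h \<le> 1 - h"
    proof -
      have "real (j + 1) \<le> 2 ^ k" using j by (metis Suc_eq_plus1 Suc_leI of_nat_le_iff of_nat_numeral of_nat_power)
      thus ?thesis by (simp add: h_def field_simps)
    qed
    have al: "al = 2 * pi * (real j * h) + pi * h" by (simp add: al_def algebra_simps)
    have lo: "2 * pi * (real j * h) \<le> al + b" using b h3 al by linarith
    have hi: "al + b < 2 * pi * (real j * h + h)"
      using b h3 al by (simp add: algebra_simps)
    have "2 * pi * (real j * h + h) \<le> 2 * pi * 1" using jh by (intro mult_left_mono) auto
    hence hi': "al + b < 2 * pi" using hi by linarith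
    have "0 \<le> 2 * pi * (real j * h)" using h by simp
    hence lo': "0 \<le> al + b" using lo by linarith
    have "Arg2pi w = al + b"
      using wp wpos lo' hi' by (intro Arg2pi_unique[of "norm w"]) (auto simp: cis_conv_exp)
    hence "disk_angle w = (al + b) / (2 * pi)" by (simp add: disk_angle_def)
    hence "2 * pi * disk_angle w = al + b" by simp
    hence "2 * pi * (real j * h) \<le> 2 * pi * disk_angle w" "2 * pi * disk_angle w < 2 * pi * (real j * h + h)"
      using lo hi by simp_all
    hence "real j * h \<le> disk_angle w" "disk_angle w < real j * h + h"
      by simp_all
    hence "real j \<le> 2 ^ k * disk_angle w" "2 ^ k * disk_angle w < real j + 1"
      by (auto simp: h_def field_simps)
    hence "\<lfloor>2 ^ k * disk_angle w\<rfloor> = int j" by (intro floor_unique) auto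
    hence cell: "cell k w = j" by (simp add: cell_def)
    have "\<bar>norm w - r\<bar> < h / 8" using norm_triangle_ineq3[of w c] d nc by simp
    hence "1 - norm w > 5 / 8 * h" "1 - norm w < 7 / 8 * h" unfolding r_def by linarith+
    moreover from this have "norm w < 1" using h by linarith
    ultimately have "1 / 2 ^ Suc k < 1 - norm w" "1 - norm w \<le> 1 / 2 ^ k" "norm w < 1"
      by (auto simp: h_def field_simps)
    thus "w \<in> top_D k j" using cell by (auto simp: top_D_def)
  qed
  thus ?thesis by (auto simp: h_def mult.commute)
qed

lemma emeasure_top: "j < 2 ^ k \<Longrightarrow> ennreal (1 / (64 * 4 ^ k)) \<le> emeasure dA (top_D k j)"
proof -
  assume "j < 2 ^ k"
  then obtain c where c: "ball c (1 / (8 * 2 ^ k)) \<subseteq> top_D k j" using top_contains_ball by blast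
  have "top_D k j \<subseteq> \<D>" by (auto simp: top_D_def)
  hence "emeasure dA (ball c (1 / (8 * 2 ^ k))) = ennreal ((1 / (8 * 2 ^ k))\<^sup>2)"
    using c by (intro emeasure_dA_ball) auto
  also have "(1 / (8 * 2 ^ k) :: real)\<^sup>2 = 1 / (64 * 4 ^ k)"
    by (simp add: power_divide power_mult_distrib power2_eq_square flip: power_mult_distrib)
  finally show ?thesis using emeasure_mono[OF c, of dA] by simp
qed

section \<open>The positive Bergman operator\<close>

lemma weighted_Cauchy_Schwarz:
  assumes [measurable]: "h \<in> borel_measurable dA" "u \<in> borel_measurable dA" "E \<in> sets dA"
    and u: "\<And>z. 0 < (u z :: real)"
  shows "(\<integral>\<^sup>+z\<in>E. h z \<partial>dA)\<^sup>2 \<le> (\<integral>\<^sup>+z\<in>E. (h z)\<^sup>2 * ennreal (u z) \<partial>dA) * weighted_measure (\<lambda>z. inverse (u z)) E"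
proof -
  define f where "f z = h z * ennreal (sqrt (u z)) * indicator E z" for z
  define g where "g z = ennreal (1 / sqrt (u z)) * indicator E z" for z
  have "f z * g z = h z * indicator E z" for z
  proof -
    have "ennreal (sqrt (u z)) * ennreal (1 / sqrt (u z)) = 1"
      using u[of z] by (simp flip: ennreal_mult)
    thus ?thesis unfolding f_def g_def by (simp add: indicator_def mult.assoc)
  qed
  moreover have "(f z)\<^sup>2 = (h z)\<^sup>2 * ennreal (u z) * indicator E z" for z
    using u[of z] by (simp add: f_def power_mult_distrib indicator_def ennreal_power)
  moreover have "(g z)\<^sup>2 = ennreal (inverse (u z)) * indicator E z" for z
    using u[of z] by (simp add: g_def power_mult_distrib indicator_def ennreal_power power_divide inverse_eq_divide)
  moreover have "(\<integral>\<^sup>+z. f z * g z \<partial>dA)\<^sup>2 \<le> (\<integral>\<^sup>+z. (f z)\<^sup>2 \<partial>dA) * (\<integral>\<^sup>+z. (g z)\<^sup>2 \<partial>dA)"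
    unfolding f_def g_def by (intro Cauchy_Schwarz_nn_integral) measurable
  ultimately show ?thesis by (simp add: weighted_measure_def)
qed

text \<open>The case \<open>h = 1\<close>. It bounds products of dual masses from below for every
  weight, whereas the A2 condition bounds them from above; the two are played against each other
  later.\<close>

lemma emeasure_weighted_Cauchy_Schwarz:
  assumes [measurable]: "u \<in> borel_measurable dA" "E \<in> sets dA" and u: "\<And>z. 0 < (u z :: real)"
  shows "(emeasure dA E)\<^sup>2 \<le> weighted_measure u E * weighted_measure (\<lambda>z. inverse (u z)) E"
  using weighted_Cauchy_Schwarz[of "\<lambda>_. 1" u E] assms by (simp add: weighted_measure_def)

lemma weighted_measure_mono: "A \<inter> \<D> \<subseteq> B \<Longrightarrow> weighted_measure u A \<le> weighted_measure u B"
  unfolding weighted_measure_def by (intro nn_integral_mono) (auto split: split_indicator)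

lemma set_nn_integral_finite:
  assumes "(\<integral>\<^sup>+z. f z \<partial>M) < \<infinity>"
  shows "(\<integral>\<^sup>+z\<in>E. f z \<partial>M) < \<infinity>"
  using assms by (elim le_less_trans[rotated]) (auto intro!: nn_integral_mono split: split_indicator)

text \<open>Supplies the tree recursions for \<open>carleson_embedding\<close>. Finiteness is what
  allows \<open>enn2real\<close> to distribute over the sum.\<close>

lemma box_split_integral:
  assumes [measurable]: "f \<in> borel_measurable dA" and fin: "(\<integral>\<^sup>+z. f z \<partial>dA) < \<infinity>"
  shows "enn2real (\<integral>\<^sup>+z\<in>box_D k j. f z \<partial>dA) = enn2real (\<integral>\<^sup>+z\<in>top_D k j. f z \<partial>dA)
    + enn2real (\<integral>\<^sup>+z\<in>box_D (Suc k) (2 * j). f z \<partial>dA) + enn2real (\<integral>\<^sup>+z\<in>box_D (Suc k) (2 * j + 1). f z \<partial>dA)"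
proof -
  have fin: "(\<integral>\<^sup>+z\<in>E. f z \<partial>dA) < top" for E using set_nn_integral_finite[OF fin] by simp
  have "(\<integral>\<^sup>+z\<in>box_D k j. f z \<partial>dA) = (\<integral>\<^sup>+z\<in>top_D k j. f z \<partial>dA)
    + ((\<integral>\<^sup>+z\<in>box_D (Suc k) (2 * j). f z \<partial>dA) + (\<integral>\<^sup>+z\<in>box_D (Suc k) (2 * j + 1). f z \<partial>dA))"
    unfolding box_D_split(1)[of k j]
    using nn_integral_disjoint_pair[of f dA "top_D k j" "box_D (Suc k) (2 * j) \<union> box_D (Suc k) (2 * j + 1)"]
      nn_integral_disjoint_pair[of f dA "box_D (Suc k) (2 * j)" "box_D (Suc k) (2 * j + 1)"]
    using box_D_split(2)[of k j] box_D_split(3)[of k j] by simp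
  thus ?thesis using fin by (simp add: enn2real_plus add.assoc)
qed

lemma weighted_measure_pos:
  assumes "u \<in> borel_measurable dA" "E \<in> sets dA" "\<And>z. 0 < (u z :: real)" "emeasure dA E > 0"
  shows "weighted_measure u E > 0"
proof (rule ccontr)
  assume "\<not> weighted_measure u E > 0"
  hence "weighted_measure u E = 0" by (simp add: not_gr_zero)
  hence "(emeasure dA E)\<^sup>2 = 0" using emeasure_weighted_Cauchy_Schwarz[OF assms(1-3)] by simp
  thus False using assms(4) by simp
qed

lemma emeasure_top_pos: "j < 2 ^ k \<Longrightarrow> emeasure dA (top_D k j) > 0"
  by (rule less_le_trans[OF _ emeasure_top]) auto

text \<open>Carleson embedding for the measure with density \<open>1 / u\<close>. The function
  averaged over the boxes is \<open>h * u\<close>, whose squared norm for this measure is the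
  integral of \<open>h^2 * u\<close>. It is applied with \<open>u = w\<close> and with
  \<open>u = inverse w\<close>.\<close>

lemma dyadic_embedding:
  fixes h :: "complex \<Rightarrow> ennreal" and u :: "complex \<Rightarrow> real"
  assumes [measurable]: "h \<in> borel_measurable dA" "u \<in> borel_measurable dA"
    and u: "\<And>z. 0 < u z" and fin: "weighted_measure (\<lambda>z. inverse (u z)) \<D> < \<infinity>"
      "(\<integral>\<^sup>+z. (h z)\<^sup>2 * ennreal (u z) \<partial>dA) < \<infinity>"
  defines "v \<equiv> \<lambda>E. enn2real (weighted_measure (\<lambda>z. inverse (u z)) E)"
  shows "(\<Sum>k<n. \<Sum>j<2^k. v (top_D k j) * (enn2real (\<integral>\<^sup>+z\<in>box_D k j. h z \<partial>dA) / v (box_D k j))\<^sup>2)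
    \<le> 4 * enn2real (\<integral>\<^sup>+z. (h z)\<^sup>2 * ennreal (u z) \<partial>dA)"
proof -
  let ?A = "\<lambda>E. enn2real (\<integral>\<^sup>+z\<in>E. h z \<partial>dA)"
  let ?B = "\<lambda>E. enn2real (\<integral>\<^sup>+z\<in>E. (h z)\<^sup>2 * ennreal (u z) \<partial>dA)"
  have disk: "(\<integral>\<^sup>+z. f z * indicator \<D> z \<partial>dA) = (\<integral>\<^sup>+z. f z \<partial>dA)" for f :: "complex \<Rightarrow> ennreal"
    by (intro nn_integral_cong) simp
  have finv: "(\<integral>\<^sup>+z. ennreal (inverse (u z)) \<partial>dA) < \<infinity>"
    using fin(1) by (simp add: weighted_measure_def disk)
  have vfin: "weighted_measure (\<lambda>z. inverse (u z)) E < \<infinity>" for E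
    unfolding weighted_measure_def by (rule set_nn_integral_finite[OF finv])
  have finB: "(\<integral>\<^sup>+z\<in>E. (h z)\<^sup>2 * ennreal (u z) \<partial>dA) < \<infinity>" for E
    by (rule set_nn_integral_finite[OF fin(2)])
  have sq: "(?A E)\<^sup>2 \<le> ?B E * v E" if [measurable]: "E \<in> sets dA" for E
  proof -
    have "(\<integral>\<^sup>+z\<in>E. h z \<partial>dA)\<^sup>2 \<le> (\<integral>\<^sup>+z\<in>E. (h z)\<^sup>2 * ennreal (u z) \<partial>dA) * weighted_measure (\<lambda>z. inverse (u z)) E"
      by (intro weighted_Cauchy_Schwarz u) measurable
    hence "enn2real ((\<integral>\<^sup>+z\<in>E. h z \<partial>dA)\<^sup>2) \<le> enn2real ((\<integral>\<^sup>+z\<in>E. (h z)\<^sup>2 * ennreal (u z) \<partial>dA) * weighted_measure (\<lambda>z. inverse (u z)) E)"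
      using finB[of E] vfin[of E] by (intro enn2real_mono) (auto simp: ennreal_mult_less_top)
    thus ?thesis by (simp add: v_def enn2real_mult power2_eq_square)
  qed
  have finh: "(\<integral>\<^sup>+z. h z \<partial>dA) < \<infinity>"
  proof -
    have "(\<integral>\<^sup>+z\<in>\<D>. h z \<partial>dA)\<^sup>2 \<le> (\<integral>\<^sup>+z\<in>\<D>. (h z)\<^sup>2 * ennreal (u z) \<partial>dA) * weighted_measure (\<lambda>z. inverse (u z)) \<D>"
      by (intro weighted_Cauchy_Schwarz u borel_in_sets_dA) auto
    also have "\<dots> < \<infinity>" using finB vfin by (auto simp: ennreal_mult_less_top)
    finally show ?thesis unfolding disk by (auto simp: power2_eq_square ennreal_mult_less_top)
  qed
  have "v (top_D k j) > 0" if "j < 2 ^ k" for k j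
    using weighted_measure_pos[of "\<lambda>z. inverse (u z)" "top_D k j"] u emeasure_top_pos[OF that] vfin[of "top_D k j"]
    by (simp add: v_def enn2real_positive_iff)
  moreover have "v (box_D k j) \<ge> v (top_D k j)" for k j
    unfolding v_def using top_subset_box vfin by (intro enn2real_mono weighted_measure_mono) auto
  ultimately have pos: "v (top_D k j) > 0" "v (box_D k j) > 0" if "j < 2 ^ k" for k j
    using that less_le_trans by blast+
  have "(\<Sum>k<n. \<Sum>j<2^k. v (top_D k j) * (?A (box_D k j) / v (box_D k j))\<^sup>2) \<le> 4 * ?B (box_D 0 0)"
  proof (rule carleson_embedding[where a = "\<lambda>k j. ?A (top_D k j)" and b = "\<lambda>k j. ?B (top_D k j)"
        and B = "\<lambda>k j. ?B (box_D k j)"])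
    show "v (box_D k j) = v (top_D k j) + v (box_D (Suc k) (2 * j)) + v (box_D (Suc k) (2 * j + 1))" for k j
      unfolding v_def weighted_measure_def by (rule box_split_integral[OF _ finv]) measurable
    show "?A (box_D k j) = ?A (top_D k j) + ?A (box_D (Suc k) (2 * j)) + ?A (box_D (Suc k) (2 * j + 1))" for k j
      by (rule box_split_integral[OF _ finh]) measurable
    show "?B (box_D k j) = ?B (top_D k j) + ?B (box_D (Suc k) (2 * j)) + ?B (box_D (Suc k) (2 * j + 1))" for k j
      by (rule box_split_integral[OF _ fin(2)]) measurable
  qed (auto intro!: pos sq)
  thus ?thesis by (simp add: box_D_0 disk)
qed

section \<open>Domination of the positive Bergman kernel by boxes\<close>

lemma fst_measurable_dA [measurable]: "fst \<in> borel_measurable (dA \<Otimes>\<^sub>M M)"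
  by (rule measurable_compose[OF measurable_fst id_measurable_dA])

lemma snd_measurable_dA [measurable]: "snd \<in> borel_measurable (M \<Otimes>\<^sub>M dA)"
  by (rule measurable_compose[OF measurable_snd id_measurable_dA])

lemma cnj_measurable [measurable]: "cnj \<in> borel_measurable borel"
  by (intro borel_measurable_continuous_onI continuous_intros)

definition bergman_pos :: "(complex \<Rightarrow> ennreal) \<Rightarrow> complex \<Rightarrow> ennreal"
  where "bergman_pos h z = (\<integral>\<^sup>+u. h u * ennreal (1 / (norm (1 - cnj u * z))\<^sup>2) \<partial>dA)"

lemma bergman_pos_measurable [measurable]:
  assumes [measurable]: "h \<in> borel_measurable dA"
  shows "bergman_pos h \<in> borel_measurable dA"
  unfolding bergman_pos_def[abs_def] by measurable

lemma norm_one_minus_cnj_mult: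
  assumes "z \<in> \<D>" "u \<in> \<D>"
  shows "1 - norm z \<le> norm (1 - cnj u * z)" "1 - norm u \<le> norm (1 - cnj u * z)" "norm (1 - cnj u * z) \<le> 2"
    "1 - cnj u * z \<noteq> 0"
proof -
  have nz: "norm z < 1" "norm u < 1" using assms by auto
  have prod: "norm u * norm z \<le> norm z" "norm u * norm z \<le> norm u"
    using nz by (auto simp: mult_left_le mult_left_le_one_le)
  have "1 - norm (cnj u * z) \<le> norm (1 - cnj u * z)" using norm_triangle_ineq2[of 1 "cnj u * z"] by simp
  thus 1: "1 - norm z \<le> norm (1 - cnj u * z)" "1 - norm u \<le> norm (1 - cnj u * z)"
    using prod by (auto simp: norm_mult)
  have "norm (1 - cnj u * z) \<le> 1 + norm (cnj u * z)" by (metis norm_triangle_ineq4 norm_one)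
  thus "norm (1 - cnj u * z) \<le> 2" using prod nz by (simp add: norm_mult)
  show "1 - cnj u * z \<noteq> 0" using 1 nz by auto
qed

lemma bergman_pos_le:
  assumes h: "h \<in> borel_measurable dA" and z: "z \<in> \<D>"
  shows "bergman_pos h z \<le> ennreal (1 / (1 - norm z)\<^sup>2) * (\<integral>\<^sup>+u. h u \<partial>dA)"
proof -
  have "bergman_pos h z \<le> (\<integral>\<^sup>+u. ennreal (1 / (1 - norm z)\<^sup>2) * h u \<partial>dA)"
    unfolding bergman_pos_def
  proof (rule nn_integral_mono)
    fix u assume "u \<in> space dA"
    hence "1 - norm z \<le> norm (1 - cnj u * z)" "0 < 1 - norm z" using norm_one_minus_cnj_mult z by auto
    hence "1 / (norm (1 - cnj u * z))\<^sup>2 \<le> 1 / (1 - norm z)\<^sup>2"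
      by (intro divide_left_mono power_mono mult_pos_pos zero_less_power) auto
    thus "h u * ennreal (1 / (cmod (1 - cnj u * z))\<^sup>2) \<le> ennreal (1 / (1 - cmod z)\<^sup>2) * h u"
      by (subst mult.commute, intro mult_right_mono ennreal_leI) auto
  qed
  thus ?thesis using h by (simp add: nn_integral_cmult)
qed

text \<open>One term suffices: at the scale \<open>k\<close> of \<open>common_box\<close> the
  denominator exceeds \<open>2^-(k+1)\<close>, so the kernel is below \<open>4 * 4 ^ k\<close>.
  Nonnegativity lets the sum over all boxes absorb the dependence of \<open>k\<close> on both
  points, and the variables become separated.\<close>

lemma kernel_le_boxes:
  assumes z: "z \<in> \<D>" and u: "u \<in> \<D>"
  shows "ennreal (1 / (norm (1 - cnj u * z))\<^sup>2)
    \<le> (\<Sum>k. \<Sum>j<2^k. \<Sum>i<3. 4 * 4 ^ k * indicator (box_D k j) z * indicator (box_D k (nbr i k j)) u)"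
    (is "_ \<le> (\<Sum>k. ?F k)")
proof -
  obtain k i where k: "norm (1 - cnj u * z) > 1 / 2 ^ Suc k" and i: "i < 3"
    and boxes: "z \<in> box_D k (cell k z)" "u \<in> box_D k (nbr i k (cell k z))"
    using common_box[OF z u] by blast
  have "1 / (norm (1 - cnj u * z))\<^sup>2 \<le> 1 / (1 / 2 ^ Suc k)\<^sup>2"
    using k by (intro divide_left_mono power_mono mult_pos_pos zero_less_power less_imp_le)
      (auto intro: order.strict_trans[rotated])
  also have "\<dots> = 4 * 4 ^ k"
    by (simp add: power_divide power_mult_distrib power2_eq_square flip: power_mult_distrib)
  finally have "ennreal (1 / (norm (1 - cnj u * z))\<^sup>2) \<le> ennreal (4 * 4 ^ k)" by (rule ennreal_leI)
  also have "\<dots> = 4 * 4 ^ k * indicator (box_D k (cell k z)) z * indicator (box_D k (nbr i k (cell k z))) u"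
    using boxes by (simp add: ennreal_mult ennreal_power[symmetric])
  also have "\<dots> \<le> (\<Sum>i<3. 4 * 4 ^ k * indicator (box_D k (cell k z)) z * indicator (box_D k (nbr i k (cell k z))) u)"
    by (rule member_le_sum) (use i in auto)
  also have "\<dots> \<le> ?F k"
    by (rule member_le_sum[of "cell k z" _ "\<lambda>j. \<Sum>i<3. 4 * 4 ^ k * indicator (box_D k j) z * indicator (box_D k (nbr i k j)) u"])
      (use cell_less in auto)
  also have "\<dots> \<le> (\<Sum>k. ?F k)"
    using sum_le_suminf[of ?F "{k}"] by simp
  finally show ?thesis .
qed

lemma bergman_pos_le_boxes:
  assumes [measurable]: "h \<in> borel_measurable dA" and z: "z \<in> \<D>"
  shows "bergman_pos h z
    \<le> (\<Sum>k. \<Sum>j<2^k. \<Sum>i<3. 4 * 4 ^ k * indicator (box_D k j) z * (\<integral>\<^sup>+u\<in>box_D k (nbr i k j). h u \<partial>dA))"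
proof -
  have "bergman_pos h z \<le> (\<integral>\<^sup>+u. (\<Sum>k. \<Sum>j<2^k. \<Sum>i<3. 4 * 4 ^ k * indicator (box_D k j) z * (h u * indicator (box_D k (nbr i k j)) u)) \<partial>dA)"
    unfolding bergman_pos_def
  proof (rule nn_integral_mono)
    fix u assume "u \<in> space dA"
    hence "h u * ennreal (1 / (norm (1 - cnj u * z))\<^sup>2)
      \<le> h u * (\<Sum>k. \<Sum>j<2^k. \<Sum>i<3. 4 * 4 ^ k * indicator (box_D k j) z * indicator (box_D k (nbr i k j)) u)"
      by (intro mult_left_mono kernel_le_boxes z) auto
    thus "h u * ennreal (1 / (norm (1 - cnj u * z))\<^sup>2)
      \<le> (\<Sum>k. \<Sum>j<2^k. \<Sum>i<3. 4 * 4 ^ k * indicator (box_D k j) z * (h u * indicator (box_D k (nbr i k j)) u))"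
      by (simp add: sum_distrib_left mult_ac flip: ennreal_suminf_cmult)
  qed
  also have "\<dots> = (\<Sum>k. \<Sum>j<2^k. \<Sum>i<3. 4 * 4 ^ k * indicator (box_D k j) z * (\<integral>\<^sup>+u\<in>box_D k (nbr i k j). h u \<partial>dA))"
    by (simp add: nn_integral_suminf nn_integral_sum nn_integral_cmult)
  finally show ?thesis .
qed

section \<open>A2 estimates and boundedness of the positive operator\<close>

lemma disk_in_sets_dA [measurable]: "\<D> \<in> sets dA"
  by (rule borel_in_sets_dA) auto

text \<open>\<open>r ^ 4\<close> dominates the squared measure of the truncated ball, so the
  quotient of the A2 condition becomes a product bound, stated for every \<open>r > 0\<close>.
  Positivity at every point makes \<open>inverse\<close> a genuine dual weight.\<close>

locale A2_disk_weight =
  fixes w :: "complex \<Rightarrow> real" and C :: real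
  assumes w_measurable [measurable]: "w \<in> borel_measurable dA"
    and w_pos: "0 < w z"
    and C_pos: "0 < C"
    and A2: "a \<in> \<D> \<Longrightarrow> 0 < r \<Longrightarrow>
      weighted_measure w (\<D> \<inter> ball a r) * weighted_measure (\<lambda>z. inverse (w z)) (\<D> \<inter> ball a r) \<le> ennreal (C * r ^ 4)"
    and w_finite: "weighted_measure w \<D> < \<infinity>"
    and inv_finite: "weighted_measure (\<lambda>z. inverse (w z)) \<D> < \<infinity>"
begin

abbreviation "mu \<equiv> weighted_measure w"
abbreviation "nu \<equiv> weighted_measure (\<lambda>z. inverse (w z))"

definition wnorm2 :: "(complex \<Rightarrow> ennreal) \<Rightarrow> ennreal"
  where "wnorm2 h = (\<integral>\<^sup>+z. (h z)\<^sup>2 * ennreal (w z) \<partial>dA)"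

lemma inv_pos: "0 < inverse (w z)"
  using w_pos[of z] by simp

lemma finite_measures: "mu E < \<infinity>" "nu E < \<infinity>"
proof -
  have "mu E \<le> mu \<D>" "nu E \<le> nu \<D>" by (auto intro!: weighted_measure_mono)
  thus "mu E < \<infinity>" "nu E < \<infinity>" using w_finite inv_finite by auto
qed

text \<open>Finite dual mass of the disk turns the weighted square norm into unweighted
  integrability; this is how \<open>L^2(w)\<close> sits inside \<open>L^1(dA)\<close>.\<close>

lemma nn_integral_le_wnorm2:
  assumes [measurable]: "h \<in> borel_measurable dA"
  shows "(\<integral>\<^sup>+z. h z \<partial>dA)\<^sup>2 \<le> wnorm2 h * nu \<D>"
proof -
  have "(\<integral>\<^sup>+z\<in>\<D>. h z \<partial>dA)\<^sup>2 \<le> (\<integral>\<^sup>+z\<in>\<D>. (h z)\<^sup>2 * ennreal (w z) \<partial>dA) * nu \<D>"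
    by (intro weighted_Cauchy_Schwarz w_pos borel_in_sets_dA) auto
  moreover have "(\<integral>\<^sup>+z\<in>\<D>. f z \<partial>dA) = (\<integral>\<^sup>+z. f z \<partial>dA)" for f :: "complex \<Rightarrow> ennreal"
    by (intro nn_integral_cong) simp
  ultimately show ?thesis by (simp add: wnorm2_def)
qed

lemma nn_integral_finite:
  assumes "h \<in> borel_measurable dA" "wnorm2 h < \<infinity>"
  shows "(\<integral>\<^sup>+z. h z \<partial>dA) < \<infinity>"
proof -
  have "(\<integral>\<^sup>+z. h z \<partial>dA)\<^sup>2 < \<infinity>"
    using nn_integral_le_wnorm2[OF assms(1)] assms(2) inv_finite
    by (elim le_less_trans) (simp add: ennreal_mult_less_top)
  thus ?thesis by (auto simp: power2_eq_square ennreal_mult_less_top)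
qed

abbreviation "rmu E \<equiv> enn2real (mu E)"
abbreviation "rnu E \<equiv> enn2real (nu E)"

lemma tops_product:
  assumes "j < 2 ^ k"
  shows "1 / (4096 * 16 ^ k) \<le> rmu (top_D k j) * rnu (top_D k j)"
proof -
  have "(ennreal (1 / (64 * 4 ^ k)))\<^sup>2 \<le> (emeasure dA (top_D k j))\<^sup>2"
    by (intro power_mono emeasure_top assms) auto
  also have "\<dots> \<le> mu (top_D k j) * nu (top_D k j)"
    by (intro emeasure_weighted_Cauchy_Schwarz w_pos) measurable
  finally have "enn2real ((ennreal (1 / (64 * 4 ^ k)))\<^sup>2) \<le> enn2real (mu (top_D k j) * nu (top_D k j))"
    using finite_measures by (intro enn2real_mono) (auto simp: ennreal_mult_less_top)
  moreover have "(1 / (64 * 4 ^ k) :: real)\<^sup>2 = 1 / (4096 * 16 ^ k)"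
    by (simp add: power_divide power_mult_distrib power2_eq_square flip: power_mult_distrib)
  ultimately show ?thesis by (simp add: enn2real_mult power2_eq_square)
qed

text \<open>Both boxes lie in one ball of radius \<open>16 / 2 ^ k\<close> around a point of
  \<open>box_D k j\<close>, to which the A2 bound applies; \<open>65536 = 16 ^ 4\<close>.\<close>

lemma boxes_product:
  assumes i: "i < 3" and j: "j < 2 ^ k"
  shows "rnu (box_D k (nbr i k j)) * rmu (box_D k j) \<le> 65536 * C / 16 ^ k"
    "rmu (box_D k (nbr i k j)) * rnu (box_D k j) \<le> 65536 * C / 16 ^ k"
proof -
  have "top_D k j \<noteq> {}" using emeasure_top_pos[OF j] by auto
  then obtain p where p: "p \<in> box_D k j" using top_subset_box by blast
  hence pD: "p \<in> \<D>" by (auto simp: box_D_def)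
  let ?B = "\<D> \<inter> ball p (16 / 2 ^ k)"
  have sub: "box_D k (nbr i k j) \<subseteq> ?B" "box_D k j \<subseteq> ?B"
    using box_in_ball[OF p] i nbr_1[OF j] box_in_ball[OF p, of _ 1] by (auto simp: box_D_def)
  have "enn2real (mu ?B * nu ?B) \<le> enn2real (ennreal (C * (16 / 2 ^ k) ^ 4))"
    by (intro enn2real_mono A2 pD) auto
  hence B: "rmu ?B * rnu ?B \<le> C * (16 / 2 ^ k) ^ 4" using C_pos by (simp add: enn2real_mult)
  have le: "rmu E \<le> rmu ?B" "rnu E \<le> rnu ?B" if "E \<subseteq> ?B" for E
    using that finite_measures by (auto intro!: enn2real_mono weighted_measure_mono)
  have *: "C * (16 / 2 ^ k) ^ 4 = 65536 * C / 16 ^ k"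
    by (simp add: power_divide flip: power_mult) (simp add: power_mult mult.commute[of k])
  have "rnu (box_D k (nbr i k j)) * rmu (box_D k j) \<le> rnu ?B * rmu ?B"
    by (intro mult_mono le sub) auto
  thus "rnu (box_D k (nbr i k j)) * rmu (box_D k j) \<le> 65536 * C / 16 ^ k" using B * by (simp add: mult.commute)
  have "rmu (box_D k (nbr i k j)) * rnu (box_D k j) \<le> rmu ?B * rnu ?B"
    by (intro mult_mono le sub) auto
  thus "rmu (box_D k (nbr i k j)) * rnu (box_D k j) \<le> 65536 * C / 16 ^ k" using B * by simp
qed

text \<open>The reverse estimate holds because the opposite product \<open>mu T' nu T\<close> is controlled by the
  \<open>A\<^sub>2\<close> condition while \<open>mu T nu T\<close> and \<open>mu T' nu T'\<close> are bounded below by Cauchy--Schwarz.\<close>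

lemma neighbour_tops_product:
  assumes i: "i < 3" and j: "j < 2 ^ k"
  shows "1 / (4096\<^sup>2 * (65536 * C) * 16 ^ k) \<le> rnu (top_D k (nbr i k j)) * rmu (top_D k j)"
proof -
  let ?j = "nbr i k j" and ?D = "65536 * C"
  have Dp: "?D > 0" using C_pos by simp
  have le: "rmu (top_D k l) \<le> rmu (box_D k l)" "rnu (top_D k l) \<le> rnu (box_D k l)" for l
    using top_subset_box finite_measures by (auto intro!: enn2real_mono weighted_measure_mono)
  have up: "rmu (top_D k ?j) * rnu (top_D k j) \<le> ?D / 16 ^ k"
    by (rule order.trans[OF mult_mono[OF le] boxes_product(2)[OF i j]]) auto
  have lo: "1 / (4096 * 16 ^ k) \<le> rmu (top_D k ?j) * rnu (top_D k ?j)" "1 / (4096 * 16 ^ k) \<le> rmu (top_D k j) * rnu (top_D k j)"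
    using tops_product nbr_less j by auto
  have nn: "0 \<le> rnu (top_D k ?j) * rmu (top_D k j)" by simp
  have "(1 / (4096 * 16 ^ k)) * (1 / (4096 * 16 ^ k)) \<le> (rmu (top_D k ?j) * rnu (top_D k ?j)) * (rmu (top_D k j) * rnu (top_D k j))"
    using lo by (intro mult_mono) auto
  also have "\<dots> = (rnu (top_D k ?j) * rmu (top_D k j)) * (rmu (top_D k ?j) * rnu (top_D k j))" by simp
  also have "\<dots> \<le> (rnu (top_D k ?j) * rmu (top_D k j)) * (?D / 16 ^ k)"
    by (rule mult_left_mono[OF up nn])
  finally have "(1 / (4096 * 16 ^ k)) * (1 / (4096 * 16 ^ k)) / (?D / 16 ^ k) \<le> rnu (top_D k ?j) * rmu (top_D k j)"
    using Dp by (subst pos_divide_le_eq) auto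
  moreover have "(1 / (4096 * 16 ^ k)) * (1 / (4096 * 16 ^ k)) / (?D / 16 ^ k) = 1 / (4096\<^sup>2 * ?D * 16 ^ k)"
    using Dp by (simp add: field_simps power2_eq_square)
  ultimately show ?thesis by metis
qed

text \<open>With \<open>D = 65536 * C\<close>, the factor \<open>D\<close> comes from
  \<open>boxes_product\<close> and \<open>4096 * sqrt D\<close> from the square root of
  \<open>neighbour_tops_product\<close>.\<close>

definition bilin_const :: real
  where "bilin_const = 4096 * (65536 * C) * sqrt (65536 * C)"

lemma bilin_const_pos: "bilin_const > 0"
  using C_pos by (simp add: bilin_const_def)

text \<open>\<open>x\<close> and \<open>y\<close> will be averages over boxes, so the right-hand
  side has the shape for Cauchy-Schwarz followed by the two embeddings. The powers balance:
  \<open>4 ^ k / 16 ^ k\<close> against the factor \<open>4 ^ k\<close> gained from the top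
  halves.\<close>

lemma box_term_bound:
  assumes i: "i < 3" and j: "j < 2 ^ k" and xy: "0 \<le> x" "0 \<le> y"
  shows "4 ^ k * (rnu (box_D k (nbr i k j)) * x) * (rmu (box_D k j) * y)
    \<le> bilin_const * ((sqrt (rnu (top_D k (nbr i k j))) * x) * (sqrt (rmu (top_D k j)) * y))"
proof -
  let ?D = "65536 * C" and ?s = "rnu (top_D k (nbr i k j)) * rmu (top_D k j)"
  have Dp: "?D > 0" using C_pos by simp
  have "sqrt (1 / (4096\<^sup>2 * ?D * 16 ^ k)) \<le> sqrt ?s"
    by (intro real_sqrt_le_mono neighbour_tops_product i j)
  moreover have "sqrt (1 / (4096\<^sup>2 * ?D * 16 ^ k)) = 1 / (4096 * sqrt ?D * 4 ^ k)"
  proof (rule real_sqrt_unique)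
    show "(1 / (4096 * sqrt ?D * 4 ^ k))\<^sup>2 = 1 / (4096\<^sup>2 * ?D * 16 ^ k)"
      using Dp by (simp add: power_divide power_mult_distrib power2_eq_square flip: power_mult_distrib)
  qed (use Dp in simp)
  ultimately have "1 / (4096 * sqrt ?D * 4 ^ k) \<le> sqrt ?s" by (simp only:)
  hence "1 \<le> sqrt ?s * (4096 * sqrt ?D * 4 ^ k)" using Dp by (subst (asm) pos_divide_le_eq) auto
  hence s: "1 \<le> 4096 * sqrt ?D * 4 ^ k * sqrt ?s" by (simp only: mult.commute)
  have "4 ^ k * (rnu (box_D k (nbr i k j)) * x) * (rmu (box_D k j) * y)
      = 4 ^ k * (rnu (box_D k (nbr i k j)) * rmu (box_D k j)) * (x * y)" by simp
  also have "\<dots> \<le> 4 ^ k * (?D / 16 ^ k) * (x * y)"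
    using xy by (intro mult_right_mono mult_left_mono boxes_product(1) i j) auto
  also have "\<dots> = ?D / 4 ^ k * (x * y) * 1"
  proof -
    have "(16::real) ^ k = 4 ^ k * 4 ^ k" by (simp flip: power_mult_distrib)
    thus ?thesis by simp
  qed
  also have "\<dots> \<le> ?D / 4 ^ k * (x * y) * (4096 * sqrt ?D * 4 ^ k * sqrt ?s)"
    using xy Dp s by (intro mult_left_mono) auto
  also have "\<dots> = bilin_const * ((sqrt (rnu (top_D k (nbr i k j))) * x) * (sqrt (rmu (top_D k j)) * y))"
    by (simp add: bilin_const_def real_sqrt_mult)
  finally show ?thesis .
qed

lemma box_bilinear_real:
  fixes h psi :: "complex \<Rightarrow> ennreal"
  assumes i: "i < 3" and [measurable]: "h \<in> borel_measurable dA" "psi \<in> borel_measurable dA"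
    and fin: "wnorm2 h < \<infinity>" "wnorm2 psi < \<infinity>"
  shows "(\<Sum>k<N. \<Sum>j<2^k. 4 ^ k * enn2real (\<integral>\<^sup>+z\<in>box_D k (nbr i k j). h z \<partial>dA)
        * enn2real (\<integral>\<^sup>+z\<in>box_D k j. psi z * ennreal (w z) \<partial>dA))
    \<le> 4 * bilin_const * sqrt (enn2real (wnorm2 h) * enn2real (wnorm2 psi))"
proof -
  define a where "a k j = enn2real (\<integral>\<^sup>+z\<in>box_D k j. h z \<partial>dA)" for k j
  define b where "b k j = enn2real (\<integral>\<^sup>+z\<in>box_D k j. psi z * ennreal (w z) \<partial>dA)" for k j
  define x where "x k j = a k j / rnu (box_D k j)" for k j
  define y where "y k j = b k j / rmu (box_D k j)" for k j
  let ?I = "Sigma {..<N} (\<lambda>k. {..<2^k::nat})"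
  \<comment> \<open>\<open>psi * w\<close> has the same norm in \<open>L^2(1/w)\<close> as
    \<open>psi\<close> has in \<open>L^2(w)\<close>; this makes the embedding with the roles of the
    weights exchanged applicable to \<open>psi\<close>.\<close>
  have wnorm2_psi: "wnorm2 psi = (\<integral>\<^sup>+z. (psi z * ennreal (w z))\<^sup>2 * ennreal (inverse (w z)) \<partial>dA)"
  proof -
    have "(psi z * ennreal (w z))\<^sup>2 * ennreal (inverse (w z)) = (psi z)\<^sup>2 * ennreal (w z)" for z
    proof -
      have "ennreal (w z) * ennreal (inverse (w z)) = 1"
        using w_pos[of z] by (simp flip: ennreal_mult)
      thus ?thesis by (simp add: power2_eq_square mult_ac)
    qed
    thus ?thesis by (simp add: wnorm2_def)
  qed
  have emb1: "(\<Sum>k<N. \<Sum>j<2^k. rnu (top_D k j) * (x k j)\<^sup>2) \<le> 4 * enn2real (wnorm2 h)"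
    unfolding x_def a_def wnorm2_def
    by (rule dyadic_embedding) (use w_pos inv_finite fin in \<open>auto simp: wnorm2_def\<close>)
  have emb2: "(\<Sum>k<N. \<Sum>j<2^k. rmu (top_D k j) * (y k j)\<^sup>2) \<le> 4 * enn2real (wnorm2 psi)"
    using dyadic_embedding[of "\<lambda>z. psi z * ennreal (w z)" "\<lambda>z. inverse (w z)" N] inv_pos w_finite fin(2)
    unfolding y_def b_def wnorm2_psi by simp
  have box_pos: "rnu (box_D k j) > 0" "rmu (box_D k j) > 0" if "j < 2 ^ k" for k j
  proof -
    have "emeasure dA (box_D k j) > 0"
      using emeasure_top_pos[OF that] emeasure_mono[OF top_subset_box[of k j], of dA] by (auto intro: less_le_trans)
    hence "nu (box_D k j) > 0" "mu (box_D k j) > 0"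
      using w_pos inv_pos by (auto intro!: weighted_measure_pos)
    thus "rnu (box_D k j) > 0" "rmu (box_D k j) > 0"
      using finite_measures by (auto simp: enn2real_positive_iff)
  qed
  have nonneg: "x k j \<ge> 0" "y k j \<ge> 0" for k j unfolding x_def y_def a_def b_def by auto
  have summand: "4 ^ k * a k (nbr i k j) * b k j
      \<le> bilin_const * ((sqrt (rnu (top_D k (nbr i k j))) * x k (nbr i k j)) * (sqrt (rmu (top_D k j)) * y k j))"
    if j: "j < 2 ^ k" for k j
  proof -
    have "a k (nbr i k j) = rnu (box_D k (nbr i k j)) * x k (nbr i k j)" "b k j = rmu (box_D k j) * y k j"
      using box_pos[OF nbr_less, of k i j] box_pos[OF j] by (auto simp: x_def y_def)
    thus ?thesis using box_term_bound[OF i j nonneg(1) nonneg(2), of "nbr i k j" j] nonneg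
      by (simp only:) (intro box_term_bound i j nonneg)
  qed
  have "(\<Sum>k<N. \<Sum>j<2^k. 4 ^ k * a k (nbr i k j) * b k j)
      \<le> (\<Sum>k<N. \<Sum>j<2^k. bilin_const * ((sqrt (rnu (top_D k (nbr i k j))) * x k (nbr i k j)) * (sqrt (rmu (top_D k j)) * y k j)))"
    by (intro sum_mono summand) auto
  also have "\<dots> = bilin_const * (\<Sum>(k,j)\<in>?I. (sqrt (rnu (top_D k (nbr i k j))) * x k (nbr i k j)) * (sqrt (rmu (top_D k j)) * y k j))"
    by (simp add: sum.Sigma sum_distrib_left split_def)
  also have "\<dots> \<le> bilin_const * (sqrt (4 * enn2real (wnorm2 h)) * sqrt (4 * enn2real (wnorm2 psi)))"
  proof (rule mult_left_mono)
    let ?f = "\<lambda>(k,j). sqrt (rnu (top_D k (nbr i k j))) * x k (nbr i k j)"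
    let ?g = "\<lambda>(k,j). sqrt (rmu (top_D k j)) * y k j"
    have f: "(\<Sum>p\<in>?I. (?f p)\<^sup>2) \<le> 4 * enn2real (wnorm2 h)"
    proof -
      have "(\<Sum>p\<in>?I. (?f p)\<^sup>2) = (\<Sum>k<N. \<Sum>j<2^k. rnu (top_D k (nbr i k j)) * (x k (nbr i k j))\<^sup>2)"
        by (simp add: sum.Sigma split_def power_mult_distrib)
      \<comment> \<open>\<open>nbr i k\<close> permutes the cells of each level, so the shifted sum
        is the sum that \<open>emb1\<close> bounds.\<close>
      also have "\<dots> = (\<Sum>k<N. \<Sum>j<2^k. rnu (top_D k j) * (x k j)\<^sup>2)"
        by (intro sum.cong sum.reindex_bij_betw[OF bij_betw_nbr, where g = "\<lambda>l. rnu (top_D _ l) * (x _ l)\<^sup>2"] refl)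
      finally show ?thesis using emb1 by simp
    qed
    have g: "(\<Sum>p\<in>?I. (?g p)\<^sup>2) \<le> 4 * enn2real (wnorm2 psi)"
      using emb2 by (simp add: sum.Sigma split_def power_mult_distrib)
    have "(\<Sum>p\<in>?I. ?f p * ?g p)\<^sup>2 \<le> (\<Sum>p\<in>?I. (?f p)\<^sup>2) * (\<Sum>p\<in>?I. (?g p)\<^sup>2)"
      by (rule Cauchy_Schwarz_ineq_sum)
    also have "\<dots> \<le> (4 * enn2real (wnorm2 h)) * (4 * enn2real (wnorm2 psi))"
      by (intro mult_mono f g sum_nonneg) auto
    finally have "(\<Sum>p\<in>?I. ?f p * ?g p) \<le> sqrt ((4 * enn2real (wnorm2 h)) * (4 * enn2real (wnorm2 psi)))"
      by (rule real_le_rsqrt)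
    thus "(\<Sum>(k,j)\<in>?I. (sqrt (rnu (top_D k (nbr i k j))) * x k (nbr i k j)) * (sqrt (rmu (top_D k j)) * y k j))
      \<le> sqrt (4 * enn2real (wnorm2 h)) * sqrt (4 * enn2real (wnorm2 psi))"
      by (simp add: real_sqrt_mult split_def)
  qed (use bilin_const_pos in simp)
  also have "\<dots> = 4 * bilin_const * sqrt (enn2real (wnorm2 h) * enn2real (wnorm2 psi))"
    by (simp add: real_sqrt_mult)
  finally show ?thesis by (simp add: a_def b_def)
qed

lemma box_bilinear:
  fixes h psi :: "complex \<Rightarrow> ennreal"
  assumes i: "i < 3" and [measurable]: "h \<in> borel_measurable dA" "psi \<in> borel_measurable dA"
    and fin: "wnorm2 h < \<infinity>" "wnorm2 psi < \<infinity>"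
  shows "(\<Sum>k. \<Sum>j<2^k. 4 ^ k * (\<integral>\<^sup>+z\<in>box_D k (nbr i k j). h z \<partial>dA)
        * (\<integral>\<^sup>+z\<in>box_D k j. psi z * ennreal (w z) \<partial>dA))
    \<le> ennreal (4 * bilin_const * sqrt (enn2real (wnorm2 h) * enn2real (wnorm2 psi)))"
proof -
  have finw: "(\<integral>\<^sup>+z. psi z * ennreal (w z) \<partial>dA) < \<infinity>"
  proof -
    have "(\<integral>\<^sup>+z. psi z * ennreal (w z) \<partial>dA) \<le> (\<integral>\<^sup>+z. (psi z)\<^sup>2 * ennreal (w z) + ennreal (w z) * indicator \<D> z \<partial>dA)"
    proof (rule nn_integral_mono)
      fix z assume z: "z \<in> space dA"
      \<comment> \<open>Reduces finiteness of the integral of \<open>psi * w\<close> to that of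
        \<open>wnorm2 psi\<close> and \<open>mu \<D>\<close>.\<close>
      have "psi z \<le> (psi z)\<^sup>2 + 1"
      proof (cases "psi z \<le> 1")
        case False
        hence "psi z * 1 \<le> psi z * psi z" by (intro mult_left_mono) auto
        thus ?thesis by (simp add: power2_eq_square add_increasing2)
      qed (simp add: add_increasing)
      hence "psi z * ennreal (w z) \<le> ((psi z)\<^sup>2 + 1) * ennreal (w z)" by (intro mult_right_mono) auto
      thus "psi z * ennreal (w z) \<le> (psi z)\<^sup>2 * ennreal (w z) + ennreal (w z) * indicator \<D> z"
        using z by (simp add: distrib_right)
    qed
    also have "\<dots> = wnorm2 psi + mu \<D>"
      unfolding wnorm2_def weighted_measure_def by (intro nn_integral_add) measurable
    also have "\<dots> < \<infinity>" using fin w_finite by simp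
    finally show ?thesis .
  qed
  have e1: "(\<integral>\<^sup>+z\<in>E. h z \<partial>dA) = ennreal (enn2real (\<integral>\<^sup>+z\<in>E. h z \<partial>dA))" for E
    using set_nn_integral_finite[OF nn_integral_finite[OF _ fin(1)], of E] by simp
  have e2: "(\<integral>\<^sup>+z\<in>E. psi z * ennreal (w z) \<partial>dA) = ennreal (enn2real (\<integral>\<^sup>+z\<in>E. psi z * ennreal (w z) \<partial>dA))" for E
    using set_nn_integral_finite[OF finw, of E] by simp
  show ?thesis
  proof (subst suminf_eq_SUP, rule SUP_least)
    fix N
    have "(\<Sum>k<N. \<Sum>j<2^k. 4 ^ k * (\<integral>\<^sup>+z\<in>box_D k (nbr i k j). h z \<partial>dA)
        * (\<integral>\<^sup>+z\<in>box_D k j. psi z * ennreal (w z) \<partial>dA))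
      = ennreal (\<Sum>k<N. \<Sum>j<2^k. 4 ^ k * enn2real (\<integral>\<^sup>+z\<in>box_D k (nbr i k j). h z \<partial>dA)
        * enn2real (\<integral>\<^sup>+z\<in>box_D k j. psi z * ennreal (w z) \<partial>dA))"
      by (subst e1, subst e2) (simp add: ennreal_mult ennreal_power[symmetric] sum_nonneg flip: sum_ennreal)
    also have "\<dots> \<le> ennreal (4 * bilin_const * sqrt (enn2real (wnorm2 h) * enn2real (wnorm2 psi)))"
      by (intro ennreal_leI box_bilinear_real i fin) auto
    finally show "(\<Sum>k<N. \<Sum>j<2^k. 4 ^ k * (\<integral>\<^sup>+z\<in>box_D k (nbr i k j). h z \<partial>dA)
        * (\<integral>\<^sup>+z\<in>box_D k j. psi z * ennreal (w z) \<partial>dA))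
      \<le> ennreal (4 * bilin_const * sqrt (enn2real (wnorm2 h) * enn2real (wnorm2 psi)))" .
  qed
qed

text \<open>\<open>48 = 4 * 3 * 4\<close>: the 4 in the kernel bound \<open>4 * 4 ^ k\<close>, the
  three neighbours, and the 4 of \<open>box_bilinear\<close>.\<close>

lemma bergman_pos_bilinear:
  fixes h psi :: "complex \<Rightarrow> ennreal"
  assumes [measurable]: "h \<in> borel_measurable dA" "psi \<in> borel_measurable dA"
    and fin: "wnorm2 h < \<infinity>" "wnorm2 psi < \<infinity>"
  shows "(\<integral>\<^sup>+z. bergman_pos h z * psi z * ennreal (w z) \<partial>dA)
    \<le> ennreal (48 * bilin_const * sqrt (enn2real (wnorm2 h) * enn2real (wnorm2 psi)))"
proof -
  let ?H = "\<lambda>i k j. \<integral>\<^sup>+z\<in>box_D k (nbr i k j). h z \<partial>dA"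
  let ?P = "\<lambda>k j. \<integral>\<^sup>+z\<in>box_D k j. psi z * ennreal (w z) \<partial>dA"
  have "(\<integral>\<^sup>+z. bergman_pos h z * psi z * ennreal (w z) \<partial>dA)
    \<le> (\<integral>\<^sup>+z. (\<Sum>k. \<Sum>j<2^k. \<Sum>i<3. 4 * 4 ^ k * ?H i k j * (psi z * ennreal (w z) * indicator (box_D k j) z)) \<partial>dA)"
  proof (rule nn_integral_mono)
    fix z assume "z \<in> space dA"
    hence "psi z * ennreal (w z) * bergman_pos h z \<le> psi z * ennreal (w z) *
      (\<Sum>k. \<Sum>j<2^k. \<Sum>i<3. 4 * 4 ^ k * indicator (box_D k j) z * ?H i k j)"
      by (intro mult_left_mono bergman_pos_le_boxes) auto
    thus "bergman_pos h z * psi z * ennreal (w z)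
      \<le> (\<Sum>k. \<Sum>j<2^k. \<Sum>i<3. 4 * 4 ^ k * ?H i k j * (psi z * ennreal (w z) * indicator (box_D k j) z))"
      by (simp add: sum_distrib_left mult_ac flip: ennreal_suminf_cmult)
  qed
  also have "\<dots> = (\<Sum>k. \<Sum>j<2^k. \<Sum>i<3. 4 * (4 ^ k * ?H i k j * ?P k j))"
    by (simp add: nn_integral_suminf nn_integral_sum nn_integral_cmult mult.assoc)
  also have "\<dots> = (\<Sum>k. \<Sum>i<3. 4 * (\<Sum>j<2^k. 4 ^ k * ?H i k j * ?P k j))"
    by (subst sum.swap) (simp add: sum_distrib_left)
  also have "\<dots> = (\<Sum>i<3. 4 * (\<Sum>k. \<Sum>j<2^k. 4 ^ k * ?H i k j * ?P k j))"
    by (subst suminf_sum) (auto simp: ennreal_suminf_cmult)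
  also have "\<dots> \<le> (\<Sum>i<(3::nat). 4 * ennreal (4 * bilin_const * sqrt (enn2real (wnorm2 h) * enn2real (wnorm2 psi))))"
    by (intro sum_mono mult_left_mono box_bilinear fin) auto
  also have "\<dots> = ennreal (48 * bilin_const * sqrt (enn2real (wnorm2 h) * enn2real (wnorm2 psi)))"
  proof -
    define X where "X = 4 * bilin_const * sqrt (enn2real (wnorm2 h) * enn2real (wnorm2 psi))"
    have X: "X \<ge> 0" using bilin_const_pos by (simp add: X_def)
    have "(\<Sum>i<(3::nat). 4 * ennreal X) = ennreal 12 * ennreal X" by simp
    also have "\<dots> = ennreal (12 * X)" by (rule ennreal_mult[symmetric]) (use X in auto)
    also have "12 * X = 48 * bilin_const * sqrt (enn2real (wnorm2 h) * enn2real (wnorm2 psi))"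
      by (simp add: X_def)
    finally show ?thesis by (simp only: X_def)
  qed
  finally show ?thesis .
qed

definition op_const :: real
  where "op_const = (48 * bilin_const)\<^sup>2"

text \<open>Duality, testing \<open>bergman_pos h\<close> against itself. The bilinear bound has the
  form \<open>X \<le> c * sqrt (Y * X)\<close>, from which \<open>X\<close> can be cancelled only
  when it is finite; hence the test function is truncated at height \<open>N\<close>, and monotone
  convergence removes the truncation.\<close>

lemma bergman_pos_bounded:
  fixes h :: "complex \<Rightarrow> ennreal"
  assumes [measurable]: "h \<in> borel_measurable dA" and fin: "wnorm2 h < \<infinity>"
  shows "wnorm2 (bergman_pos h) \<le> ennreal op_const * wnorm2 h"
proof -
  define psi where "psi N z = min (bergman_pos h z) (of_nat N)" for N :: nat and z
  have [measurable]: "psi N \<in> borel_measurable dA" for N unfolding psi_def by measurable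
  have bound: "wnorm2 (psi N) \<le> ennreal op_const * wnorm2 h" for N
  proof -
    have "wnorm2 (psi N) \<le> (\<integral>\<^sup>+z. (of_nat N)\<^sup>2 * (ennreal (w z) * indicator \<D> z) \<partial>dA)"
      unfolding wnorm2_def psi_def
      by (intro nn_integral_mono) (auto intro!: mult_right_mono power_mono)
    also have "\<dots> = (of_nat N)\<^sup>2 * mu \<D>"
      unfolding weighted_measure_def by (intro nn_integral_cmult) measurable
    also have "\<dots> < \<infinity>" using w_finite by (simp add: ennreal_mult_less_top power2_eq_square of_nat_less_top)
    finally have f: "wnorm2 (psi N) < \<infinity>" .
    define X where "X = enn2real (wnorm2 (psi N))"
    define Y where "Y = enn2real (wnorm2 h)"
    have X: "wnorm2 (psi N) = ennreal X" "X \<ge> 0" using f by (auto simp: X_def)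
    have Y: "wnorm2 h = ennreal Y" "Y \<ge> 0" using fin by (auto simp: Y_def)
    have "ennreal X \<le> (\<integral>\<^sup>+z. bergman_pos h z * psi N z * ennreal (w z) \<partial>dA)"
      unfolding X(1)[symmetric] wnorm2_def power2_eq_square
      by (intro nn_integral_mono mult_right_mono) (auto simp: psi_def)
    also have "\<dots> \<le> ennreal (48 * bilin_const * sqrt (Y * X))"
      unfolding X_def Y_def by (intro bergman_pos_bilinear fin f) auto
    finally have "X \<le> 48 * bilin_const * sqrt (Y * X)"
      using bilin_const_pos X Y by (simp add: ennreal_le_iff)
    hence "X * X \<le> (48 * bilin_const * sqrt (Y * X)) * (48 * bilin_const * sqrt (Y * X))"
      using X by (intro mult_mono) auto
    also have "\<dots> = (48 * bilin_const)\<^sup>2 * (sqrt (Y * X))\<^sup>2" by (simp add: power2_eq_square)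
    also have "\<dots> = op_const * Y * X" using X Y by (simp add: op_const_def)
    finally have "X \<le> op_const * Y"
      using X Y by (cases "X = 0") (auto simp: op_const_def)
    thus ?thesis unfolding X Y using X Y by (simp add: op_const_def ennreal_leI flip: ennreal_mult)
  qed
  have "wnorm2 (bergman_pos h) = (\<integral>\<^sup>+z. (SUP N. (psi N z)\<^sup>2 * ennreal (w z)) \<partial>dA)"
    unfolding wnorm2_def
  proof (intro nn_integral_cong antisym)
    fix z assume z: "z \<in> space dA"
    have "bergman_pos h z \<le> ennreal (1 / (1 - norm z)\<^sup>2) * (\<integral>\<^sup>+u. h u \<partial>dA)"
      using z by (intro bergman_pos_le) auto
    also have "\<dots> < \<infinity>" using nn_integral_finite[OF _ fin] by (simp add: ennreal_mult_less_top)
    finally have "bergman_pos h z < top" by simp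
    then obtain N where "bergman_pos h z < of_nat N" using ennreal_Ex_less_of_nat by auto
    hence "psi N z = bergman_pos h z" by (simp add: psi_def)
    thus "(bergman_pos h z)\<^sup>2 * ennreal (w z) \<le> (SUP N. (psi N z)\<^sup>2 * ennreal (w z))"
      by (intro SUP_upper2[of N]) auto
    show "(SUP N. (psi N z)\<^sup>2 * ennreal (w z)) \<le> (bergman_pos h z)\<^sup>2 * ennreal (w z)"
      by (intro SUP_least mult_right_mono power_mono) (auto simp: psi_def)
  qed
  also have "\<dots> = (SUP N. \<integral>\<^sup>+z. (psi N z)\<^sup>2 * ennreal (w z) \<partial>dA)"
  proof (rule nn_integral_monotone_convergence_SUP)
    show "incseq (\<lambda>N z. (psi N z)\<^sup>2 * ennreal (w z))"
      unfolding psi_def by (intro incseq_SucI le_funI mult_right_mono power_mono min.mono) auto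
  qed auto
  also have "\<dots> \<le> ennreal op_const * wnorm2 h"
    using bound by (intro SUP_least) (auto simp: wnorm2_def)
  finally show ?thesis .
qed

end

section \<open>The reproducing formula\<close>

text \<open>An isometry with \<open>real^2\<close>, where \<open>measure_orthogonal_image\<close>
  applies; it carries rotation invariance over to \<open>complex\<close>.\<close>

definition vec_of_complex :: "complex \<Rightarrow> real^2"
  where "vec_of_complex z = vector [Re z, Im z]"

definition complex_of_vec :: "real^2 \<Rightarrow> complex"
  where "complex_of_vec v = Complex (v $ 1) (v $ 2)"

lemma complex_of_vec_of_complex [simp]: "complex_of_vec (vec_of_complex z) = z"
  by (simp add: complex_of_vec_def vec_of_complex_def)

lemma vec_of_complex_of_vec [simp]: "vec_of_complex (complex_of_vec v) = v"
  by (simp add: complex_of_vec_def vec_of_complex_def vec_eq_iff forall_2)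

lemma norm_complex_of_vec [simp]: "norm (complex_of_vec v) = norm v"
  by (simp add: complex_of_vec_def norm_vec_def L2_set_def sum_2 cmod_def)

lemma linear_complex_of_vec: "linear complex_of_vec"
  by (intro linearI) (auto simp: complex_of_vec_def complex_eq_iff)

lemma linear_vec_of_complex: "linear vec_of_complex"
  by (intro linearI) (auto simp: vec_of_complex_def vec_eq_iff forall_2)

lemma complex_of_vec_measurable [measurable]: "complex_of_vec \<in> borel_measurable borel"
  by (intro borel_measurable_continuous_onI linear_continuous_on linear_conv_bounded_linear[THEN iffD1] linear_complex_of_vec)

lemma lborel_complex: "(lborel :: complex measure) = distr lborel borel complex_of_vec"
proof (rule lborel_eqI)
  fix l u :: complex assume le: "\<And>b. b \<in> Basis \<Longrightarrow> l \<bullet> b \<le> u \<bullet> b"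
  have le': "Re l \<le> Re u" "Im l \<le> Im u" using le[of 1] le[of \<i>] by (auto simp: Basis_complex_def)
  have B2: "(Basis :: (real^2) set) = {axis 1 1, axis 2 1}"
    by (auto simp: Basis_vec_def UNIV_2)
  have ax: "axis 1 1 \<noteq> (axis 2 1 :: real^2)" by (simp add: axis_eq_axis)
  have "complex_of_vec -` box l u = box (vec_of_complex l) (vec_of_complex u)"
    by (auto simp: box_def B2 Basis_complex_def complex_of_vec_def vec_of_complex_def inner_axis)
  hence "emeasure (distr lborel borel complex_of_vec) (box l u) = emeasure lborel (box (vec_of_complex l) (vec_of_complex u))"
    by (simp add: emeasure_distr)
  also have "\<dots> = (\<Prod>b\<in>Basis. (vec_of_complex u - vec_of_complex l) \<bullet> b)"
    using le' by (intro emeasure_lborel_box) (auto simp: B2 vec_of_complex_def inner_axis)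
  also have "(\<Prod>b\<in>Basis. (vec_of_complex u - vec_of_complex l) \<bullet> b) = (\<Prod>b\<in>Basis. (u - l) \<bullet> b)"
    unfolding B2 using ax by (simp add: vec_of_complex_def inner_axis Basis_complex_def)
  finally show "emeasure (distr lborel borel complex_of_vec) (box l u) = ennreal (\<Prod>b\<in>Basis. (u - l) \<bullet> b)" .
qed simp

text \<open>Seen in \<open>real^2\<close>, the preimage of a box under multiplication by
  \<open>c\<close> is the image of the box under the orthogonal map \<open>T\<close>, which is
  multiplication by \<open>cnj c\<close>.\<close>

lemma lborel_rotation:
  fixes c :: complex
  assumes c: "norm c = 1"
  shows "distr lborel borel ((*) c) = lborel"
proof (rule lborel_eqI[symmetric])
  fix l u :: complex assume le: "\<And>b. b \<in> Basis \<Longrightarrow> l \<bullet> b \<le> u \<bullet> b"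
  define T where "T v = vec_of_complex (cnj c * complex_of_vec v)" for v
  have cc: "c * cnj c = 1" using c by (simp add: complex_mult_cnj cmod_def complex_eq_iff)
  have "orthogonal_transformation T"
    unfolding orthogonal_transformation
  proof
    show "linear T"
      unfolding T_def using linear_compose[OF linear_compose[OF linear_complex_of_vec, of "(*) (cnj c)"] linear_vec_of_complex]
      by (simp add: o_def linear_times)
    show "\<forall>v. norm (T v) = norm v"
    proof
      fix v
      have "norm (T v) = norm (complex_of_vec (T v))" by simp
      also have "\<dots> = norm v" unfolding T_def complex_of_vec_of_complex by (simp add: norm_mult c)
      finally show "norm (T v) = norm v" .
    qed
  qed
  define S where "S = complex_of_vec -` box l u"
  have Sborel: "S \<in> sets borel" unfolding S_def by (rule measurable_sets_borel[OF complex_of_vec_measurable]) auto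
  have Sfin: "emeasure lborel S = emeasure lborel (box l u)"
  proof -
    have "emeasure (distr lborel borel complex_of_vec) (box l u) = emeasure lborel S"
      by (simp add: emeasure_distr S_def)
    thus ?thesis by (simp add: lborel_complex[symmetric])
  qed
  have SL: "S \<in> lmeasurable"
    using Sborel Sfin emeasure_lborel_box_finite[of l u] by (intro fmeasurableI) auto
  have pre: "complex_of_vec -` ((*) c -` box l u) = T ` S"
  proof (intro set_eqI iffI)
    fix v assume "v \<in> complex_of_vec -` ((*) c -` box l u)"
    hence "vec_of_complex (c * complex_of_vec v) \<in> S" by (simp add: S_def)
    moreover have "T (vec_of_complex (c * complex_of_vec v)) = v"
      unfolding T_def using cc by (simp add: mult.commute[of "cnj c"] mult.assoc[symmetric] mult.left_commute)
    ultimately show "v \<in> T ` S" by force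
  next
    fix v assume "v \<in> T ` S"
    thus "v \<in> complex_of_vec -` ((*) c -` box l u)"
      using cc by (auto simp: S_def T_def mult.assoc[symmetric])
  qed
  have m: "(*) c \<in> borel_measurable borel" by measurable
  have mS: "(*) c -` box l u \<in> sets borel" using measurable_sets_borel[OF m] by simp
  have TSb: "T ` S \<in> sets borel" unfolding pre[symmetric] using measurable_sets_borel[OF complex_of_vec_measurable mS] .
  have TS: "T ` S \<in> lmeasurable" using \<open>orthogonal_transformation T\<close> SL by (rule measurable_orthogonal_image)
  have "emeasure (distr lborel borel ((*) c)) (box l u) = emeasure lborel ((*) c -` box l u)"
    by (simp add: emeasure_distr)
  also have "\<dots> = emeasure lborel (T ` S)"
    by (subst lborel_complex) (simp add: emeasure_distr mS pre)
  also have "\<dots> = emeasure lebesgue (T ` S)" using TSb by simp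
  also have "\<dots> = ennreal (measure lebesgue (T ` S))" using TS by (rule emeasure_eq_measure2)
  also have "\<dots> = ennreal (measure lebesgue S)"
    using \<open>orthogonal_transformation T\<close> SL by (simp add: measure_orthogonal_image)
  also have "\<dots> = emeasure lebesgue S" using SL by (simp add: emeasure_eq_measure2)
  also have "\<dots> = emeasure lborel (box l u)" using Sborel Sfin by simp
  also have "\<dots> = ennreal (\<Prod>b\<in>Basis. (u - l) \<bullet> b)" using le by (rule emeasure_lborel_box)
  finally show "emeasure (distr lborel borel ((*) c)) (box l u) = ennreal (\<Prod>b\<in>Basis. (u - l) \<bullet> b)" .
qed simp

section \<open>Integrals over concentric disks\<close>

lemma emeasure_dA_borel: "A \<in> sets borel \<Longrightarrow> A \<subseteq> \<D> \<Longrightarrow> emeasure dA A = emeasure lborel A / ennreal pi"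
  by (simp add: emeasure_dA borel_in_sets_dA)

lemma integral_dA_rotation:
  fixes f :: "complex \<Rightarrow> complex"
  assumes c: "norm c = 1" and f: "f \<in> borel_measurable borel"
  shows "(\<integral>z. f (c * z) \<partial>dA) = (\<integral>z. f z \<partial>dA)"
proof -
  have m: "(*) c \<in> borel_measurable borel" by measurable
  have mdA: "(*) c \<in> borel_measurable dA" by (rule borel_measurable_dA[OF m])
  have "distr dA borel ((*) c) = distr dA borel (\<lambda>z. z)"
  proof (rule measure_eqI)
    fix A assume "A \<in> sets (distr dA borel ((*) c))"
    hence A: "A \<in> sets borel" by simp
    have B: "(*) c -` (A \<inter> \<D>) \<in> sets borel" using measurable_sets_borel[OF m, of "A \<inter> \<D>"] A by simp
    have eq: "(*) c -` A \<inter> \<D> = (*) c -` (A \<inter> \<D>)" using c by (auto simp: norm_mult)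
    have "emeasure (distr dA borel ((*) c)) A = emeasure dA ((*) c -` (A \<inter> \<D>))"
      using A mdA eq by (simp add: emeasure_distr)
    also have "\<dots> = emeasure lborel ((*) c -` (A \<inter> \<D>)) / ennreal pi"
      using B c by (intro emeasure_dA_borel) (auto simp: norm_mult)
    also have "emeasure lborel ((*) c -` (A \<inter> \<D>)) = emeasure (distr lborel borel ((*) c)) (A \<inter> \<D>)"
      using A by (simp add: emeasure_distr)
    also have "\<dots> = emeasure lborel (A \<inter> \<D>)" by (simp add: lborel_rotation[OF c])
    also have "\<dots> / ennreal pi = emeasure dA (A \<inter> \<D>)"
      using A by (intro emeasure_dA_borel[symmetric]) auto
    also have "\<dots> = emeasure (distr dA borel (\<lambda>z. z)) A" using A by (simp add: emeasure_distr)
    finally show "emeasure (distr dA borel ((*) c)) A = emeasure (distr dA borel (\<lambda>z. z)) A" .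
  qed simp
  hence "(\<integral>z. f z \<partial>distr dA borel ((*) c)) = (\<integral>z. f z \<partial>distr dA borel (\<lambda>z. z))" by simp
  thus ?thesis using f mdA by (simp add: integral_distr)
qed

text \<open>For \<open>r < 1\<close> holomorphic functions on \<open>\<D>\<close> are bounded on the
  smaller disk and their power series converge uniformly there; the full disk is reached by a limit
  in \<open>reproducing_formula\<close>.\<close>

definition subdisk_integral :: "real \<Rightarrow> (complex \<Rightarrow> complex) \<Rightarrow> complex"
  where "subdisk_integral r f = (\<integral>w. indicator (ball 0 r) w *\<^sub>R f w \<partial>dA)"

lemma subdisk_monomial_zero:
  assumes "a \<noteq> b"
  shows "subdisk_integral r (\<lambda>w. w ^ a * cnj w ^ b) = 0"
proof -
  define d where "d = real a - real b"
  have d: "d \<noteq> 0" using assms by (simp add: d_def)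
  \<comment> \<open>The rotation that negates the integrand:
    \<open>c ^ a * cnj c ^ b = cis (d * (pi / d)) = -1\<close>, for either sign of
    \<open>d\<close>.\<close>
  define c where "c = cis (pi / d)"
  have c: "norm c = 1" by (simp add: c_def)
  have ca: "c ^ a * cnj c ^ b = -1"
  proof -
    have "c ^ a * cnj c ^ b = cis (real a * (pi / d)) * cis (- (real b * (pi / d)))"
      unfolding c_def cis_cnj Complex.DeMoivre by simp
    also have "\<dots> = cis (d * (pi / d))" by (simp add: cis_mult d_def algebra_simps diff_divide_distrib)
    also have "\<dots> = -1" using d by simp
    finally show ?thesis .
  qed
  let ?f = "\<lambda>w. indicator (ball 0 r) w *\<^sub>R (w ^ a * cnj w ^ b) :: complex"
  have "(\<integral>w. ?f (c * w) \<partial>dA) = (\<integral>w. ?f w \<partial>dA)"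
  proof (rule integral_dA_rotation[OF c])
    have "(\<lambda>w. w ^ a * cnj w ^ b) \<in> borel_measurable borel"
      by (intro borel_measurable_continuous_onI continuous_intros)
    thus "?f \<in> borel_measurable borel"
      by (intro borel_measurable_scaleR borel_measurable_indicator) auto
  qed
  moreover have "?f (c * w) = - ?f w" for w
  proof -
    have "(c * w) ^ a * cnj (c * w) ^ b = (c ^ a * cnj c ^ b) * (w ^ a * cnj w ^ b)"
      by (simp add: power_mult_distrib)
    thus ?thesis using ca c by (simp add: indicator_def norm_mult)
  qed
  ultimately have "- (\<integral>w. ?f w \<partial>dA) = (\<integral>w. ?f w \<partial>dA)" by simp
  thus ?thesis unfolding subdisk_integral_def by (simp add: complex_eq_iff)
qed

text \<open>Layer cake: \<open>r\<^sup>2\<^sup>n - |w|\<^sup>2\<^sup>n\<close> is the integral of \<open>2n t\<^sup>2\<^sup>n\<^sup>-\<^sup>1\<close> over \<open>|w| < t < r\<close>, and the disk of radius \<open>t\<close> has area \<open>t\<^sup>2\<close>.\<close>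

lemma nn_integral_subdisk_power:
  assumes r: "0 < r" "r \<le> 1"
  shows "(\<integral>\<^sup>+w. indicator (ball 0 r) w * ennreal (r ^ (2 * n) - norm w ^ (2 * n)) \<partial>dA)
    = ennreal (real n * r ^ (2 * n + 2) / (real n + 1))"
proof (cases "n = 0")
  case False
  define g where "g t = real (2 * n) * t ^ (2 * n - 1)" for t :: real
  have deriv: "((\<lambda>t. t ^ (2 * n)) has_real_derivative g t) (at t)" for t
    unfolding g_def by (auto intro!: derivative_eq_intros)
  interpret L: sigma_finite_measure "lborel :: real measure" by (rule sigma_finite_lborel)
  interpret P: pair_sigma_finite dA "lborel :: real measure" ..
  have inner: "indicator (ball 0 r) w * ennreal (r ^ (2 * n) - norm w ^ (2 * n))
      = (\<integral>\<^sup>+t. ennreal (g t) * indicator {0..r} t * indicator {x. norm (fst x) \<le> snd x} (w, t) * indicator (ball 0 r) w \<partial>lborel)" for w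
  proof (cases "w \<in> ball 0 r")
    case True
    have "(\<integral>\<^sup>+t. ennreal (g t) * indicator {norm w..r} t \<partial>lborel) = ennreal (r ^ (2 * n) - norm w ^ (2 * n))"
    proof (rule nn_integral_FTC_Icc)
      show "0 \<le> g t" if "t \<in> {norm w..r}" for t
        using that order.trans[OF norm_ge_zero, of w t] by (simp add: g_def)
    qed (use True in \<open>simp_all add: deriv, simp add: g_def[abs_def]\<close>)
    moreover have "ennreal (g t) * indicator {0..r} t * indicator {x. norm (fst x) \<le> snd x} (w, t) * indicator (ball 0 r) w
       = ennreal (g t) * indicator {norm w..r} t" for t
      using True order.trans[OF norm_ge_zero, of w t] by (auto simp: indicator_def)
    ultimately show ?thesis using True by simp
  qed simp
  have "(\<integral>\<^sup>+w. indicator (ball 0 r) w * ennreal (r ^ (2 * n) - norm w ^ (2 * n)) \<partial>dA)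
     = (\<integral>\<^sup>+w. \<integral>\<^sup>+t. ennreal (g t) * indicator {0..r} t * indicator {x. norm (fst x) \<le> snd x} (w, t) * indicator (ball 0 r) w \<partial>lborel \<partial>dA)"
    by (simp only: inner)
  also have "\<dots> = (\<integral>\<^sup>+t. \<integral>\<^sup>+w. ennreal (g t) * indicator {0..r} t * indicator {x. norm (fst x) \<le> snd x} (w, t) * indicator (ball 0 r) w \<partial>dA \<partial>lborel)"
  proof (rule P.Fubini'[symmetric])
    have "(\<lambda>x. ennreal (g (snd x))) \<in> borel_measurable (dA \<Otimes>\<^sub>M lborel)"
      "(\<lambda>x. indicator {0..r} (snd x) :: ennreal) \<in> borel_measurable (dA \<Otimes>\<^sub>M lborel)"
      unfolding g_def by measurable
    moreover have "{x \<in> space (dA \<Otimes>\<^sub>M lborel). norm (fst x) \<le> snd x} \<in> sets (dA \<Otimes>\<^sub>M (lborel :: real measure))"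
      by measurable
    hence "(\<lambda>x. indicator {x. norm (fst x) \<le> snd x} x :: ennreal) \<in> borel_measurable (dA \<Otimes>\<^sub>M (lborel :: real measure))"
      by (subst borel_measurable_indicator_iff) (simp add: Collect_conj_eq Int_commute)
    moreover have "(\<lambda>x. indicator (ball 0 r) (fst x) :: ennreal) \<in> borel_measurable (dA \<Otimes>\<^sub>M (lborel :: real measure))"
      by (rule measurable_compose[OF fst_measurable_dA]) (simp add: borel_measurable_indicator)
    ultimately show "(\<lambda>(w, t). ennreal (g t) * indicator {0..r} t * indicator {x. norm (fst x) \<le> snd x} (w, t) * indicator (ball 0 r) w)
        \<in> borel_measurable (dA \<Otimes>\<^sub>M lborel)"
      unfolding split_beta prod.collapse by (intro borel_measurable_times_ennreal)
  qed
  also have "\<dots> = (\<integral>\<^sup>+t. ennreal (g t * t\<^sup>2) * indicator {0..r} t \<partial>lborel)"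
  proof (rule nn_integral_cong_AE)
    \<comment> \<open>At \<open>t = r\<close> the closed disk \<open>cball 0 t\<close> sticks out of
      \<open>ball 0 r\<close>, and out of \<open>\<D>\<close> when \<open>r = 1\<close>; this single
      value is discarded.\<close>
    have "AE t in lborel. t \<noteq> r" by (rule AE_lborel_singleton)
    thus "AE t in lborel. (\<integral>\<^sup>+w. ennreal (g t) * indicator {0..r} t * indicator {x. norm (fst x) \<le> snd x} (w, t) * indicator (ball 0 r) w \<partial>dA)
      = ennreal (g t * t\<^sup>2) * indicator {0..r} t"
    proof eventually_elim
      case (elim t)
      show ?case
      proof (cases "t \<in> {0..r}")
        case True
        hence t: "0 \<le> t" "t < r" using elim by auto
        have sub: "cball 0 t \<subseteq> \<D>" using t r by auto
        have "emeasure dA (cball 0 t) = emeasure lborel (cball (0::complex) t) / ennreal pi"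
          by (intro emeasure_dA_borel sub) auto
        also have "emeasure lborel (cball (0::complex) t) = ennreal (pi * t\<^sup>2)"
          using emeasure_cball[of t "0::complex"] t by (simp add: eval_unit_ball_vol)
        also have "ennreal (pi * t\<^sup>2) / ennreal pi = ennreal (t\<^sup>2)" by (simp add: divide_ennreal)
        finally have e: "emeasure dA (cball 0 t) = ennreal (t\<^sup>2)" .
        have "(\<integral>\<^sup>+w. ennreal (g t) * indicator {0..r} t * indicator {x. norm (fst x) \<le> snd x} (w, t) * indicator (ball 0 r) w \<partial>dA)
          = (\<integral>\<^sup>+w. ennreal (g t) * indicator (cball 0 t) w \<partial>dA)"
          using t by (intro nn_integral_cong) (auto simp: indicator_def)
        also have "\<dots> = ennreal (g t) * emeasure dA (cball 0 t)"
          using sub by (subst nn_integral_cmult_indicator) (auto intro: borel_in_sets_dA)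
        also have "\<dots> = ennreal (g t * t\<^sup>2)" unfolding e using t by (simp add: ennreal_mult g_def)
        finally show ?thesis using True by simp
      qed simp
    qed
  qed
  also have "\<dots> = ennreal (real n / (real n + 1) * r ^ (2 * n + 2) - real n / (real n + 1) * 0 ^ (2 * n + 2))"
  proof (rule nn_integral_FTC_Icc[where F = "\<lambda>t. real n / (real n + 1) * t ^ (2 * n + 2)"])
    fix t assume "t \<in> {0..r}"
    have "((\<lambda>t. real n / (real n + 1) * t ^ (2 * n + 2)) has_real_derivative
        real n / (real n + 1) * (real (2 * n + 2) * t ^ (2 * n + 1))) (at t)"
      by (auto intro!: derivative_eq_intros simp del: power_Suc)
    moreover have "real n / (real n + 1) * (real (2 * n + 2) * t ^ (2 * n + 1)) = g t * t\<^sup>2"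
    proof -
      have "t ^ (2 * n - 1) * t\<^sup>2 = t ^ (2 * n + 1)" using False by (simp flip: power_add) 
      moreover have "real n / (real n + 1) * real (2 * n + 2) = real (2 * n)" by (simp add: field_simps)
      ultimately show ?thesis unfolding g_def by (metis mult.assoc)
    qed
    ultimately show "((\<lambda>t. real n / (real n + 1) * t ^ (2 * n + 2)) has_real_derivative g t * t\<^sup>2) (at t)" by simp
  qed (use r in \<open>auto simp: g_def\<close>)
  finally show ?thesis using False by (simp add: field_simps)
qed simp

lemma subdisk_integrable:
  assumes "f \<in> borel_measurable dA" "r \<le> 1" "\<And>w. w \<in> ball 0 r \<Longrightarrow> norm (f w) \<le> B"
  shows "integrable dA (\<lambda>w. indicator (ball 0 r) w *\<^sub>R (f w :: complex))"
proof (rule dA.integrable_const_bound[where B = "max B 0"])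
  show "AE w in dA. norm (indicator (ball 0 r) w *\<^sub>R f w) \<le> max B 0"
    using assms(3) by (intro AE_I2) (auto simp: indicator_def le_max_iff_disj)
  have [measurable]: "f \<in> borel_measurable dA" by fact
  have "indicator (ball 0 r) \<in> borel_measurable dA" for r :: real
    by (intro borel_measurable_dA borel_measurable_indicator) simp
  thus "(\<lambda>w. indicator (ball 0 r) w *\<^sub>R f w) \<in> borel_measurable dA" by measurable
qed

text \<open>The layer-cake integral of \<open>r^(2n) - |w|^(2n)\<close> is subtracted from
  \<open>r^(2n)\<close> times the area \<open>r^2\<close>, and
  \<open>1 - n/(n+1) = 1/(n+1)\<close>.\<close>

lemma subdisk_monomial_norm:
  assumes r: "0 < r" "r \<le> 1"
  shows "subdisk_integral r (\<lambda>w. w ^ n * cnj w ^ n) = of_real (r ^ (2 * n + 2) / (real n + 1))"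
proof -
  have eq: "w ^ n * cnj w ^ n = of_real (norm w ^ (2 * n))" for w :: complex
    by (simp add: power_mult flip: power_mult_distrib complex_norm_square)
  have ind: "indicator (ball 0 r) \<in> borel_measurable dA"
    by (intro borel_measurable_dA borel_measurable_indicator) simp
  hence [measurable]: "(indicator (ball 0 r) :: complex \<Rightarrow> real) \<in> borel_measurable dA" .
  have i1: "integrable dA (\<lambda>w. indicator (ball 0 r) w * (r ^ (2 * n) - norm w ^ (2 * n)))"
  proof (rule dA.integrable_const_bound[where B = 1])
    show "AE w in dA. norm (indicator (ball 0 r) w * (r ^ (2 * n) - norm w ^ (2 * n))) \<le> 1"
    proof (rule AE_I2)
      fix w :: complex
      have "norm w ^ (2 * n) \<le> r ^ (2 * n)" if "norm w < r" using that by (intro power_mono) auto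
      moreover have "r ^ (2 * n) \<le> 1" using r by (intro power_le_one) auto
      moreover have "0 \<le> norm w ^ (2 * n)" by simp
      ultimately have "\<bar>r ^ (2 * n) - norm w ^ (2 * n)\<bar> \<le> 1" if "norm w < r" using that by linarith
      thus "norm (indicator (ball 0 r) w * (r ^ (2 * n) - norm w ^ (2 * n))) \<le> 1"
        by (cases "norm w < r") simp_all
    qed
  qed measurable
  have "(\<integral>w. indicator (ball 0 r) w * (r ^ (2 * n) - norm w ^ (2 * n)) \<partial>dA) = real n * r ^ (2 * n + 2) / (real n + 1)"
  proof (subst integral_eq_nn_integral)
    show "AE w in dA. 0 \<le> indicator (ball 0 r) w * (r ^ (2 * n) - norm w ^ (2 * n))"
      by (intro AE_I2) (auto simp: indicator_def intro: power_mono)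
    have "ennreal (indicator (ball 0 r) w * (r ^ (2 * n) - norm w ^ (2 * n)))
      = indicator (ball 0 r) w * ennreal (r ^ (2 * n) - norm w ^ (2 * n))" for w :: complex
      by (simp add: indicator_def)
    thus "enn2real (\<integral>\<^sup>+w. ennreal (indicator (ball 0 r) w * (r ^ (2 * n) - norm w ^ (2 * n))) \<partial>dA) = real n * r ^ (2 * n + 2) / (real n + 1)"
      using nn_integral_subdisk_power[OF r, of n] r by simp
  qed measurable
  moreover have i2: "(\<integral>w. indicator (ball 0 r) w * r ^ (2 * n) \<partial>dA) = r ^ (2 * n + 2)"
  proof -
    have "ball 0 r \<subseteq> \<D>" using r by auto
    hence "measure dA (ball 0 r) = r\<^sup>2" using emeasure_dA_ball[of 0 r] r by (simp add: measure_def)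
    moreover have "ball 0 r \<inter> \<D> = ball 0 r" using r by auto
    ultimately show ?thesis by (simp add: power_add power2_eq_square)
  qed
  moreover have i3: "integrable dA (\<lambda>w. indicator (ball 0 r) w * r ^ (2 * n))"
    by (rule dA.integrable_const_bound[where B = "r ^ (2 * n)"]) (use r in \<open>auto simp: indicator_def\<close>)
  ultimately have "(\<integral>w. indicator (ball 0 r) w * norm w ^ (2 * n) \<partial>dA) = r ^ (2 * n + 2) - real n * r ^ (2 * n + 2) / (real n + 1)"
    using Bochner_Integration.integral_diff[OF i3 i1] by (simp add: algebra_simps)
  also have "\<dots> = r ^ (2 * n + 2) / (real n + 1)" by (simp add: field_simps)
  finally have "(\<integral>w. indicator (ball 0 r) w * norm w ^ (2 * n) \<partial>dA) = r ^ (2 * n + 2) / (real n + 1)" .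
  moreover have "subdisk_integral r (\<lambda>w. w ^ n * cnj w ^ n) = (\<integral>w. of_real (indicator (ball 0 r) w * norm w ^ (2 * n)) \<partial>dA)"
    unfolding subdisk_integral_def eq by (intro Bochner_Integration.integral_cong) (auto simp: indicator_def)
  ultimately show ?thesis by (simp only: integral_complex_of_real)
qed

lemma indicator_ball_measurable_dA [measurable]: "indicator (ball a r) \<in> borel_measurable dA"
  by (intro borel_measurable_dA borel_measurable_indicator) simp

lemma subdisk_integral_add:
  assumes "integrable dA (\<lambda>w. indicator (ball 0 r) w *\<^sub>R f w)" "integrable dA (\<lambda>w. indicator (ball 0 r) w *\<^sub>R g w)"
  shows "subdisk_integral r (\<lambda>w. f w + g w) = subdisk_integral r f + subdisk_integral r g"
  unfolding subdisk_integral_def using Bochner_Integration.integral_add[OF assms] by (simp add: scaleR_add_right)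

lemma subdisk_integral_diff:
  assumes "integrable dA (\<lambda>w. indicator (ball 0 r) w *\<^sub>R f w)" "integrable dA (\<lambda>w. indicator (ball 0 r) w *\<^sub>R g w)"
  shows "subdisk_integral r (\<lambda>w. f w - g w) = subdisk_integral r f - subdisk_integral r g"
  unfolding subdisk_integral_def using Bochner_Integration.integral_diff[OF assms] by (simp add: scaleR_diff_right)

lemma subdisk_integral_cmult: "subdisk_integral r (\<lambda>w. c * f w) = c * subdisk_integral r f"
proof -
  have "indicator (ball 0 r) w *\<^sub>R (c * f w) = c * (indicator (ball 0 r) w *\<^sub>R f w)" for w by simp
  thus ?thesis unfolding subdisk_integral_def by (simp only: integral_mult_right_zero)
qed

lemma subdisk_integral_cong: "(\<And>w. w \<in> ball 0 r \<Longrightarrow> f w = g w) \<Longrightarrow> subdisk_integral r f = subdisk_integral r g"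
  unfolding subdisk_integral_def by (intro Bochner_Integration.integral_cong) (auto simp: indicator_def)

text \<open>Weierstrass M-test: the measure is finite, so summable constant bounds justify the
  interchange.\<close>

lemma subdisk_integral_sums:
  assumes r: "0 < r" "r \<le> 1" and m: "\<And>k. f k \<in> borel_measurable dA"
    and B: "\<And>k w. w \<in> ball 0 r \<Longrightarrow> norm (f k w) \<le> B k" and sB: "summable B"
    and F: "\<And>w. w \<in> ball 0 r \<Longrightarrow> (\<lambda>k. f k w) sums F w"
  shows "(\<lambda>k. subdisk_integral r (f k)) sums subdisk_integral r F"
proof -
  have int: "integrable dA (\<lambda>w. indicator (ball 0 r) w *\<^sub>R f k w)" for k
    using subdisk_integrable[OF m r(2) B] .
  have nB: "norm (indicator (ball 0 r) w *\<^sub>R f k w) \<le> \<bar>B k\<bar>" for k w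
    using B[of w k] by (auto simp: indicator_def)
  have "0 \<le> B k" for k using order.trans[OF norm_ge_zero B[of 0]] r by simp
  hence sB': "summable (\<lambda>k. \<bar>B k\<bar>)" using sB by simp
  have "(\<lambda>k. \<integral>w. indicator (ball 0 r) w *\<^sub>R f k w \<partial>dA) sums (\<integral>w. (\<Sum>k. indicator (ball 0 r) w *\<^sub>R f k w) \<partial>dA)"
  proof (rule sums_integral[OF int])
    show "AE w in dA. summable (\<lambda>k. norm (indicator (ball 0 r) w *\<^sub>R f k w))"
      using nB sB' by (intro AE_I2 summable_comparison_test'[OF sB', of 0]) auto
    show "summable (\<lambda>k. \<integral>w. norm (indicator (ball 0 r) w *\<^sub>R f k w) \<partial>dA)"
    proof (rule summable_comparison_test'[OF sB', of 0])
      fix k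
      have "(\<integral>w. norm (indicator (ball 0 r) w *\<^sub>R f k w) \<partial>dA) \<le> (\<integral>w. \<bar>B k\<bar> \<partial>dA)"
        using int nB by (intro integral_mono integrable_norm) auto
      also have "\<dots> = \<bar>B k\<bar>" by (simp add: measure_def)
      finally show "norm (\<integral>w. norm (indicator (ball 0 r) w *\<^sub>R f k w) \<partial>dA) \<le> \<bar>B k\<bar>" by simp
    qed
  qed
  moreover have "(\<Sum>k. indicator (ball 0 r) w *\<^sub>R f k w) = indicator (ball 0 r) w *\<^sub>R F w" for w
    using sums_unique[OF F, of w] by (cases "w \<in> ball 0 r") (simp_all add: indicator_def)
  ultimately show ?thesis unfolding subdisk_integral_def by simp
qed

lemma monomial_measurable_dA: "(\<lambda>w. w ^ a * cnj w ^ b) \<in> borel_measurable dA"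
  by (intro borel_measurable_dA borel_measurable_continuous_onI continuous_intros)

text \<open>Orthogonality of the monomials leaves, from the power series of \<open>g\<close>, only
  the term with \<open>k + p = q\<close>.\<close>

lemma subdisk_integral_holomorphic_monomial:
  assumes g: "g holomorphic_on \<D>" and r: "0 < r" "r < 1"
  shows "subdisk_integral r (\<lambda>w. g w * (w ^ p * cnj w ^ q)) =
    (if p \<le> q then (deriv ^^ (q - p)) g 0 / fact (q - p) * of_real (r ^ (2 * q + 2) / (real q + 1)) else 0)"
proof -
  define c where "c k = (deriv ^^ k) g 0 / fact k" for k
  have ser: "(\<lambda>k. c k * w ^ k) sums g w" if "w \<in> \<D>" for w
    using holomorphic_power_series[OF g that] by (simp add: c_def)
  have "(\<lambda>k. subdisk_integral r (\<lambda>w. c k * (w ^ (k + p) * cnj w ^ q))) sums subdisk_integral r (\<lambda>w. g w * (w ^ p * cnj w ^ q))"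
  proof (rule subdisk_integral_sums[where B = "\<lambda>k. norm (c k * of_real r ^ k)"])
    \<comment> \<open>A radius strictly between \<open>r\<close> and 1: convergence there yields
      absolute convergence at \<open>r\<close>.\<close>
    have "of_real ((1 + r) / 2) \<in> (\<D> :: complex set)" using r by (simp del: of_real_add of_real_divide)
    hence "summable (\<lambda>k. c k * of_real ((1 + r) / 2) ^ k)" using ser sums_summable by blast
    thus "summable (\<lambda>k. norm (c k * of_real r ^ k))"
      by (rule powser_insidea) (use r in \<open>simp del: of_real_add of_real_divide\<close>)
    fix k
    show "(\<lambda>w. c k * (w ^ (k + p) * cnj w ^ q)) \<in> borel_measurable dA"
      using monomial_measurable_dA by (intro borel_measurable_times) auto
    fix w :: complex assume w: "w \<in> ball 0 r"
    have "norm w ^ p \<le> 1" "norm w ^ q \<le> 1" using w r by (auto intro!: power_le_one)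
    hence "norm w ^ p * norm w ^ q \<le> 1" by (simp add: mult_le_one)
    moreover have "norm w ^ k \<le> r ^ k" using w by (intro power_mono) auto
    ultimately have "norm w ^ k * (norm w ^ p * norm w ^ q) \<le> r ^ k * 1"
      using r by (intro mult_mono) auto
    thus "norm (c k * (w ^ (k + p) * cnj w ^ q)) \<le> norm (c k * of_real r ^ k)"
      using r by (auto simp: norm_mult norm_power power_add mult.assoc intro!: mult_left_mono)
  next
    fix w :: complex assume w: "w \<in> ball 0 r"
    hence "(\<lambda>k. c k * w ^ k * (w ^ p * cnj w ^ q)) sums (g w * (w ^ p * cnj w ^ q))"
      using r by (intro sums_mult2 ser) auto
    thus "(\<lambda>k. c k * (w ^ (k + p) * cnj w ^ q)) sums (g w * (w ^ p * cnj w ^ q))"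
      by (simp add: power_add mult_ac)
  qed (use r in auto)
  moreover have "subdisk_integral r (\<lambda>w. c k * (w ^ (k + p) * cnj w ^ q))
    = (if k + p = q then c k * of_real (r ^ (2 * q + 2) / (real q + 1)) else 0)" for k
    unfolding subdisk_integral_cmult using subdisk_monomial_zero[of "k + p" q r] subdisk_monomial_norm[of r q] r by auto
  ultimately have S: "(\<lambda>k. if k + p = q then c k * of_real (r ^ (2 * q + 2) / (real q + 1)) else 0) sums
      subdisk_integral r (\<lambda>w. g w * (w ^ p * cnj w ^ q))" by simp
  show ?thesis
  proof (cases "p \<le> q")
    case True
    hence eq: "k + p = q \<longleftrightarrow> k = q - p" for k by auto
    have "(\<lambda>k. if k = q - p then c k * of_real (r ^ (2 * q + 2) / (real q + 1)) else 0) sums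
      (c (q - p) * of_real (r ^ (2 * q + 2) / (real q + 1)))" by (rule sums_single)
    thus ?thesis using S True unfolding eq c_def by (metis (no_types, lifting) sums_unique2)
  next
    case False
    hence eq: "k + p = q \<longleftrightarrow> False" for k by auto
    show ?thesis using S False unfolding eq by (simp add: sums_0 sums_unique2 sums_iff)
  qed
qed

section \<open>The harmonic kernel and its reproducing property\<close>

lemma harmonic_kernel_bound:
  assumes "z \<in> \<D>" "w \<in> \<D>"
  shows "norm (harmonic_kernel w z) \<le> 6 * (1 / (norm (1 - cnj w * z))\<^sup>2)"
proof -
  define q where "q = norm (1 - cnj w * z)"
  have q: "0 < q" "q \<le> 2" using norm_one_minus_cnj_mult[OF assms] by (auto simp: q_def)
  have "cnj (1 - cnj w * z) = 1 - cnj z * w" by (simp add: mult.commute)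
  hence q': "norm (1 - cnj z * w) = q" unfolding q_def by (metis complex_mod_cnj)
  have "norm (harmonic_kernel w z) \<le> norm (1 / (1 - cnj z * w)\<^sup>2) + norm (1 / (1 - cnj w * z)\<^sup>2) + norm (1::complex)"
    unfolding harmonic_kernel_def by (meson norm_triangle_ineq4 norm_triangle_ineq add_right_mono order.trans)
  also have "\<dots> = 2 / q\<^sup>2 + 1" using q' by (simp add: norm_divide norm_power q_def)
  \<comment> \<open>The summand \<open>-1\<close> of the kernel is absorbed using
    \<open>q \<le> 2\<close>, so the constant is \<open>2 + 4 = 6\<close>.\<close>
  also have "1 \<le> 4 / q\<^sup>2" using q power_mono[of q 2 2] by simp
  finally show ?thesis by (simp add: q_def)
qed

lemma harmonic_kernel_bounded:
  assumes z: "z \<in> \<D>" and w: "w \<in> \<D>"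
  shows "norm (harmonic_kernel w z) \<le> 6 / (1 - norm z)\<^sup>2"
proof -
  have "1 / (norm (1 - cnj w * z))\<^sup>2 \<le> 1 / (1 - norm z)\<^sup>2"
    using norm_one_minus_cnj_mult[OF z w] z by (intro divide_left_mono power_mono mult_pos_pos zero_less_power) auto
  thus ?thesis using harmonic_kernel_bound[OF z w] by simp
qed

lemma cnj_harmonic_kernel: "cnj (harmonic_kernel w z) = harmonic_kernel w z"
  by (simp add: harmonic_kernel_def mult.commute add.commute)

lemma harmonic_kernel_commute: "harmonic_kernel w z = harmonic_kernel z w"
  by (simp add: harmonic_kernel_def)

lemma harmonic_kernel_measurable [measurable]: "(\<lambda>w. harmonic_kernel w z) \<in> borel_measurable dA"
  unfolding harmonic_kernel_def by measurable

text \<open>Expand \<open>1 / (1 - u)^2\<close> as the sum of \<open>(m + 1) * u^m\<close>. The half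
  of the kernel that is holomorphic in \<open>w\<close> meets \<open>g\<close> only in the constant
  term, which the summand \<open>-1\<close> cancels; the conjugate half restores the power series.
  On radius \<open>r\<close> the squared norm of \<open>w^m\<close> is
  \<open>r^(2m+2) / (m+1)\<close>, whence the dilation by \<open>r^2\<close>.\<close>

lemma subdisk_integral_holomorphic_kernel:
  assumes g: "g holomorphic_on \<D>" and r: "0 < r" "r < 1" and z: "z \<in> \<D>"
  shows "subdisk_integral r (\<lambda>w. g w * harmonic_kernel w z) = of_real (r\<^sup>2) * g (of_real (r\<^sup>2) * z)"
proof -
  define c where "c k = (deriv ^^ k) g 0 / fact k" for k
  have gm: "g \<in> borel_measurable dA"
    using g by (intro continuous_on_measurable_dA holomorphic_on_imp_continuous_on)
  have "compact (g ` cball 0 r)" using r by (intro compact_continuous_image holomorphic_on_imp_continuous_on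
      holomorphic_on_subset[OF g]) auto
  then obtain G where G: "\<And>w. w \<in> cball 0 r \<Longrightarrow> norm (g w) \<le> G" by (meson bounded_iff compact_imp_bounded imageI)
  have Gb: "norm (g w) \<le> G" if "w \<in> ball 0 r" for w using G[of w] that by auto
  have G0: "G \<ge> 0" using order.trans[OF norm_ge_zero G[of 0]] r by auto
  have nz: "norm z < 1" using z by simp
  have sB: "summable (\<lambda>m. G * (of_nat (Suc m) * norm z ^ m))"
    using sums_summable[OF geometric_deriv_sums[of "norm z"]] nz by (intro summable_mult) auto
  have m1: "(\<lambda>w. w ^ a * cnj w ^ b) \<in> borel_measurable dA" for a b by (rule monomial_measurable_dA)
  have bd: "norm (g w * (of_nat (Suc m) * u ^ m)) \<le> G * (of_nat (Suc m) * norm z ^ m)"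
    if "w \<in> ball 0 r" "norm u \<le> norm z" for w u m
  proof -
    have "norm (g w * (of_nat (Suc m) * u ^ m)) = norm (g w) * (of_nat (Suc m) * norm u ^ m)"
      by (simp only: norm_mult norm_power norm_of_nat)
    also have "\<dots> \<le> G * (of_nat (Suc m) * norm z ^ m)"
      using that Gb[OF that(1)] G0 by (intro mult_mono power_mono) auto
    finally show ?thesis .
  qed
  have uz: "norm (cnj z * w) \<le> norm z" "norm (z * cnj w) \<le> norm z" if "w \<in> ball 0 r" for w
    using that r by (auto simp: norm_mult intro!: mult_left_le)
  have S1: "(\<lambda>m. subdisk_integral r (\<lambda>w. g w * (of_nat (Suc m) * (cnj z * w) ^ m)))
    sums subdisk_integral r (\<lambda>w. g w * (1 / (1 - cnj z * w)\<^sup>2))"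
  proof (rule subdisk_integral_sums[OF _ _ _ bd[OF _ uz(1)] sB])
    show "(\<lambda>w. g w * (of_nat (Suc m) * (cnj z * w) ^ m)) \<in> borel_measurable dA" for m
      using gm by measurable
    show "(\<lambda>m. g w * (of_nat (Suc m) * (cnj z * w) ^ m)) sums (g w * (1 / (1 - cnj z * w)\<^sup>2))" if "w \<in> ball 0 r" for w
      using uz[OF that] nz by (intro sums_mult geometric_deriv_sums) auto
  qed (use r in auto)
  have S2: "(\<lambda>m. subdisk_integral r (\<lambda>w. g w * (of_nat (Suc m) * (z * cnj w) ^ m)))
    sums subdisk_integral r (\<lambda>w. g w * (1 / (1 - z * cnj w)\<^sup>2))"
  proof (rule subdisk_integral_sums[OF _ _ _ bd[OF _ uz(2)] sB])
    show "(\<lambda>w. g w * (of_nat (Suc m) * (z * cnj w) ^ m)) \<in> borel_measurable dA" for m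
      using gm by measurable
    show "(\<lambda>m. g w * (of_nat (Suc m) * (z * cnj w) ^ m)) sums (g w * (1 / (1 - z * cnj w)\<^sup>2))" if "w \<in> ball 0 r" for w
      using uz[OF that] nz by (intro sums_mult geometric_deriv_sums) auto
  qed (use r in auto)
  have t1: "subdisk_integral r (\<lambda>w. g w * (of_nat (Suc m) * (cnj z * w) ^ m)) = (if m = 0 then c 0 * of_real (r\<^sup>2) else 0)" for m
  proof -
    have "g w * (of_nat (Suc m) * (cnj z * w) ^ m) = of_nat (Suc m) * cnj z ^ m * (g w * (w ^ m * cnj w ^ 0))" for w
      by (simp only: power_mult_distrib power_0 mult_1_right mult_1_left mult_ac)
    thus ?thesis using subdisk_integral_holomorphic_monomial[OF g r, of m 0]
      by (simp only: subdisk_integral_cmult) (auto simp: c_def power2_eq_square)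
  qed
  have t2: "subdisk_integral r (\<lambda>w. g w * (of_nat (Suc m) * (z * cnj w) ^ m)) = of_real (r\<^sup>2) * (c m * (of_real (r\<^sup>2) * z) ^ m)" for m
  proof -
    have "g w * (of_nat (Suc m) * (z * cnj w) ^ m) = of_nat (Suc m) * z ^ m * (g w * (w ^ 0 * cnj w ^ m))" for w
      by (simp only: power_mult_distrib power_0 mult_1_right mult_1_left mult_ac)
    hence "subdisk_integral r (\<lambda>w. g w * (of_nat (Suc m) * (z * cnj w) ^ m))
      = of_nat (Suc m) * z ^ m * (c m * of_real (r ^ (2 * m + 2) / (real m + 1)))"
      using subdisk_integral_holomorphic_monomial[OF g r, of 0 m] by (simp only: subdisk_integral_cmult) (simp add: c_def)
    also have "of_real (r ^ (2 * m + 2) / (real m + 1)) = (of_real (r\<^sup>2) * of_real (r\<^sup>2) ^ m / of_nat (Suc m) :: complex)"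
    proof -
      have "r ^ (2 * m + 2) = r\<^sup>2 * (r\<^sup>2) ^ m" by (simp add: power_mult[symmetric] flip: power_add)
      thus ?thesis by (simp add: add.commute)
    qed
    finally show ?thesis by (simp add: power_mult_distrib del: of_nat_Suc)
  qed
  have I1: "subdisk_integral r (\<lambda>w. g w * (1 / (1 - cnj z * w)\<^sup>2)) = c 0 * of_real (r\<^sup>2)"
    using S1 sums_single[of 0 "\<lambda>m. c 0 * of_real (r\<^sup>2)"] unfolding t1 by (metis (no_types, lifting) sums_unique2)
  have "norm (of_real (r\<^sup>2) * z) \<le> norm z" using r by (simp add: norm_mult norm_power mult_left_le_one_le power_le_one)
  hence "of_real (r\<^sup>2) * z \<in> \<D>" using nz by simp
  hence "(\<lambda>m. c m * (of_real (r\<^sup>2) * z) ^ m) sums g (of_real (r\<^sup>2) * z)"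
    using holomorphic_power_series[OF g, of "of_real (r\<^sup>2) * z"] by (simp add: c_def)
  hence I2: "subdisk_integral r (\<lambda>w. g w * (1 / (1 - z * cnj w)\<^sup>2)) = of_real (r\<^sup>2) * g (of_real (r\<^sup>2) * z)"
    using S2 unfolding t2 by (intro sums_unique2[OF S2[unfolded t2]] sums_mult)
  have I3: "subdisk_integral r g = c 0 * of_real (r\<^sup>2)"
    using subdisk_integral_holomorphic_monomial[OF g r, of 0 0] by (simp add: c_def power2_eq_square)
  have kb: "norm (1 / (1 - u)\<^sup>2) \<le> 1 / (1 - norm z)\<^sup>2" if "norm u \<le> norm z" for u :: complex
  proof -
    have "1 - norm z \<le> norm (1 - u)" using norm_triangle_ineq2[of 1 u] that by simp
    thus ?thesis using nz by (simp add: norm_divide norm_power) (intro divide_left_mono power_mono mult_pos_pos zero_less_power, auto)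
  qed
  have gb: "norm (g w * (1 / (1 - u)\<^sup>2)) \<le> G * (1 / (1 - norm z)\<^sup>2)" if "w \<in> ball 0 r" "norm u \<le> norm z" for w u
    unfolding norm_mult using Gb[OF that(1)] kb[OF that(2)] G0 by (intro mult_mono) auto
  have int1: "integrable dA (\<lambda>w. indicator (ball 0 r) w *\<^sub>R (g w * (1 / (1 - cnj z * w)\<^sup>2)))"
    by (rule subdisk_integrable[OF _ _ gb[OF _ uz(1)]]) (use gm r in \<open>measurable, simp\<close>)
  have int2: "integrable dA (\<lambda>w. indicator (ball 0 r) w *\<^sub>R (g w * (1 / (1 - z * cnj w)\<^sup>2)))"
    by (rule subdisk_integrable[OF _ _ gb[OF _ uz(2)]]) (use gm r in \<open>measurable, simp\<close>)
  have int3: "integrable dA (\<lambda>w. indicator (ball 0 r) w *\<^sub>R g w)"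
    by (rule subdisk_integrable[OF gm _ Gb]) (use r in auto)
  have "subdisk_integral r (\<lambda>w. g w * harmonic_kernel w z)
    = subdisk_integral r (\<lambda>w. (g w * (1 / (1 - cnj z * w)\<^sup>2) + g w * (1 / (1 - z * cnj w)\<^sup>2)) - g w)"
    by (intro subdisk_integral_cong) (simp add: harmonic_kernel_def algebra_simps)
  also have "\<dots> = (c 0 * of_real (r\<^sup>2) + of_real (r\<^sup>2) * g (of_real (r\<^sup>2) * z)) - c 0 * of_real (r\<^sup>2)"
  proof -
    have "integrable dA (\<lambda>w. indicator (ball 0 r) w *\<^sub>R (g w * (1 / (1 - cnj z * w)\<^sup>2) + g w * (1 / (1 - z * cnj w)\<^sup>2)))"
      using Bochner_Integration.integrable_add[OF int1 int2] by (simp only: scaleR_add_right)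
    thus ?thesis
      by (simp only: subdisk_integral_diff[OF _ int3] subdisk_integral_add[OF int1 int2] I1 I2 I3)
  qed
  finally show ?thesis by simp
qed

text \<open>The kernel is real, so the antiholomorphic part follows by conjugation. Integrability is
  known for \<open>f\<close> and not for \<open>g\<close> and \<open>h\<close> separately, so the
  parts are treated on smaller disks and only \<open>f\<close> is passed to the limit, dominated by
  \<open>norm (f w)\<close> times the bound of the kernel for fixed \<open>z\<close>.\<close>

lemma reproducing_formula:
  assumes g: "g holomorphic_on \<D>" and h: "h holomorphic_on \<D>"
    and f: "\<And>w. w \<in> \<D> \<Longrightarrow> f w = g w + cnj (h w)" and int: "integrable dA f" and z: "z \<in> \<D>"
  shows "f z = (\<integral>w. f w * harmonic_kernel w z \<partial>dA)"
proof -
  have nz: "norm z < 1" using z by simp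
  have fm [measurable]: "f \<in> borel_measurable dA" using int by simp
  have sub: "subdisk_integral r (\<lambda>w. f w * harmonic_kernel w z) = of_real (r\<^sup>2) * f (of_real (r\<^sup>2) * z)"
    if r: "0 < r" "r < 1" for r
  proof -
    have inthol: "integrable dA (\<lambda>w. indicator (ball 0 r) w *\<^sub>R (k w * harmonic_kernel w z))" if k: "k holomorphic_on \<D>" for k
    proof -
      have "compact (k ` cball 0 r)" using r by (intro compact_continuous_image holomorphic_on_imp_continuous_on
          holomorphic_on_subset[OF k]) auto
      then obtain G where G: "\<And>w. w \<in> cball 0 r \<Longrightarrow> norm (k w) \<le> G" by (meson bounded_iff compact_imp_bounded imageI)
      have [measurable]: "k \<in> borel_measurable dA"
        using k by (intro continuous_on_measurable_dA holomorphic_on_imp_continuous_on)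
      show ?thesis
      proof (rule subdisk_integrable[where B = "G * (6 / (1 - norm z)\<^sup>2)"])
        fix w :: complex assume w: "w \<in> ball 0 r"
        hence wD: "w \<in> \<D>" using r by auto
        have "norm (harmonic_kernel w z) \<le> 6 / (1 - norm z)\<^sup>2" by (rule harmonic_kernel_bounded[OF z wD])
        moreover have "norm (k w) \<le> G" using G w by auto
        moreover from this have "G \<ge> 0" using order.trans[OF norm_ge_zero] by blast
        ultimately show "norm (k w * harmonic_kernel w z) \<le> G * (6 / (1 - norm z)\<^sup>2)"
          unfolding norm_mult by (intro mult_mono) auto
      qed (use r in auto)
    qed
    have cn: "indicator (ball 0 r) w *\<^sub>R (cnj (h w) * harmonic_kernel w z) = cnj (indicator (ball 0 r) w *\<^sub>R (h w * harmonic_kernel w z))" for w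
      by (simp add: cnj_harmonic_kernel)
    have "subdisk_integral r (\<lambda>w. f w * harmonic_kernel w z)
      = subdisk_integral r (\<lambda>w. g w * harmonic_kernel w z + cnj (h w) * harmonic_kernel w z)"
      using f r by (intro subdisk_integral_cong) (auto simp: algebra_simps)
    also have "\<dots> = subdisk_integral r (\<lambda>w. g w * harmonic_kernel w z) + subdisk_integral r (\<lambda>w. cnj (h w) * harmonic_kernel w z)"
    proof (rule subdisk_integral_add[OF inthol[OF g]])
      show "integrable dA (\<lambda>w. indicator (ball 0 r) w *\<^sub>R (cnj (h w) * harmonic_kernel w z))"
        unfolding cn by (intro integrable_cnj inthol[OF h])
    qed
    also have "subdisk_integral r (\<lambda>w. cnj (h w) * harmonic_kernel w z) = cnj (subdisk_integral r (\<lambda>w. h w * harmonic_kernel w z))"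
      unfolding subdisk_integral_def cn by (rule Bochner_Integration.integral_cnj)
    also have "subdisk_integral r (\<lambda>w. g w * harmonic_kernel w z) + cnj (subdisk_integral r (\<lambda>w. h w * harmonic_kernel w z))
      = of_real (r\<^sup>2) * (g (of_real (r\<^sup>2) * z) + cnj (h (of_real (r\<^sup>2) * z)))"
      unfolding subdisk_integral_holomorphic_kernel[OF g r z] subdisk_integral_holomorphic_kernel[OF h r z] by (simp add: algebra_simps)
    also have "g (of_real (r\<^sup>2) * z) + cnj (h (of_real (r\<^sup>2) * z)) = f (of_real (r\<^sup>2) * z)"
    proof (rule f[symmetric])
      have "norm (of_real (r\<^sup>2) * z) \<le> norm z" using r by (simp add: norm_mult norm_power mult_left_le_one_le power_le_one)
      thus "of_real (r\<^sup>2) * z \<in> \<D>" using nz by simp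
    qed
    finally show ?thesis .
  qed
  define R where "R n = 1 - 1 / (real n + 2)" for n
  have R: "0 < R n" "R n < 1" for n by (auto simp: R_def field_simps)
  have "(\<lambda>n. 1 - 1 / real (n + 2)) \<longlonglongrightarrow> 1 - 0"
    by (intro tendsto_diff tendsto_const LIMSEQ_ignore_initial_segment lim_1_over_n)
  hence R1: "R \<longlonglongrightarrow> 1" by (simp add: R_def[abs_def] add.commute)
  have "(\<lambda>n. subdisk_integral (R n) (\<lambda>w. f w * harmonic_kernel w z)) \<longlonglongrightarrow> (\<integral>w. f w * harmonic_kernel w z \<partial>dA)"
    unfolding subdisk_integral_def
  proof (rule integral_dominated_convergence[where w = "\<lambda>w. norm (f w) * (6 / (1 - norm z)\<^sup>2)"])
    show "integrable dA (\<lambda>w. norm (f w) * (6 / (1 - norm z)\<^sup>2))" using int by simp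
    show "AE w in dA. (\<lambda>n. indicator (ball 0 (R n)) w *\<^sub>R (f w * harmonic_kernel w z)) \<longlonglongrightarrow> f w * harmonic_kernel w z"
    proof (rule AE_I2)
      fix w assume "w \<in> space dA"
      hence "norm w < 1" by simp
      hence "eventually (\<lambda>n. norm w < R n) sequentially" using order_tendstoD(1)[OF R1] by blast
      hence "eventually (\<lambda>n. indicator (ball 0 (R n)) w *\<^sub>R (f w * harmonic_kernel w z) = f w * harmonic_kernel w z) sequentially"
        by eventually_elim (simp add: indicator_def)
      thus "(\<lambda>n. indicator (ball 0 (R n)) w *\<^sub>R (f w * harmonic_kernel w z)) \<longlonglongrightarrow> f w * harmonic_kernel w z"
        by (rule tendsto_eventually)
    qed
    show "AE w in dA. norm (indicator (ball 0 (R n)) w *\<^sub>R (f w * harmonic_kernel w z)) \<le> norm (f w) * (6 / (1 - norm z)\<^sup>2)" for n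
    proof (rule AE_I2)
      fix w assume "w \<in> space dA"
      hence wD: "w \<in> \<D>" by simp
      have "norm (harmonic_kernel w z) \<le> 6 / (1 - norm z)\<^sup>2" by (rule harmonic_kernel_bounded[OF z wD])
      hence "norm (f w * harmonic_kernel w z) \<le> norm (f w) * (6 / (1 - norm z)\<^sup>2)"
        unfolding norm_mult by (intro mult_left_mono) auto
      thus "norm (indicator (ball 0 (R n)) w *\<^sub>R (f w * harmonic_kernel w z)) \<le> norm (f w) * (6 / (1 - norm z)\<^sup>2)"
        by (auto simp: indicator_def)
    qed
  qed measurable
  moreover have "(\<lambda>n. of_real ((R n)\<^sup>2) * f (of_real ((R n)\<^sup>2) * z)) \<longlonglongrightarrow> of_real (1\<^sup>2) * f (of_real (1\<^sup>2) * z)"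
  proof (intro tendsto_mult tendsto_of_real tendsto_power R1)
    have "continuous_on \<D> (\<lambda>w. g w + cnj (h w))"
      using g h by (intro continuous_intros holomorphic_on_imp_continuous_on)
    hence "continuous_on \<D> f" using f by (subst continuous_on_cong[OF refl, of _ _ "\<lambda>w. g w + cnj (h w)"]) auto
    hence "isCont f z" using z by (simp add: continuous_on_eq_continuous_at)
    moreover have "(\<lambda>n. of_real ((R n)\<^sup>2) * z) \<longlonglongrightarrow> of_real (1\<^sup>2) * z"
      by (intro tendsto_mult tendsto_of_real tendsto_power R1 tendsto_const)
    ultimately show "(\<lambda>n. f (of_real ((R n)\<^sup>2) * z)) \<longlonglongrightarrow> f (of_real (1\<^sup>2) * z)"
      by (intro isCont_tendsto_compose[of _ f]) auto
  qed
  ultimately show ?thesis unfolding sub[OF R] using LIMSEQ_unique by fastforce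
qed

section \<open>Harmonic functions as sums of holomorphic and antiholomorphic ones\<close>

text \<open>The second difference is integrated along \<open>p\<close>; differentiability of the \<open>p\<close>-derivative \<open>G\<close> at the
  single point \<open>z\<close> suffices.\<close>

lemma second_difference:
  fixes f G L :: "complex \<Rightarrow> complex"
  assumes d: "0 < d" and f: "\<And>w. w \<in> ball z d \<Longrightarrow> ((\<lambda>s. f (w + of_real s * p)) has_vector_derivative G w) (at 0)"
    and G: "(G has_derivative L) (at z)" and n: "norm p = 1" "norm q = 1" and e: "0 < e"
  shows "\<exists>t0>0. \<forall>t. 0 < t \<and> t < t0 \<longrightarrow>
    norm (f (z + of_real t * p + of_real t * q) - f (z + of_real t * p) - f (z + of_real t * q) + f z
      - of_real (t\<^sup>2) * L q) \<le> e * t\<^sup>2"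
proof -
  interpret L: bounded_linear L by (rule has_derivative_bounded_linear[OF G])
  obtain d1 where d1: "0 < d1" "\<And>y. norm (y - z) < d1 \<Longrightarrow> norm (G y - G z - L (y - z)) \<le> e / 3 * norm (y - z)"
    using G e unfolding has_derivative_at_alt by (meson divide_pos_pos zero_less_numeral)
  have d1': "norm (G (z + h) - G z - L h) \<le> e / 3 * norm h" if "norm h < d1" for h
    using d1(2)[of "z + h"] that by simp
  \<comment> \<open>Half the minimum, because the corner \<open>z + t * p + t * q\<close> can be as
    far as \<open>2 * t\<close> from \<open>z\<close>.\<close>
  define t0 where "t0 = min d d1 / 2"
  have "norm (f (z + of_real t * p + of_real t * q) - f (z + of_real t * p) - f (z + of_real t * q) + f z
      - of_real (t\<^sup>2) * L q) \<le> e * t\<^sup>2" if t: "0 < t" "t < t0" for t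
  proof -
    \<comment> \<open>The linear term is subtracted to make \<open>F'\<close> small: its two
      first-order errors \<open>e/3 * 2t\<close> and \<open>e/3 * t\<close> add up to
      \<open>e * t\<close>.\<close>
    define F where "F s = f (z + of_real s * p + of_real t * q) - f (z + of_real s * p) - of_real s * (of_real t * L q)" for s
    define F' where "F' s = G (z + of_real s * p + of_real t * q) - G (z + of_real s * p) - of_real t * L q" for s
    have Lq: "L (of_real t * q) = of_real t * L q" using L.scaleR[of t q] by (simp add: scaleR_conv_of_real)
    have der: "(F has_vector_derivative F' s) (at s within {0..t})" if s: "s \<in> {0..t}" for s
    proof -
      have shift: "((\<lambda>s'. f (w + of_real s' * p)) has_vector_derivative G (w + of_real s * p)) (at s)"
        if "w + of_real s * p \<in> ball z d" for w
      proof -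
        have "((\<lambda>x. f (w + of_real s * p + of_real x * p)) \<circ> (\<lambda>x. x - s) has_vector_derivative 1 *\<^sub>R G (w + of_real s * p)) (at s)"
          using f[OF that] by (intro vector_diff_chain_at) (auto intro!: derivative_eq_intros)
        moreover have "(\<lambda>x. f (w + of_real s * p + of_real x * p)) \<circ> (\<lambda>x. x - s) = (\<lambda>s'. f (w + of_real s' * p))"
          by (auto simp: fun_eq_iff algebra_simps)
        ultimately show ?thesis by simp
      qed
      have s': "norm (of_real s * p) \<le> t" using s n by (simp add: norm_mult)
      have "norm (of_real s * p + of_real t * q) \<le> t + t"
        using s' n t by (intro norm_triangle_le add_mono) (auto simp: norm_mult)
      also have "\<dots> < d" using t by (auto simp: t0_def)
      finally have "z + (of_real s * p + of_real t * q) \<in> ball z d"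
        by (simp only: mem_ball dist_norm norm_minus_commute[of z] add_diff_cancel_left')
      hence b1: "z + of_real t * q + of_real s * p \<in> ball z d" by (simp only: add_ac)
      have b2: "z + of_real s * p \<in> ball z d" using s' t by (auto simp: dist_norm t0_def norm_mult)
      have "((\<lambda>s. f (z + of_real t * q + of_real s * p) - f (z + of_real s * p) - of_real s * (of_real t * L q)) has_vector_derivative
          (G (z + of_real t * q + of_real s * p) - G (z + of_real s * p) - 1 * (of_real t * L q))) (at s)"
        by (intro has_vector_derivative_diff shift b1 b2 has_vector_derivative_mult_left)
          (auto intro!: derivative_eq_intros simp: has_vector_derivative_of_real)
      note * = this
      have eq: "z + of_real x * p + of_real t * q = z + of_real t * q + of_real x * p" for x by simp
      show ?thesis unfolding F_def F'_def eq
        by (rule has_vector_derivative_at_within[OF *[unfolded mult_1_left]])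
    qed
    have bound: "norm (F' s) \<le> e * t" if s: "s \<in> {0..t}" for s
    proof -
      have s': "norm (of_real s * p) \<le> t" using s n by (simp add: norm_mult)
      have st: "norm (of_real s * p + of_real t * q) \<le> 2 * t"
        using norm_triangle_le[of "of_real s * p" "of_real t * q" "2 * t"] s' n t by (simp add: norm_mult)
      have "norm (G (z + (of_real s * p + of_real t * q)) - G z - L (of_real s * p + of_real t * q)) \<le> e / 3 * norm (of_real s * p + of_real t * q)"
        using st t by (intro d1') (auto simp: t0_def)
      also have "\<dots> \<le> e / 3 * (2 * t)" using st e by (intro mult_left_mono) auto
      finally have 1: "norm (G (z + (of_real s * p + of_real t * q)) - G z - L (of_real s * p + of_real t * q)) \<le> e / 3 * (2 * t)" .
      have "norm (G (z + of_real s * p) - G z - L (of_real s * p)) \<le> e / 3 * norm (of_real s * p)"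
        using s' t by (intro d1') (auto simp: t0_def)
      also have "\<dots> \<le> e / 3 * t" using s' e by (intro mult_left_mono) auto
      finally have 2: "norm (G (z + of_real s * p) - G z - L (of_real s * p)) \<le> e / 3 * t" .
      have "F' s = (G (z + (of_real s * p + of_real t * q)) - G z - L (of_real s * p + of_real t * q))
          - (G (z + of_real s * p) - G z - L (of_real s * p))"
        unfolding F'_def L.add Lq by (simp add: algebra_simps)
      hence "norm (F' s) \<le> norm (G (z + (of_real s * p + of_real t * q)) - G z - L (of_real s * p + of_real t * q))
          + norm (G (z + of_real s * p) - G z - L (of_real s * p))" by (simp only: norm_triangle_ineq4)
      hence "norm (F' s) \<le> e / 3 * (2 * t) + e / 3 * t" using 1 2 by linarith
      thus ?thesis by simp
    qed
    have "norm (F t - F 0) \<le> e * t * norm (t - 0)"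
    proof (rule differentiable_bound[of "{0..t}" F "\<lambda>s h. h *\<^sub>R F' s"])
      show "(F has_derivative (\<lambda>h. h *\<^sub>R F' s)) (at s within {0..t})" if "s \<in> {0..t}" for s
        using der[OF that] by (simp add: has_vector_derivative_def)
      show "onorm (\<lambda>h. h *\<^sub>R F' s) \<le> e * t" if "s \<in> {0..t}" for s
        using bound[OF that] e t by (intro onorm_le) (auto simp: mult.commute intro: mult_left_mono)
    qed (use t in auto)
    moreover have "F t - F 0 = f (z + of_real t * p + of_real t * q) - f (z + of_real t * p) - f (z + of_real t * q) + f z
      - of_real (t\<^sup>2) * L q"
      by (simp add: F_def power2_eq_square algebra_simps)
    ultimately show ?thesis using t by (simp add: power2_eq_square mult.assoc)
  qed
  moreover have "t0 > 0" using d d1 by (simp add: t0_def)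
  ultimately show ?thesis by blast
qed

text \<open>The second difference over the square spanned by \<open>1\<close> and
  \<open>\<i>\<close> is symmetric in the two directions. Divided by \<open>t^2\<close> it
  approaches \<open>fxy\<close> if the first direction is integrated out, and \<open>fyx\<close> if
  the second is.\<close>

lemma mixed_partials_eq:
  assumes d: "0 < d"
    and f: "\<And>w. w \<in> ball z d \<Longrightarrow> (f has_derivative (\<lambda>h. Re h *\<^sub>R fx w + Im h *\<^sub>R fy w)) (at w)"
    and fx: "(fx has_derivative (\<lambda>h. Re h *\<^sub>R fxx + Im h *\<^sub>R fxy)) (at z)"
    and fy: "(fy has_derivative (\<lambda>h. Re h *\<^sub>R fyx + Im h *\<^sub>R fyy)) (at z)"
  shows "fxy = (fyx :: complex)"
proof -
  have line: "((\<lambda>s. f (w + of_real s * p)) has_vector_derivative Re p *\<^sub>R fx w + Im p *\<^sub>R fy w) (at 0)"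
    if "w \<in> ball z d" for w p
  proof -
    have 1: "((\<lambda>s. w + of_real s * p) has_derivative (\<lambda>s. of_real s * p)) (at (0::real))"
      by (auto intro!: derivative_eq_intros)
    have 2: "(f has_derivative (\<lambda>h. Re h *\<^sub>R fx w + Im h *\<^sub>R fy w)) (at (w + of_real 0 * p))"
      using f[OF that] by simp
    show ?thesis using diff_chain_at[OF 1 2] by (simp add: has_vector_derivative_def o_def scaleR_add_right mult.commute)
  qed
  have "norm (fxy - fyx) \<le> e" if e: "e > 0" for e
  proof -
    have px: "((\<lambda>s. f (w + of_real s * 1)) has_vector_derivative fx w) (at 0)" if "w \<in> ball z d" for w
      using line[OF that, of 1] by simp
    have py: "((\<lambda>s. f (w + of_real s * \<i>)) has_vector_derivative fy w) (at 0)" if "w \<in> ball z d" for w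
      using line[OF that, of \<i>] by simp
    obtain t1 where t1: "t1 > 0" "\<And>t. 0 < t \<Longrightarrow> t < t1 \<Longrightarrow> norm (f (z + of_real t * 1 + of_real t * \<i>) - f (z + of_real t * 1) - f (z + of_real t * \<i>) + f z
      - of_real (t\<^sup>2) * (Re \<i> *\<^sub>R fxx + Im \<i> *\<^sub>R fxy)) \<le> e / 2 * t\<^sup>2"
      using second_difference[OF d px fx, of \<i> "e / 2"] e by auto
    obtain t2 where t2: "t2 > 0" "\<And>t. 0 < t \<Longrightarrow> t < t2 \<Longrightarrow> norm (f (z + of_real t * \<i> + of_real t * 1) - f (z + of_real t * \<i>) - f (z + of_real t * 1) + f z
      - of_real (t\<^sup>2) * (Re 1 *\<^sub>R fyx + Im 1 *\<^sub>R fyy)) \<le> e / 2 * t\<^sup>2"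
      using second_difference[OF d py fy, of 1 "e / 2"] e by auto
    define t where "t = min t1 t2 / 2"
    have t: "0 < t" "t < t1" "t < t2" using t1(1) t2(1) by (auto simp: t_def)
    define D where "D = f (z + of_real t + of_real t * \<i>) - f (z + of_real t) - f (z + of_real t * \<i>) + f z"
    have "norm (D - of_real (t\<^sup>2) * fxy) \<le> e / 2 * t\<^sup>2"
      using t1(2)[OF t(1,2)] by (simp add: D_def)
    moreover have "norm (D - of_real (t\<^sup>2) * fyx) \<le> e / 2 * t\<^sup>2"
      using t2(2)[OF t(1,3)] by (simp add: D_def algebra_simps)
    moreover have "of_real (t\<^sup>2) * (fxy - fyx) = (D - of_real (t\<^sup>2) * fyx) - (D - of_real (t\<^sup>2) * fxy)"
      by (simp add: algebra_simps)
    hence "norm (of_real (t\<^sup>2) * (fxy - fyx))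
        \<le> norm (D - of_real (t\<^sup>2) * fyx) + norm (D - of_real (t\<^sup>2) * fxy)"
      by (simp only: norm_triangle_ineq4)
    ultimately have "norm (of_real (t\<^sup>2) * (fxy - fyx)) \<le> e / 2 * t\<^sup>2 + e / 2 * t\<^sup>2" by linarith
    hence "t\<^sup>2 * norm (fxy - fyx) \<le> t\<^sup>2 * e" by (simp add: norm_mult norm_power mult.commute)
    thus ?thesis using t by simp
  qed
  hence "norm (fxy - fyx) \<le> 0" by (rule field_le_epsilon) simp
  thus ?thesis by simp
qed

lemma harmonic_on_decompose:
  assumes "harmonic_on f \<D>"
  shows "\<exists>g h. g holomorphic_on \<D> \<and> h holomorphic_on \<D> \<and> (\<forall>z\<in>\<D>. f z = g z + cnj (h z))"
proof -
  obtain fx fy fxx fxy fyx fyy where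
    f: "\<And>z. z \<in> \<D> \<Longrightarrow> (f has_derivative (\<lambda>h. Re h *\<^sub>R fx z + Im h *\<^sub>R fy z)) (at z)" and
    fx: "\<And>z. z \<in> \<D> \<Longrightarrow> (fx has_derivative (\<lambda>h. Re h *\<^sub>R fxx z + Im h *\<^sub>R fxy z)) (at z)" and
    fy: "\<And>z. z \<in> \<D> \<Longrightarrow> (fy has_derivative (\<lambda>h. Re h *\<^sub>R fyx z + Im h *\<^sub>R fyy z)) (at z)" and
    lap: "\<And>z. z \<in> \<D> \<Longrightarrow> fxx z + fyy z = 0"
    using assms unfolding harmonic_on_def by blast
  have sym: "fyx z = fxy z" if z: "z \<in> \<D>" for z
  proof -
    obtain d where d: "d > 0" "ball z d \<subseteq> \<D>" using z open_ball openE by blast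
    show ?thesis
      by (rule mixed_partials_eq[symmetric, OF d(1) f fx[OF z] fy[OF z]]) (use d in blast)
  qed
  have yy: "fyy z = - fxx z" if "z \<in> \<D>" for z using lap[OF that] by (simp add: add_eq_0_iff)
  \<comment> \<open>Wirtinger derivatives: \<open>u\<close> is the derivative of \<open>f\<close> in
    \<open>z\<close>, and \<open>v\<close> is the conjugate of its derivative in
    \<open>cnj z\<close>. Equal mixed partials and vanishing Laplacian make both complex
    differentiable; their primitives give the two parts, up to a constant.\<close>
  define u where "u z = (fx z - \<i> * fy z) * (1 / 2)" for z
  define v where "v z = cnj ((fx z + \<i> * fy z) * (1 / 2))" for z
  have "(u has_field_derivative (fxx z - \<i> * fxy z) / 2) (at z)" if z: "z \<in> \<D>" for z
  proof -
    have "(u has_derivative (\<lambda>h. ((Re h *\<^sub>R fxx z + Im h *\<^sub>R fxy z) - \<i> * (Re h *\<^sub>R fyx z + Im h *\<^sub>R fyy z)) * (1 / 2))) (at z)"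
      unfolding u_def by (rule has_derivative_mult_left[OF has_derivative_diff[OF fx[OF z] has_derivative_mult_right[OF fy[OF z]]]])
    moreover have "((Re h *\<^sub>R fxx z + Im h *\<^sub>R fxy z) - \<i> * (Re h *\<^sub>R fyx z + Im h *\<^sub>R fyy z)) * (1 / 2) = (fxx z - \<i> * fxy z) / 2 * h" for h
      unfolding sym[OF z] yy[OF z] by (auto simp: complex_eq_iff algebra_simps)
    ultimately show ?thesis unfolding has_field_derivative_def by (simp only:)
  qed
  hence uh: "u holomorphic_on \<D>" using holomorphic_on_open by blast
  have "(v has_field_derivative cnj ((fxx z + \<i> * fxy z) / 2)) (at z)" if z: "z \<in> \<D>" for z
  proof -
    have "(v has_derivative (\<lambda>h. cnj (((Re h *\<^sub>R fxx z + Im h *\<^sub>R fxy z) + \<i> * (Re h *\<^sub>R fyx z + Im h *\<^sub>R fyy z)) * (1 / 2)))) (at z)"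
      unfolding v_def by (rule bounded_linear.has_derivative[OF bounded_linear_cnj
            has_derivative_mult_left[OF has_derivative_add[OF fx[OF z] has_derivative_mult_right[OF fy[OF z]]]]])
    moreover have "cnj (((Re h *\<^sub>R fxx z + Im h *\<^sub>R fxy z) + \<i> * (Re h *\<^sub>R fyx z + Im h *\<^sub>R fyy z)) * (1 / 2)) = cnj ((fxx z + \<i> * fxy z) / 2) * h" for h
      unfolding sym[OF z] yy[OF z] by (auto simp: complex_eq_iff algebra_simps)
    ultimately show ?thesis unfolding has_field_derivative_def by (simp only:)
  qed
  hence vh: "v holomorphic_on \<D>" using holomorphic_on_open by blast
  obtain g where g: "\<And>z. z \<in> \<D> \<Longrightarrow> (g has_field_derivative u z) (at z within \<D>)"
    using holomorphic_convex_primitive'[OF convex_ball open_ball uh] by blast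
  obtain h where h: "\<And>z. z \<in> \<D> \<Longrightarrow> (h has_field_derivative v z) (at z within \<D>)"
    using holomorphic_convex_primitive'[OF convex_ball open_ball vh] by blast
  have "\<exists>c. \<forall>z\<in>\<D>. f z - (g z + cnj (h z)) = c"
  proof (rule has_derivative_zero_constant[OF convex_ball])
    fix z assume z: "z \<in> \<D>"
    have "((\<lambda>z. f z - (g z + cnj (h z))) has_derivative (\<lambda>t. (Re t *\<^sub>R fx z + Im t *\<^sub>R fy z) - (u z * t + cnj (v z * t)))) (at z within \<D>)"
      using g[OF z] h[OF z] unfolding has_field_derivative_def
      by (intro derivative_intros has_derivative_at_withinI[OF f[OF z]] bounded_linear.has_derivative[OF bounded_linear_cnj]) auto
    moreover have "(Re t *\<^sub>R fx z + Im t *\<^sub>R fy z) - (u z * t + cnj (v z * t)) = 0" for t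
      by (auto simp: complex_eq_iff u_def v_def field_simps)
    ultimately show "((\<lambda>z. f z - (g z + cnj (h z))) has_derivative (\<lambda>h. 0)) (at z within \<D>)" by simp
  qed
  then obtain c where c: "\<And>z. z \<in> \<D> \<Longrightarrow> f z - (g z + cnj (h z)) = c" by blast
  have "g holomorphic_on \<D>" "h holomorphic_on \<D>"
    using g h unfolding holomorphic_on_def field_differentiable_def by blast+
  hence "(\<lambda>z. g z + c) holomorphic_on \<D>" "h holomorphic_on \<D>"
    by (auto intro!: holomorphic_intros)
  moreover have "f z = (g z + c) + cnj (h z)" if "z \<in> \<D>" for z using c[OF that] by (simp add: algebra_simps)
  ultimately show ?thesis by blast
qed

section \<open>Pseudohyperbolic lattices\<close>

lemma pseudohyp_dist_eq: "pseudohyp_dist z a = norm (z - a) / norm (1 - cnj a * z)"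
  by (simp add: pseudohyp_dist_def norm_divide)

lemma norm_one_minus_cnj_commute: "norm (1 - cnj a * z) = norm (1 - cnj z * a)"
proof -
  have "cnj (1 - cnj a * z) = 1 - cnj z * a" by (simp add: mult.commute)
  thus ?thesis by (metis complex_mod_cnj)
qed

lemma pseudohyp_dist_commute: "pseudohyp_dist z a = pseudohyp_dist a z"
  unfolding pseudohyp_dist_eq using norm_one_minus_cnj_commute norm_minus_commute by metis

text \<open>Since \<open>1 - cnj a * w = (1 - |a|^2) - cnj a * (w - a)\<close>, the distance
  reappears on the right with a factor of at most \<open>1/8\<close>. Absorbing it leaves
  \<open>7/8\<close> on the left, and \<open>2 * 8/7 < 3\<close>.\<close>

lemma pseudohyp_close:
  assumes w: "w \<in> \<D>" and a: "a \<in> \<D>" and e: "pseudohyp_dist w a < e" "e \<le> 1 / 8"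
  shows "norm (w - a) \<le> 3 * e * (1 - norm a)"
proof -
  have e0: "0 < e" using e(1) norm_ge_zero unfolding pseudohyp_dist_def by (meson le_less_trans)
  have na: "norm a < 1" using a by simp
  have pos: "0 < norm (1 - cnj a * w)" using norm_one_minus_cnj_mult(4)[OF w a] by simp
  have "1 - cnj a * w = of_real (1 - (norm a)\<^sup>2) - cnj a * (w - a)"
    by (simp add: algebra_simps complex_norm_square[symmetric] del: of_real_power)
  hence "norm (1 - cnj a * w) \<le> norm (of_real (1 - (norm a)\<^sup>2) :: complex) + norm (cnj a * (w - a))"
    by (simp only: norm_triangle_ineq4)
  also have "norm (of_real (1 - (norm a)\<^sup>2) :: complex) = 1 - (norm a)\<^sup>2"
    using na by (simp only: norm_of_real) (simp add: power_le_one abs_square_le_1)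
  also have "1 - (norm a)\<^sup>2 \<le> 2 * (1 - norm a)"
    using zero_le_power2[of "1 - norm a"] by (simp add: power2_eq_square algebra_simps)
  also have "norm (cnj a * (w - a)) \<le> norm (w - a)" using na by (simp add: norm_mult mult_left_le_one_le)
  finally have q: "norm (1 - cnj a * w) \<le> 2 * (1 - norm a) + norm (w - a)" by simp
  have "norm (w - a) \<le> e * norm (1 - cnj a * w)"
    using e(1) pos unfolding pseudohyp_dist_eq by (simp add: field_simps)
  also have "\<dots> \<le> e * (2 * (1 - norm a) + norm (w - a))" using q e0 by (intro mult_left_mono) auto
  also have "\<dots> \<le> 2 * e * (1 - norm a) + 1 / 8 * norm (w - a)"
    using mult_right_mono[OF e(2) norm_ge_zero[of "w - a"]] by (simp add: algebra_simps)
  finally have "7 / 8 * norm (w - a) \<le> 2 * (e * (1 - norm a))" by simp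
  moreover have "0 \<le> e * (1 - norm a)" using e0 na by simp
  ultimately have "norm (w - a) \<le> 3 * (e * (1 - norm a))" by linarith
  thus ?thesis by (simp add: mult.assoc)
qed

section \<open>Stability of the kernel under pseudohyperbolic perturbation\<close>

definition kern :: "complex \<Rightarrow> complex \<Rightarrow> real"
  where "kern z w = 1 / (norm (1 - cnj w * z))\<^sup>2"

lemma kern_commute: "kern z w = kern w z"
  unfolding kern_def using norm_one_minus_cnj_commute by metis

lemma kern_nonneg [simp]: "0 \<le> kern z w"
  by (simp add: kern_def)

lemma bergman_pos_kern: "bergman_pos h z = (\<integral>\<^sup>+u. h u * ennreal (kern z u) \<partial>dA)"
  by (simp add: bergman_pos_def kern_def)

lemma harmonic_kernel_le_kern: "z \<in> \<D> \<Longrightarrow> w \<in> \<D> \<Longrightarrow> norm (harmonic_kernel w z) \<le> 6 * kern z w"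
  using harmonic_kernel_bound[of z w] by (simp add: kern_def)

text \<open>The denominators \<open>p\<close> and \<open>q\<close> differ by at most
  \<open>3 * e * |p|\<close>, because \<open>|w - a| \<le> 3 * e * (1 - |a|)\<close> and
  \<open>1 - |a| \<le> |p|\<close>. They are thus comparable, and the difference of inverse squares
  gains the factor \<open>e\<close>: \<open>3 * 3 = 9\<close> for one half of the kernel, 18 with
  its conjugate.\<close>

lemma kern_estimates:
  assumes w: "w \<in> \<D>" and a: "a \<in> \<D>" and z: "z \<in> \<D>" and e: "pseudohyp_dist w a < e" "e \<le> 1 / 8"
  shows "kern z a \<le> 4 * kern z w" "norm (harmonic_kernel w z - harmonic_kernel a z) \<le> 18 * e * kern z w"
proof -
  define p where "p = 1 - cnj a * z"
  define q where "q = 1 - cnj w * z"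
  have e0: "0 < e" using e(1) norm_ge_zero unfolding pseudohyp_dist_def by (meson le_less_trans)
  have pq: "p \<noteq> 0" "q \<noteq> 0" "1 - norm a \<le> norm p"
    using norm_one_minus_cnj_mult[OF z a] norm_one_minus_cnj_mult[OF z w] by (auto simp: p_def q_def)
  have pos: "0 < norm p" "0 < norm q" using pq by auto
  have "norm (q - p) = norm (cnj (a - w) * z)" by (simp add: p_def q_def algebra_simps)
  also have "\<dots> \<le> norm (w - a)" using z by (simp add: norm_mult mult_left_le norm_minus_commute del: complex_cnj_diff)
  also have "\<dots> \<le> 3 * e * (1 - norm a)" by (rule pseudohyp_close[OF w a e])
  also have "\<dots> \<le> 3 * e * norm p" using pq e0 by (intro mult_left_mono) auto
  finally have d: "norm (q - p) \<le> 3 * e * norm p" .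
  have d': "norm (q - p) \<le> 3 / 8 * norm p"
    using d mult_right_mono[OF e(2) norm_ge_zero[of p]] by simp
  have le: "norm q \<le> 11 / 8 * norm p" "5 / 8 * norm p \<le> norm q"
    using d' norm_triangle_ineq2[of q p] norm_triangle_ineq3[of q p] by linarith+
  have "norm q \<le> 2 * norm p" using le pos by linarith
  hence "(norm q)\<^sup>2 \<le> (2 * norm p)\<^sup>2" by (intro power_mono) auto
  hence "(norm q)\<^sup>2 \<le> 4 * (norm p)\<^sup>2" by (simp add: power_mult_distrib)
  thus "kern z a \<le> 4 * kern z w" using pos unfolding kern_def p_def[symmetric] q_def[symmetric]
    by (simp add: field_simps)
  have "1 / q\<^sup>2 - 1 / p\<^sup>2 = (p - q) * (p + q) / (p\<^sup>2 * q\<^sup>2)"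
    using pq by (simp add: field_simps power2_eq_square)
  hence "norm (1 / q\<^sup>2 - 1 / p\<^sup>2) = norm (q - p) * norm (p + q) / ((norm p)\<^sup>2 * (norm q)\<^sup>2)"
    by (simp add: norm_mult norm_divide norm_power norm_minus_commute)
  also have "\<dots> \<le> (3 * e * norm p) * (3 * norm p) / ((norm p)\<^sup>2 * (norm q)\<^sup>2)"
  proof -
    have "norm (p + q) \<le> 3 * norm p" using norm_triangle_ineq[of p q] le pos by linarith
    thus ?thesis using d e0 by (intro divide_right_mono mult_mono) auto
  qed
  also have "\<dots> = 9 * e / (norm q)\<^sup>2" using pos by (simp add: field_simps power2_eq_square)
  finally have D: "norm (1 / q\<^sup>2 - 1 / p\<^sup>2) \<le> 9 * e / (norm q)\<^sup>2" .
  have cn: "1 - cnj z * w = cnj q" "1 - cnj z * a = cnj p" by (auto simp: p_def q_def mult.commute)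
  have "harmonic_kernel w z - harmonic_kernel a z = cnj (1 / q\<^sup>2 - 1 / p\<^sup>2) + (1 / q\<^sup>2 - 1 / p\<^sup>2)"
    unfolding harmonic_kernel_def cn p_def[symmetric] q_def[symmetric] by simp
  hence "norm (harmonic_kernel w z - harmonic_kernel a z) \<le> norm (cnj (1 / q\<^sup>2 - 1 / p\<^sup>2)) + norm (1 / q\<^sup>2 - 1 / p\<^sup>2)"
    by (simp only: norm_triangle_ineq)
  also have "\<dots> \<le> 9 * e / (norm q)\<^sup>2 + 9 * e / (norm q)\<^sup>2" using D by (simp only: complex_mod_cnj)
  finally show "norm (harmonic_kernel w z - harmonic_kernel a z) \<le> 18 * e * kern z w"
    by (simp add: kern_def q_def)
qed

section \<open>Pseudohyperbolic disks and existence of lattices\<close>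

lemma pseudohyp_disk_measurable [measurable]:
  assumes "a \<in> \<D>"
  shows "pseudohyp_disk a r \<in> sets dA"
proof -
  have "continuous_on \<D> (\<lambda>z. pseudohyp_dist z a)"
    unfolding pseudohyp_dist_eq[abs_def] using norm_one_minus_cnj_mult(4)[OF _ assms]
    by (intro continuous_intros) auto
  hence [measurable]: "(\<lambda>z. pseudohyp_dist z a) \<in> borel_measurable dA" by (rule continuous_on_measurable_dA)
  have "{z \<in> space dA. pseudohyp_dist z a < r} \<in> sets dA" by measurable
  thus ?thesis by (simp add: pseudohyp_disk_def)
qed

text \<open>The Euclidean ball of radius \<open>r * (1 - |a|)\<close> fits inside. Positivity passes
  to \<open>mD\<close>, whose negative power would otherwise be 0 by convention.\<close>

lemma emeasure_pseudohyp_disk_pos: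
  assumes a: "a \<in> \<D>" and r: "0 < r" "r \<le> 1"
  shows "0 < emeasure dA (pseudohyp_disk a r)"
proof -
  have na: "norm a < 1" using a by simp
  have "r * (1 - norm a) \<le> 1 * (1 - norm a)" using r na by (intro mult_right_mono) auto
  hence le: "norm a + r * (1 - norm a) \<le> 1" by simp
  have D: "ball a (r * (1 - norm a)) \<subseteq> \<D>"
  proof
    fix z assume "z \<in> ball a (r * (1 - norm a))"
    hence "norm z < norm a + r * (1 - norm a)"
      using norm_triangle_ineq2[of z a] by (simp add: dist_norm norm_minus_commute)
    thus "z \<in> \<D>" using le by simp
  qed
  have "ball a (r * (1 - norm a)) \<subseteq> pseudohyp_disk a r"
  proof
    fix z assume z: "z \<in> ball a (r * (1 - norm a))"
    hence zD: "z \<in> \<D>" using D by blast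
    have "norm (z - a) < r * (1 - norm a)" using z by (simp add: dist_norm norm_minus_commute)
    also have "\<dots> \<le> r * norm (1 - cnj a * z)" using norm_one_minus_cnj_mult(2)[OF zD a] r by (intro mult_left_mono) auto
    finally have "pseudohyp_dist z a < r"
      using norm_one_minus_cnj_mult(4)[OF zD a] by (simp add: pseudohyp_dist_eq field_simps)
    thus "z \<in> pseudohyp_disk a r" using zD by (simp add: pseudohyp_disk_def)
  qed
  hence "emeasure dA (ball a (r * (1 - norm a))) \<le> emeasure dA (pseudohyp_disk a r)"
    using a by (intro emeasure_mono) auto
  moreover have "emeasure dA (ball a (r * (1 - norm a))) = ennreal ((r * (1 - norm a))\<^sup>2)"
    using D r na by (intro emeasure_dA_ball) auto
  moreover have "0 < ennreal ((r * (1 - norm a))\<^sup>2)" using r na by simp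
  ultimately show ?thesis by (metis less_le_trans)
qed

text \<open>On \<open>|x| \<le> 1 - 1/(n+1)\<close> pseudohyperbolic separation by \<open>d\<close>
  implies Euclidean separation by \<open>d/(n+1)\<close>, and a bounded set that is separated in
  this sense is finite.\<close>

lemma separated_countable:
  assumes S: "S \<subseteq> \<D>" and sep: "\<And>x y. x \<in> S \<Longrightarrow> y \<in> S \<Longrightarrow> x \<noteq> y \<Longrightarrow> d \<le> pseudohyp_dist x y" and d: "0 < d"
  shows "countable S"
proof -
  define T where "T n = {x \<in> S. norm x \<le> 1 - 1 / real (Suc n)}" for n
  have "finite (T n)" for n
  proof (rule ccontr)
    assume "infinite (T n)"
    moreover have "bounded (T n)" using S by (intro bounded_subset[OF bounded_ball[of 0 1]]) (auto simp: T_def)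
    ultimately obtain x where "x islimpt T n" using bounded_infinite_imp_islimpt by blast
    moreover have "\<forall>x\<in>T n. \<forall>y\<in>T n. dist y x < d / real (Suc n) \<longrightarrow> y = x"
    proof (intro ballI impI, rule ccontr)
      fix x y assume xy: "x \<in> T n" "y \<in> T n" "dist y x < d / real (Suc n)" "y \<noteq> x"
      hence D: "x \<in> \<D>" "y \<in> \<D>" "x \<in> S" "y \<in> S" using S by (auto simp: T_def)
      have "1 / real (Suc n) \<le> 1 - norm x" using xy by (simp add: T_def)
      also have "\<dots> \<le> norm (1 - cnj x * y)" by (rule norm_one_minus_cnj_mult(2)[OF D(2,1)])
      finally have "d * (1 / real (Suc n)) \<le> d * norm (1 - cnj x * y)" using d by (intro mult_left_mono) auto
      moreover have "d \<le> pseudohyp_dist y x" using sep[OF D(4,3) xy(4)] .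
      hence "d * norm (1 - cnj x * y) \<le> norm (y - x)"
        using norm_one_minus_cnj_mult(4)[OF D(2,1)] by (simp add: pseudohyp_dist_eq field_simps)
      ultimately show False using xy(3) by (simp add: dist_norm)
    qed
    ultimately show False using discrete_imp_not_islimpt[of "d / real (Suc n)" "T n"] d by auto
  qed
  moreover have "S = (\<Union>n. T n)"
  proof (intro equalityI subsetI)
    fix x assume x: "x \<in> S"
    hence "0 < 1 - norm x" using S by auto
    then obtain n where "inverse (real (Suc n)) < 1 - norm x" using reals_Archimedean by blast
    hence "x \<in> T n" using x by (simp add: T_def inverse_eq_divide)
    thus "x \<in> (\<Union>n. T n)" by blast
  qed (auto simp: T_def)
  ultimately show ?thesis by (metis countable_UN countable_finite uncountable_def countableI_type)
qed

text \<open>A maximal \<open>e/2\<close>-separated set covers the disk, since a point at distance at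
  least \<open>e\<close> from all of it could be added. It is infinite because finitely many such
  disks stay away from the circle; so it can be enumerated injectively, as separation of distinct
  indices requires.\<close>

lemma lattice_exists:
  assumes e: "0 < e" "e \<le> 1 / 8"
  shows "\<exists>a. is_lattice e a"
proof -
  define \<A> where "\<A> = {S. S \<subseteq> \<D> \<and> (\<forall>x\<in>S. \<forall>y\<in>S. x \<noteq> y \<longrightarrow> e / 2 \<le> pseudohyp_dist x y)}"
  have "\<exists>M\<in>\<A>. \<forall>X\<in>\<A>. M \<subseteq> X \<longrightarrow> X = M"
  proof (rule subset_Zorn')
    fix \<C> assume c: "subset.chain \<A> \<C>"
    show "\<Union>\<C> \<in> \<A>"
      unfolding \<A>_def
    proof (intro CollectI conjI ballI impI)
      show "\<Union>\<C> \<subseteq> \<D>" using c by (auto simp: \<A>_def subset.chain_def)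
      fix x y assume "x \<in> \<Union>\<C>" "y \<in> \<Union>\<C>" "x \<noteq> y"
      then obtain X Y where XY: "x \<in> X" "y \<in> Y" "X \<in> \<C>" "Y \<in> \<C>" by blast
      have "X \<subseteq> Y \<or> Y \<subseteq> X" using c XY by (auto simp: subset.chain_def)
      then obtain Z where "x \<in> Z" "y \<in> Z" "Z \<in> \<C>" using XY by blast
      moreover from this have "Z \<in> \<A>" using c by (auto simp: subset.chain_def)
      ultimately show "e / 2 \<le> pseudohyp_dist x y" using \<open>x \<noteq> y\<close> by (auto simp: \<A>_def)
    qed
  qed
  then obtain M where M: "M \<in> \<A>" "\<And>X. X \<in> \<A> \<Longrightarrow> M \<subseteq> X \<Longrightarrow> X = M" by blast
  have MD: "M \<subseteq> \<D>" and sep: "\<And>x y. x \<in> M \<Longrightarrow> y \<in> M \<Longrightarrow> x \<noteq> y \<Longrightarrow> e / 2 \<le> pseudohyp_dist x y"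
    using M(1) by (auto simp: \<A>_def)
  have cover: "\<exists>x\<in>M. pseudohyp_dist z x < e" if z: "z \<in> \<D>" for z
  proof (rule ccontr)
    assume "\<not> ?thesis"
    hence far: "pseudohyp_dist z x \<ge> e" if "x \<in> M" for x using that by force
    have "e / 2 \<le> pseudohyp_dist z x" "e / 2 \<le> pseudohyp_dist x z" if "x \<in> M" for x
      using far[OF that] e unfolding pseudohyp_dist_commute[of x z] by linarith+
    hence "insert z M \<in> \<A>"
      unfolding \<A>_def using MD z sep by blast
    hence "z \<in> M" using M(2)[of "insert z M"] by blast
    hence "e \<le> pseudohyp_dist z z" by (rule far)
    thus False using e by (simp add: pseudohyp_dist_def)
  qed
  have count: "countable M" by (rule separated_countable[OF MD sep]) (use e in auto)
  have inf: "infinite M"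
  proof
    assume fin: "finite M"
    have ne: "M \<noteq> {}" using cover[of 0] by auto
    define r where "r = Max (norm ` M)"
    have r: "norm x \<le> r" if "x \<in> M" for x using fin that by (simp add: r_def)
    have r1: "r < 1" using fin ne MD by (auto simp: r_def)
    have r0: "0 \<le> r" using ne r norm_ge_zero by (meson ex_in_conv order.trans)
    \<comment> \<open>A point at half the depth \<open>1 - r\<close> of the outermost members. A
      member \<open>x\<close> covering it would force \<open>1 - |z| \<ge> 5/8 * (1 - |x|)\<close>,
      impossible since \<open>1 - |x| \<ge> 1 - r\<close>.\<close>
    define z :: complex where "z = of_real (1 - (1 - r) / 2)"
    have nz: "norm z = 1 - (1 - r) / 2" unfolding z_def norm_of_real using r0 r1 by simp
    hence "z \<in> \<D>" using r1 by simp
    then obtain x where x: "x \<in> M" "pseudohyp_dist z x < e" using cover by blast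
    have "norm (z - x) \<le> 3 * e * (1 - norm x)" using pseudohyp_close[OF \<open>z \<in> \<D>\<close> _ x(2) e(2)] MD x by blast
    also have "\<dots> \<le> 3 / 8 * (1 - norm x)" using e MD x by (intro mult_right_mono) auto
    finally have "norm z \<le> norm x + 3 / 8 * (1 - norm x)" using norm_triangle_ineq2[of z x] by linarith
    thus False using nz r[OF x(1)] r1 by (simp add: field_simps)
  qed
  define a where "a = from_nat_into M"
  have bij: "bij_betw a UNIV M" unfolding a_def using count inf by (rule bij_betw_from_nat_into)
  hence ran: "range a = M" and inj: "inj a" by (auto simp: bij_betw_def)
  have "is_lattice e a"
    unfolding is_lattice_def
  proof (intro conjI allI impI)
    show "range a \<subseteq> \<D>" using ran MD by simp
    show "\<D> = (\<Union>n. pseudohyp_disk (a n) e)"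
    proof
      show "\<D> \<subseteq> (\<Union>n. pseudohyp_disk (a n) e)"
      proof
        fix z assume z: "z \<in> \<D>"
        then obtain x where "x \<in> M" "pseudohyp_dist z x < e" using cover by blast
        moreover from this obtain n where "x = a n" using ran by blast
        ultimately show "z \<in> (\<Union>n. pseudohyp_disk (a n) e)" using z by (auto simp: pseudohyp_disk_def)
      qed
    qed (auto simp: pseudohyp_disk_def)
    fix n m :: nat assume "n \<noteq> m"
    hence "a n \<noteq> a m" using inj by (auto dest: injD)
    thus "e / 2 \<le> pseudohyp_dist (a n) (a m)" using sep ran by blast
  qed
  thus ?thesis by blast
qed

section \<open>Discretization\<close>

text \<open>Fubini for an absolutely convergent double series, with the sum over \<open>n\<close>
  read as an integral over \<open>count_space UNIV\<close>.\<close>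

lemma sums_swap:
  fixes A :: "nat \<Rightarrow> nat \<Rightarrow> 'a::{banach, second_countable_topology}"
  assumes A: "\<And>k. summable (\<lambda>n. norm (A n k))" "\<And>k. (\<Sum>n. norm (A n k)) \<le> B k" and B: "summable B"
  shows "(\<lambda>n. \<Sum>k. A n k) sums (\<Sum>k. \<Sum>n. A n k)" "summable (\<lambda>k. norm (A n k))"
proof -
  have AB: "norm (A n k) \<le> B k" for n k
    using sum_le_suminf[OF A(1)[of k], of "{n}"] A(2)[of k] by simp
  show s: "summable (\<lambda>k. norm (A n k))" for n
    using AB by (intro summable_comparison_test'[OF B, of 0]) auto
  have int: "integrable (count_space UNIV) (\<lambda>n. A n k)" for k
    using A(1) by (simp add: integrable_count_space_nat_iff)
  have sk: "summable (\<lambda>k. \<integral>n. norm (A n k) \<partial>count_space UNIV)"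
  proof (rule summable_comparison_test'[OF B, of 0])
    fix k
    have "(\<integral>n. norm (A n k) \<partial>count_space UNIV) = (\<Sum>n. norm (A n k))"
      using A(1) by (intro integral_count_space_nat) (simp add: integrable_count_space_nat_iff)
    moreover have "0 \<le> (\<Sum>n. norm (A n k))" using A(1) by (intro suminf_nonneg) auto
    ultimately show "norm (\<integral>n. norm (A n k) \<partial>count_space UNIV) \<le> B k" using A(2) by simp
  qed
  have ae: "AE n in count_space UNIV. summable (\<lambda>k. norm (A n k))" using s by simp
  have I: "integrable (count_space UNIV) (\<lambda>n. \<Sum>k. A n k)" by (rule integrable_suminf[OF int ae sk])
  have "(\<integral>n. (\<Sum>k. A n k) \<partial>count_space UNIV) = (\<Sum>k. \<integral>n. A n k \<partial>count_space UNIV)"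
    by (rule integral_suminf[OF int ae sk])
  also have "\<dots> = (\<Sum>k. \<Sum>n. A n k)" using int by (simp add: integral_count_space_nat)
  finally show "(\<lambda>n. \<Sum>k. A n k) sums (\<Sum>k. \<Sum>n. A n k)" using sums_integral_count_space_nat[OF I] by simp
qed

lemma summable_of_ennreal_suminf:
  assumes "\<And>n. 0 \<le> x n" "(\<Sum>n. ennreal (x n)) \<le> ennreal B" "0 \<le> B"
  shows "summable x" "(\<Sum>n. x n) \<le> B"
proof -
  have "(\<Sum>n. ennreal (x n)) \<noteq> top" using assms(2) by (auto simp: top_unique)
  thus s: "summable x" using assms(1) by (intro summable_suminf_not_top) auto
  have "ennreal (\<Sum>n. x n) = (\<Sum>n. ennreal (x n))" using s assms(1) by (intro suminf_ennreal2[symmetric]) auto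
  thus "(\<Sum>n. x n) \<le> B" using assms by (metis ennreal_le_iff)
qed

lemma ennreal_le_sqrtI:
  assumes "(x::ennreal)\<^sup>2 \<le> ennreal y" "0 \<le> y"
  shows "x \<le> ennreal (sqrt y)"
proof -
  have "x < top" using assms(1) by (cases x) (auto simp: top_unique power2_eq_square ennreal_mult_top)
  then obtain r where r: "x = ennreal r" "0 \<le> r" by (cases x) auto
  have "r\<^sup>2 \<le> y" using assms r by (simp add: ennreal_power)
  thus ?thesis using r by (simp add: ennreal_leI real_le_rsqrt)
qed

section \<open>Functions reproduced by the harmonic kernel\<close>

context A2_disk_weight
begin

abbreviation nrm :: "(complex \<Rightarrow> complex) \<Rightarrow> complex \<Rightarrow> ennreal"
  where "nrm f \<equiv> \<lambda>z. ennreal (norm (f z))"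

definition maj :: "(complex \<Rightarrow> complex) \<Rightarrow> complex \<Rightarrow> ennreal"
  where "maj f = bergman_pos (nrm f)"

text \<open>Stands in for the harmonic space: the estimates below use only the kernel identity and
  the weighted norm, and both properties survive the subtraction of \<open>sample f\<close>.\<close>

definition reproduced :: "(complex \<Rightarrow> complex) \<Rightarrow> bool"
  where "reproduced f \<longleftrightarrow> f \<in> borel_measurable dA \<and> wnorm2 (nrm f) < \<infinity> \<and>
    (\<forall>z\<in>\<D>. f z = (\<integral>w. f w * harmonic_kernel w z \<partial>dA))"

lemma wnorm2_mono: "(\<And>z. z \<in> \<D> \<Longrightarrow> g z \<le> h z) \<Longrightarrow> wnorm2 g \<le> wnorm2 h"
  unfolding wnorm2_def by (intro nn_integral_mono mult_right_mono power_mono) auto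

lemma wnorm2_cmult:
  assumes [measurable]: "h \<in> borel_measurable dA"
  shows "wnorm2 (\<lambda>z. c * h z) = c\<^sup>2 * wnorm2 h"
  unfolding wnorm2_def by (subst nn_integral_cmult[symmetric]) (auto simp: power_mult_distrib mult.assoc)

lemma bergman_pos_wnorm2_finite:
  assumes "h \<in> borel_measurable dA" "wnorm2 h < \<infinity>"
  shows "wnorm2 (bergman_pos h) < \<infinity>"
  using bergman_pos_bounded[OF assms] assms(2)
  by (elim le_less_trans) (simp add: ennreal_mult_less_top)

lemma bergman_pos_finite:
  assumes "h \<in> borel_measurable dA" "wnorm2 h < \<infinity>" "z \<in> \<D>"
  shows "bergman_pos h z < \<infinity>"
  using bergman_pos_le[OF assms(1,3)] nn_integral_finite[OF assms(1,2)]
  by (elim le_less_trans) (simp add: ennreal_mult_less_top)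

text \<open>A Harnack inequality: kernels at pseudohyperbolically close points are comparable,
  uniformly in the variable of integration.\<close>

lemma bergman_pos_kern_mono:
  assumes x: "x \<in> \<D>" and b: "b \<in> \<D>" and e: "pseudohyp_dist x b < e" "e \<le> 1 / 8" and h: "h \<in> borel_measurable dA"
  shows "bergman_pos h b \<le> 4 * bergman_pos h x"
proof -
  have "bergman_pos h b \<le> (\<integral>\<^sup>+u. 4 * (h u * ennreal (kern x u)) \<partial>dA)"
    unfolding bergman_pos_kern
  proof (rule nn_integral_mono)
    fix u assume "u \<in> space dA"
    hence "kern b u \<le> 4 * kern x u" using kern_estimates(1)[OF x b _ e, of u] by (simp add: kern_commute)
    hence "ennreal (kern b u) \<le> ennreal 4 * ennreal (kern x u)" by (subst ennreal_mult[symmetric]) (auto intro: ennreal_leI)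
    hence "h u * ennreal (kern b u) \<le> h u * (ennreal 4 * ennreal (kern x u))" by (rule mult_left_mono) simp
    thus "h u * ennreal (kern b u) \<le> 4 * (h u * ennreal (kern x u))" by (simp add: mult_ac)
  qed
  also have "\<dots> = 4 * bergman_pos h x"
    unfolding bergman_pos_kern using h by (intro nn_integral_cmult) (simp add: kern_def)
  finally show ?thesis .
qed

lemma kernel_integral_bound:
  assumes [measurable]: "f \<in> borel_measurable dA" "g \<in> borel_measurable dA"
    and g: "\<And>u. u \<in> \<D> \<Longrightarrow> norm (g u) \<le> c * kern z u" and c: "0 \<le> c" and fin: "maj f z < \<infinity>"
  shows "integrable dA (\<lambda>u. f u * (g u :: complex))" "ennreal (norm (\<integral>u. f u * g u \<partial>dA)) \<le> ennreal c * maj f z"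
proof -
  have "(\<integral>\<^sup>+u. ennreal (norm (f u * g u)) \<partial>dA) \<le> (\<integral>\<^sup>+u. ennreal c * (nrm f u * ennreal (kern z u)) \<partial>dA)"
  proof (rule nn_integral_mono)
    fix u assume "u \<in> space dA"
    hence "norm (f u * g u) \<le> c * (norm (f u) * kern z u)"
      using mult_left_mono[OF g, of u "norm (f u)"] by (simp add: norm_mult mult_ac)
    hence "ennreal (norm (f u * g u)) \<le> ennreal (c * (norm (f u) * kern z u))" by (rule ennreal_leI)
    thus "ennreal (norm (f u * g u)) \<le> ennreal c * (nrm f u * ennreal (kern z u))" using c by (simp add: ennreal_mult)
  qed
  also have "\<dots> = ennreal c * maj f z"
    unfolding maj_def bergman_pos_kern by (intro nn_integral_cmult) (simp add: kern_def)
  finally have *: "(\<integral>\<^sup>+u. ennreal (norm (f u * g u)) \<partial>dA) \<le> ennreal c * maj f z" .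
  also have "\<dots> < \<infinity>" using fin by (simp add: ennreal_mult_less_top)
  finally show int: "integrable dA (\<lambda>u. f u * g u)" by (intro integrableI_bounded) auto
  show "ennreal (norm (\<integral>u. f u * g u \<partial>dA)) \<le> ennreal c * maj f z"
    using integral_norm_bound_ennreal[OF int] * by (rule order.trans)
qed

lemma reproducedD:
  assumes "reproduced f"
  shows "f \<in> borel_measurable dA" "wnorm2 (nrm f) < \<infinity>" "nrm f \<in> borel_measurable dA" "maj f \<in> borel_measurable dA"
    "wnorm2 (maj f) < \<infinity>" "wnorm2 (maj f) \<le> ennreal op_const * wnorm2 (nrm f)"
    "z \<in> \<D> \<Longrightarrow> f z = (\<integral>w. f w * harmonic_kernel w z \<partial>dA)"
    "z \<in> \<D> \<Longrightarrow> maj f z < \<infinity>"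
    "z \<in> \<D> \<Longrightarrow> integrable dA (\<lambda>w. f w * harmonic_kernel w z)"
proof -
  show m [measurable]: "f \<in> borel_measurable dA" and fin: "wnorm2 (nrm f) < \<infinity>" using assms by (auto simp: reproduced_def)
  show m': "nrm f \<in> borel_measurable dA" by measurable
  show "maj f \<in> borel_measurable dA" unfolding maj_def by measurable
  show "wnorm2 (maj f) < \<infinity>" unfolding maj_def by (rule bergman_pos_wnorm2_finite[OF m' fin])
  show "wnorm2 (maj f) \<le> ennreal op_const * wnorm2 (nrm f)" unfolding maj_def by (rule bergman_pos_bounded[OF m' fin])
  show "z \<in> \<D> \<Longrightarrow> f z = (\<integral>w. f w * harmonic_kernel w z \<partial>dA)" using assms by (auto simp: reproduced_def)
  show fz: "z \<in> \<D> \<Longrightarrow> maj f z < \<infinity>" unfolding maj_def by (rule bergman_pos_finite[OF m' fin])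
  show "z \<in> \<D> \<Longrightarrow> integrable dA (\<lambda>w. f w * harmonic_kernel w z)"
    by (rule kernel_integral_bound(1)[OF m _ harmonic_kernel_le_kern _ fz]) simp_all
qed

lemma reproduced_le_maj:
  assumes f: "reproduced f" and z: "z \<in> \<D>"
  shows "nrm f z \<le> 6 * maj f z"
proof -
  have "ennreal (norm (\<integral>w. f w * harmonic_kernel w z \<partial>dA)) \<le> ennreal 6 * maj f z"
    by (rule kernel_integral_bound(2)[OF reproducedD(1)[OF f] _ harmonic_kernel_le_kern[OF z] _ reproducedD(8)[OF f z]]) simp_all
  thus ?thesis by (simp add: reproducedD(7)[OF f z, symmetric])
qed

text \<open>The smallness comes from the kernel: the reproducing integrals at \<open>x\<close> and
  \<open>b\<close> are subtracted under the integral sign.\<close>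

lemma reproduced_diff_le_maj:
  assumes f: "reproduced f" and x: "x \<in> \<D>" and b: "b \<in> \<D>" and e: "pseudohyp_dist x b < e" "e \<le> 1 / 8"
  shows "ennreal (norm (f x - f b)) \<le> ennreal (18 * e) * maj f x"
proof -
  have e0: "0 < e" using e(1) norm_ge_zero unfolding pseudohyp_dist_def by (meson le_less_trans)
  have "f x - f b = (\<integral>u. f u * (harmonic_kernel u x - harmonic_kernel u b) \<partial>dA)"
    using reproducedD(7)[OF f x] reproducedD(7)[OF f b] reproducedD(9)[OF f x] reproducedD(9)[OF f b]
    by (simp add: right_diff_distrib)
  moreover have "ennreal (norm (\<integral>u. f u * (harmonic_kernel u x - harmonic_kernel u b) \<partial>dA)) \<le> ennreal (18 * e) * maj f x"
  proof (rule kernel_integral_bound(2))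
    fix u assume u: "u \<in> \<D>"
    show "norm (harmonic_kernel u x - harmonic_kernel u b) \<le> 18 * e * kern x u"
      using kern_estimates(2)[OF x b u e] by (simp add: harmonic_kernel_commute[of u] kern_commute[of x])
  next
    show "(\<lambda>u. harmonic_kernel u x - harmonic_kernel u b) \<in> borel_measurable dA" by measurable
  qed (use e0 reproducedD(1)[OF f] reproducedD(8)[OF f x] in simp_all)
  ultimately show ?thesis by simp
qed

text \<open>Moving the majorant from a node \<open>b\<close> to any nearby \<open>x\<close> turns a
  point value into something that can be integrated over a cell; \<open>24 = 6 * 4\<close>.\<close>

lemma reproduced_near_le_maj:
  assumes f: "reproduced f" and x: "x \<in> \<D>" and b: "b \<in> \<D>" and e: "pseudohyp_dist x b < e" "e \<le> 1 / 8"
  shows "nrm f b \<le> 24 * maj f x"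
proof -
  have "nrm f b \<le> 6 * maj f b" by (rule reproduced_le_maj[OF f b])
  also have "maj f b \<le> 4 * maj f x"
    unfolding maj_def by (rule bergman_pos_kern_mono[OF x b e reproducedD(3)[OF f]])
  finally show ?thesis by (simp add: mult_left_mono mult.assoc[symmetric])
qed

lemma reproduced_diff:
  assumes f: "reproduced f" and g: "g \<in> borel_measurable dA" "\<And>z. z \<in> \<D> \<Longrightarrow> g z = (\<integral>w. g w * harmonic_kernel w z \<partial>dA)"
    and int: "\<And>z. z \<in> \<D> \<Longrightarrow> integrable dA (\<lambda>w. g w * harmonic_kernel w z)"
    and fin: "wnorm2 (nrm (\<lambda>z. f z - g z)) < \<infinity>"
  shows "reproduced (\<lambda>z. f z - g z)"
  unfolding reproduced_def
proof (intro conjI ballI fin)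
  show "(\<lambda>z. f z - g z) \<in> borel_measurable dA" using reproducedD(1)[OF f] g(1) by measurable
  fix z assume z: "z \<in> \<D>"
  show "f z - g z = (\<integral>w. (f w - g w) * harmonic_kernel w z \<partial>dA)"
    using reproducedD(7)[OF f z] g(2)[OF z] reproducedD(9)[OF f z] int[OF z] by (simp add: left_diff_distrib)
qed

end

text \<open>The kernel is itself bounded and harmonic, with its constant \<open>-1\<close> assigned
  to the holomorphic part. This is what lets series of kernels inherit the reproducing
  identity.\<close>

lemma harmonic_kernel_reproduced:
  assumes b: "b \<in> \<D>" and z: "z \<in> \<D>"
  shows "harmonic_kernel b z = (\<integral>w. harmonic_kernel b w * harmonic_kernel w z \<partial>dA)"
proof (rule reproducing_formula)
  have ne: "1 - cnj b * w \<noteq> 0" if "w \<in> \<D>" for w using norm_one_minus_cnj_mult(4)[OF that b] .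
  show "(\<lambda>w. 1 / (1 - cnj b * w)\<^sup>2 - 1) holomorphic_on \<D>" "(\<lambda>w. 1 / (1 - cnj b * w)\<^sup>2) holomorphic_on \<D>"
    using ne by (auto intro!: holomorphic_intros simp del: mem_ball)
  show "harmonic_kernel b w = 1 / (1 - cnj b * w)\<^sup>2 - 1 + cnj (1 / (1 - cnj b * w)\<^sup>2)" for w
    by (simp add: harmonic_kernel_def mult.commute)
  show "integrable dA (\<lambda>w. harmonic_kernel b w)"
  proof (rule dA.integrable_const_bound[where B = "6 / (1 - norm b)\<^sup>2"])
    have "(\<lambda>w. harmonic_kernel w b) \<in> borel_measurable dA" by measurable
    thus "harmonic_kernel b \<in> borel_measurable dA" by (simp add: harmonic_kernel_commute[of _ b])
    show "AE w in dA. norm (harmonic_kernel b w) \<le> 6 / (1 - norm b)\<^sup>2"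
      using harmonic_kernel_bounded[OF b] by (intro AE_I2) (simp add: harmonic_kernel_commute[of b])
  qed
qed (rule z)

section \<open>The sampling operator on a lattice\<close>

locale A2_lattice = A2_disk_weight +
  fixes e :: real and a :: "nat \<Rightarrow> complex"
  assumes e_pos: "0 < e" and e_le: "e \<le> 1 / 8" and lattice: "is_lattice e a"
begin

abbreviation "Dn n \<equiv> pseudohyp_disk (a n) e"

text \<open>The disks overlap; \<open>disjointed\<close> cuts them down to a partition of
  \<open>\<D>\<close>. A cell may become empty, so the estimates avoid dividing by its area.\<close>

definition E :: "nat \<Rightarrow> complex set"
  where "E = disjointed Dn"

definition area :: "nat \<Rightarrow> real"
  where "area n = measure dA (E n)"

definition sample :: "(complex \<Rightarrow> complex) \<Rightarrow> complex \<Rightarrow> complex"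
  where "sample f z = (\<Sum>n. f (a n) * of_real (area n) * harmonic_kernel (a n) z)"

lemma a_in [simp]: "a n \<in> \<D>"
proof -
  have "range a \<subseteq> \<D>" using lattice unfolding is_lattice_def by (rule conjunct1)
  thus ?thesis by (rule subsetD) simp
qed

lemma Dn_measurable [measurable]: "Dn n \<in> sets dA"
  by (rule pseudohyp_disk_measurable) (rule a_in)

lemma E_measurable [measurable]: "E n \<in> sets dA"
proof -
  have "range Dn \<subseteq> sets dA" by auto
  thus ?thesis unfolding E_def using sets.range_disjointed_sets by blast
qed

lemma E_disjoint: "disjoint_family E"
  unfolding E_def by (rule disjoint_family_disjointed)

lemma E_union: "(\<Union>n. E n) = \<D>"
  unfolding E_def UN_disjointed_eq using lattice by (simp add: is_lattice_def)

lemma ex_E: "x \<in> \<D> \<Longrightarrow> \<exists>n. x \<in> E n"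
  using E_union by blast

lemma E_subset: "E n \<subseteq> Dn n"
  unfolding E_def by (rule disjointed_subset)

lemma in_E: "x \<in> E n \<Longrightarrow> x \<in> \<D> \<and> pseudohyp_dist x (a n) < e"
  using E_subset by (auto simp: pseudohyp_disk_def)

lemma suminf_nn_integral_E:
  assumes [measurable]: "h \<in> borel_measurable dA"
  shows "(\<Sum>n. \<integral>\<^sup>+x\<in>E n. h x \<partial>dA) = (\<integral>\<^sup>+x. h x \<partial>dA)"
proof -
  have "(\<Sum>n. \<integral>\<^sup>+x\<in>E n. h x \<partial>dA) = (\<integral>\<^sup>+x. (\<Sum>n. h x * indicator (E n) x) \<partial>dA)"
    by (intro nn_integral_suminf[symmetric]) measurable
  also have "\<dots> = (\<integral>\<^sup>+x. h x \<partial>dA)"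
    by (intro nn_integral_cong) (simp add: ennreal_suminf_cmult suminf_indicator[OF E_disjoint] E_union)
  finally show ?thesis .
qed

lemma maj_kern_measurable:
  assumes "reproduced f"
  shows "(\<lambda>u. maj f u * ennreal (kern z u)) \<in> borel_measurable dA"
  using reproducedD(4)[OF assms] unfolding kern_def by measurable

text \<open>For \<open>x\<close> in the cell, \<open>24 * maj f x\<close> bounds the value at the
  node and \<open>6 * 4 * kern z x\<close> bounds the kernel at the node, so
  \<open>576 = 24 * 24\<close>. The factor \<open>area n\<close> is turned into an integral over the
  cell.\<close>

lemma sample_term_le:
  assumes f: "reproduced f" and z: "z \<in> \<D>"
  shows "ennreal (norm (f (a n) * of_real (area n) * harmonic_kernel (a n) z))
    \<le> (\<integral>\<^sup>+x\<in>E n. 576 * (maj f x * ennreal (kern z x)) \<partial>dA)"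
proof -
  have "ennreal (norm (f (a n) * of_real (area n) * harmonic_kernel (a n) z))
      = ennreal (norm (f (a n)) * norm (harmonic_kernel (a n) z)) * emeasure dA (E n)"
    by (simp add: norm_mult area_def dA.emeasure_eq_measure ennreal_mult[symmetric] mult_ac)
  also have "\<dots> = (\<integral>\<^sup>+x\<in>E n. ennreal (norm (f (a n)) * norm (harmonic_kernel (a n) z)) \<partial>dA)"
    by (rule nn_integral_cmult_indicator[symmetric]) measurable
  also have "\<dots> \<le> (\<integral>\<^sup>+x\<in>E n. 576 * (maj f x * ennreal (kern z x)) \<partial>dA)"
  proof (rule nn_integral_mono)
    fix x assume "x \<in> space dA"
    show "ennreal (norm (f (a n)) * norm (harmonic_kernel (a n) z)) * indicator (E n) x
      \<le> 576 * (maj f x * ennreal (kern z x)) * indicator (E n) x"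
    proof (cases "x \<in> E n")
      case True
      have x: "x \<in> \<D>" "pseudohyp_dist x (a n) < e" using in_E[OF True] by auto
      have "norm (harmonic_kernel (a n) z) \<le> 6 * kern z (a n)" by (rule harmonic_kernel_le_kern[OF z a_in])
      also have "kern z (a n) \<le> 4 * kern z x" by (rule kern_estimates(1)[OF x(1) a_in z x(2) e_le])
      finally have "norm (harmonic_kernel (a n) z) \<le> 24 * kern z x" by simp
      hence "ennreal (norm (harmonic_kernel (a n) z)) \<le> ennreal (24 * kern z x)" by (rule ennreal_leI)
      also have "\<dots> = 24 * ennreal (kern z x)" by (simp add: ennreal_mult)
      finally have 1: "ennreal (norm (harmonic_kernel (a n) z)) \<le> 24 * ennreal (kern z x)" .
      have "ennreal (norm (f (a n)) * norm (harmonic_kernel (a n) z)) = nrm f (a n) * ennreal (norm (harmonic_kernel (a n) z))"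
        by (simp add: ennreal_mult)
      also have "\<dots> \<le> (24 * maj f x) * (24 * ennreal (kern z x))"
        by (intro mult_mono 1 reproduced_near_le_maj[OF f x(1) a_in x(2) e_le]) auto
      also have "\<dots> = (24 * 24) * (maj f x * ennreal (kern z x))" by (simp only: mult_ac)
      also have "(24 * 24 :: ennreal) = 576" by simp
      finally show ?thesis using True by simp
    qed simp
  qed
  finally show ?thesis .
qed

lemma sample_suminf_le:
  assumes f: "reproduced f" and z: "z \<in> \<D>"
  shows "(\<Sum>n. ennreal (norm (f (a n) * of_real (area n) * harmonic_kernel (a n) z))) \<le> 576 * bergman_pos (maj f) z"
proof -
  note [measurable] = maj_kern_measurable[OF f]
  have "(\<Sum>n. ennreal (norm (f (a n) * of_real (area n) * harmonic_kernel (a n) z)))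
      \<le> (\<Sum>n. \<integral>\<^sup>+x\<in>E n. 576 * (maj f x * ennreal (kern z x)) \<partial>dA)"
    by (intro suminf_le sample_term_le f z) auto
  also have "\<dots> = (\<integral>\<^sup>+x. 576 * (maj f x * ennreal (kern z x)) \<partial>dA)"
    by (rule suminf_nn_integral_E) measurable
  also have "\<dots> = 576 * bergman_pos (maj f) z"
    unfolding bergman_pos_kern by (rule nn_integral_cmult) measurable
  finally show ?thesis .
qed

lemma bergman_pos_maj_finite:
  assumes "reproduced f" "z \<in> \<D>"
  shows "bergman_pos (maj f) z < \<infinity>"
  using reproducedD(4,5)[OF assms(1)] assms(2) by (rule bergman_pos_finite)

lemma sample_summable:
  assumes f: "reproduced f" and z: "z \<in> \<D>"
  shows "summable (\<lambda>n. norm (f (a n) * of_real (area n) * harmonic_kernel (a n) z))"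
proof (rule summable_suminf_not_top)
  have "(\<Sum>n. ennreal (norm (f (a n) * of_real (area n) * harmonic_kernel (a n) z))) < top"
    using sample_suminf_le[OF f z] bergman_pos_maj_finite[OF f z]
    by (elim le_less_trans) (simp add: ennreal_mult_less_top)
  thus "(\<Sum>n. ennreal (norm (f (a n) * of_real (area n) * harmonic_kernel (a n) z))) \<noteq> top" by simp
qed simp

text \<open>Replacing \<open>f(x) R\<^sub>x(z)\<close> by the step function with the value \<open>f(a\<^sub>n) R\<^bsub>a\<^sub>n\<^esub>(z)\<close> on \<open>E n\<close> turns the
  reproducing integral into \<^const>\<open>sample\<close>.\<close>

lemma diff_sample_le:
  assumes f: "reproduced f" and z: "z \<in> \<D>"
  shows "ennreal (norm (f z - sample f z)) \<le> ennreal (540 * e) * bergman_pos (maj f) z"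
proof -
  define c where "c n = f (a n) * harmonic_kernel (a n) z" for n
  define s where "s x = (\<Sum>n. indicator (E n) x *\<^sub>R c n)" for x
  have term_eq: "(\<integral>x. indicator (E n) x *\<^sub>R c n \<partial>dA) = f (a n) * of_real (area n) * harmonic_kernel (a n) z" for n
  proof -
    have "(\<integral>x. indicator (E n) x *\<^sub>R c n \<partial>dA) = measure dA (E n \<inter> space dA) *\<^sub>R c n"
      by (subst integral_scaleR_left) (auto simp: dA.emeasure_eq_measure)
    also have "E n \<inter> space dA = E n" using in_E by auto
    finally show ?thesis by (simp add: c_def area_def scaleR_conv_of_real mult_ac)
  qed
  have nterm_eq: "(\<integral>x. norm (indicator (E n) x *\<^sub>R c n) \<partial>dA) = norm (f (a n) * of_real (area n) * harmonic_kernel (a n) z)" for n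
  proof -
    have "(\<integral>x. norm (indicator (E n) x *\<^sub>R c n) \<partial>dA) = (\<integral>x. indicator (E n) x *\<^sub>R norm (c n) \<partial>dA)"
      by (intro Bochner_Integration.integral_cong) auto
    also have "\<dots> = measure dA (E n \<inter> space dA) *\<^sub>R norm (c n)"
      by (subst integral_scaleR_left) (auto simp: dA.emeasure_eq_measure)
    also have "E n \<inter> space dA = E n" using in_E by auto
    finally show ?thesis by (simp add: c_def area_def norm_mult mult_ac)
  qed
  have s_eq: "s x = c n" and s_sum: "summable (\<lambda>k. norm (indicator (E k) x *\<^sub>R c k))" if x: "x \<in> E n" for x n
  proof -
    have eq: "indicator (E k) x *\<^sub>R c k = (if k = n then c k else 0)" for k
      using E_disjoint x by (auto simp: indicator_def disjoint_family_on_def)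
    show "s x = c n" unfolding s_def eq by (rule sums_unique[symmetric]) (rule sums_single)
    show "summable (\<lambda>k. norm (indicator (E k) x *\<^sub>R c k))"
      unfolding eq by (rule summable_finite[of "{n}"]) auto
  qed
  have int: "integrable dA (\<lambda>x. indicator (E n) x *\<^sub>R c n)" for n
    by (intro integrable_scaleR_left integrable_real_indicator) (auto simp: dA.emeasure_eq_measure)
  have ae: "AE x in dA. summable (\<lambda>n. norm (indicator (E n) x *\<^sub>R c n))"
  proof (rule AE_I2)
    fix x assume "x \<in> space dA"
    then obtain n where "x \<in> E n" using ex_E by auto
    thus "summable (\<lambda>n. norm (indicator (E n) x *\<^sub>R c n))" by (rule s_sum)
  qed
  have sn: "summable (\<lambda>n. \<integral>x. norm (indicator (E n) x *\<^sub>R c n) \<partial>dA)"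
    unfolding nterm_eq by (rule sample_summable[OF f z])
  have s_int: "integrable dA s" unfolding s_def by (rule integrable_suminf[OF int ae sn])
  have "sample f z = (\<integral>x. s x \<partial>dA)"
    unfolding s_def integral_suminf[OF int ae sn] term_eq sample_def ..
  hence "f z - sample f z = (\<integral>x. f x * harmonic_kernel x z - s x \<partial>dA)"
    using reproducedD(7,9)[OF f z] s_int by simp
  hence "ennreal (norm (f z - sample f z)) \<le> (\<integral>\<^sup>+x. ennreal (norm (f x * harmonic_kernel x z - s x)) \<partial>dA)"
    using integral_norm_bound_ennreal[OF Bochner_Integration.integrable_diff[OF reproducedD(9)[OF f z] s_int]] by simp
  also have "\<dots> \<le> (\<integral>\<^sup>+x. ennreal (540 * e) * (maj f x * ennreal (kern z x)) \<partial>dA)"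
  proof (rule nn_integral_mono)
    fix x assume "x \<in> space dA"
    then obtain n where n: "x \<in> E n" using ex_E by auto
    have x: "x \<in> \<D>" "pseudohyp_dist x (a n) < e" using in_E[OF n] by auto
    obtain M where M: "maj f x = ennreal M" "0 \<le> M"
      using reproducedD(8)[OF f x(1)] by (cases "maj f x") auto
    have k0: "0 \<le> kern z x" by simp
    have "ennreal (norm (f x - f (a n))) \<le> ennreal (18 * e) * ennreal M"
      using reproduced_diff_le_maj[OF f x(1) a_in x(2) e_le] M by simp
    hence 1: "norm (f x - f (a n)) \<le> 18 * e * M" using e_pos M by (simp add: ennreal_mult[symmetric])
    have "ennreal (norm (f (a n))) \<le> ennreal 24 * ennreal M"
      using reproduced_near_le_maj[OF f x(1) a_in x(2) e_le] M by simp
    hence 2: "norm (f (a n)) \<le> 24 * M" using M by (subst (asm) ennreal_mult[symmetric]) auto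
    have 3: "norm (harmonic_kernel x z) \<le> 6 * kern z x" by (rule harmonic_kernel_le_kern[OF z x(1)])
    have 4: "norm (harmonic_kernel x z - harmonic_kernel (a n) z) \<le> 18 * e * kern z x"
      by (rule kern_estimates(2)[OF x(1) a_in z x(2) e_le])
    \<comment> \<open>Oscillation of \<open>f\<close> times the kernel, plus the node value times
      the oscillation of the kernel: \<open>18 * 6 + 24 * 18 = 540\<close>.\<close>
    have "f x * harmonic_kernel x z - s x = (f x - f (a n)) * harmonic_kernel x z + f (a n) * (harmonic_kernel x z - harmonic_kernel (a n) z)"
      unfolding s_eq[OF n] c_def by (simp add: algebra_simps)
    hence "norm (f x * harmonic_kernel x z - s x) \<le> norm (f x - f (a n)) * norm (harmonic_kernel x z)
        + norm (f (a n)) * norm (harmonic_kernel x z - harmonic_kernel (a n) z)"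
      by (simp only: norm_mult[symmetric] norm_triangle_ineq)
    also have "\<dots> \<le> (18 * e * M) * (6 * kern z x) + (24 * M) * (18 * e * kern z x)"
      using 1 2 3 4 M e_pos by (intro add_mono mult_mono) auto
    also have "\<dots> = 540 * e * (M * kern z x)" by simp
    finally have "ennreal (norm (f x * harmonic_kernel x z - s x)) \<le> ennreal (540 * e * (M * kern z x))" by (rule ennreal_leI)
    thus "ennreal (norm (f x * harmonic_kernel x z - s x)) \<le> ennreal (540 * e) * (maj f x * ennreal (kern z x))"
      using e_pos M by (simp add: ennreal_mult)
  qed
  also have "\<dots> = ennreal (540 * e) * bergman_pos (maj f) z"
    unfolding bergman_pos_kern by (rule nn_integral_cmult) (rule maj_kern_measurable[OF f])
  finally show ?thesis .
qed

text \<open>Each atom is reproduced; sum and integral may be exchanged because the second kernel is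
  bounded for fixed \<open>z\<close> and \<open>bergman_pos (maj f)\<close> is integrable.\<close>

lemma sample_reproducing:
  assumes f: "reproduced f"
  shows "sample f \<in> borel_measurable dA"
    "z \<in> \<D> \<Longrightarrow> integrable dA (\<lambda>x. sample f x * harmonic_kernel x z)"
    "z \<in> \<D> \<Longrightarrow> sample f z = (\<integral>x. sample f x * harmonic_kernel x z \<partial>dA)"
proof -
  let ?t = "\<lambda>n x. f (a n) * of_real (area n) * harmonic_kernel (a n) x"
  have km: "harmonic_kernel b \<in> borel_measurable dA" for b
    using harmonic_kernel_measurable[of b] by (simp add: harmonic_kernel_commute[of _ b])
  have tm: "?t n \<in> borel_measurable dA" for n
    by (intro borel_measurable_times borel_measurable_const km)
  have hm: "(\<lambda>x. harmonic_kernel x z) \<in> borel_measurable dA" for z by (rule harmonic_kernel_measurable)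
  have sm: "(\<lambda>n. ?t n x) sums sample f x" if "x \<in> \<D>" for x
    unfolding sample_def by (rule summable_sums[OF summable_norm_cancel[OF sample_summable[OF f that]]])
  show meas: "sample f \<in> borel_measurable dA"
  proof (rule borel_measurable_LIMSEQ_metric)
    show "(\<lambda>x. \<Sum>n<N. ?t n x) \<in> borel_measurable dA" for N by (intro borel_measurable_sum tm)
    show "(\<lambda>N. \<Sum>n<N. ?t n x) \<longlonglongrightarrow> sample f x" if "x \<in> space dA" for x
      using sm that by (simp add: sums_def)
  qed
  fix z assume z: "z \<in> \<D>"
  hence nz: "norm z < 1" by simp
  define K where "K = 6 / (1 - norm z)\<^sup>2"
  have K: "0 \<le> K" by (simp add: K_def)
  have hk: "norm (harmonic_kernel x z) \<le> K" if x: "x \<in> \<D>" for x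
    unfolding K_def by (rule harmonic_kernel_bounded[OF z x])
  have Pm [measurable]: "bergman_pos (maj f) \<in> borel_measurable dA"
    using reproducedD(4)[OF f] by measurable
  have fin: "(\<integral>\<^sup>+x. 576 * bergman_pos (maj f) x * ennreal K \<partial>dA) < \<infinity>"
  proof -
    have "(\<integral>\<^sup>+x. bergman_pos (maj f) x \<partial>dA) < \<infinity>"
      by (intro nn_integral_finite Pm bergman_pos_wnorm2_finite reproducedD(4,5)[OF f])
    thus ?thesis by (simp add: nn_integral_multc nn_integral_cmult ennreal_mult_less_top)
  qed
  have tot: "(\<Sum>n. \<integral>\<^sup>+x. ennreal (norm (?t n x * harmonic_kernel x z)) \<partial>dA) < \<infinity>"
  proof -
    have "(\<Sum>n. \<integral>\<^sup>+x. ennreal (norm (?t n x * harmonic_kernel x z)) \<partial>dA)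
        = (\<integral>\<^sup>+x. (\<Sum>n. ennreal (norm (?t n x * harmonic_kernel x z))) \<partial>dA)"
      using tm hm by (intro nn_integral_suminf[symmetric] measurable_compose[OF borel_measurable_norm measurable_ennreal] borel_measurable_times) auto
    also have "\<dots> \<le> (\<integral>\<^sup>+x. 576 * bergman_pos (maj f) x * ennreal K \<partial>dA)"
    proof (rule nn_integral_mono)
      fix x assume "x \<in> space dA"
      hence x: "x \<in> \<D>" by simp
      have "(\<Sum>n. ennreal (norm (?t n x * harmonic_kernel x z))) = (\<Sum>n. ennreal (norm (?t n x))) * ennreal (norm (harmonic_kernel x z))"
        by (subst ennreal_suminf_multc[symmetric]) (simp add: norm_mult ennreal_mult)
      also have "\<dots> \<le> (576 * bergman_pos (maj f) x) * ennreal K"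
        by (intro mult_mono sample_suminf_le[OF f x] ennreal_leI hk x) auto
      finally show "(\<Sum>n. ennreal (norm (?t n x * harmonic_kernel x z))) \<le> 576 * bergman_pos (maj f) x * ennreal K" .
    qed
    finally show ?thesis using fin by (rule le_less_trans)
  qed
  have int: "integrable dA (\<lambda>x. ?t n x * harmonic_kernel x z)" for n
  proof (rule integrableI_bounded)
    have "(\<integral>\<^sup>+x. ennreal (norm (?t n x * harmonic_kernel x z)) \<partial>dA)
        \<le> (\<Sum>n. \<integral>\<^sup>+x. ennreal (norm (?t n x * harmonic_kernel x z)) \<partial>dA)"
      using sum_le_suminf[of "\<lambda>n. \<integral>\<^sup>+x. ennreal (norm (?t n x * harmonic_kernel x z)) \<partial>dA" "{n}"] by simp
    thus "(\<integral>\<^sup>+x. ennreal (norm (?t n x * harmonic_kernel x z)) \<partial>dA) < \<infinity>" using tot by (rule le_less_trans)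
  qed (intro borel_measurable_times tm hm)
  have ae: "AE x in dA. summable (\<lambda>n. norm (?t n x * harmonic_kernel x z))"
    using sample_summable[OF f] by (intro AE_I2) (simp add: norm_mult summable_mult2)
  have sn: "summable (\<lambda>n. \<integral>x. norm (?t n x * harmonic_kernel x z) \<partial>dA)"
  proof (rule summable_suminf_not_top)
    have "ennreal (\<integral>x. norm (?t n x * harmonic_kernel x z) \<partial>dA) = (\<integral>\<^sup>+x. ennreal (norm (?t n x * harmonic_kernel x z)) \<partial>dA)" for n
      by (intro nn_integral_eq_integral[symmetric] integrable_norm int) auto
    thus "(\<Sum>n. ennreal (\<integral>x. norm (?t n x * harmonic_kernel x z) \<partial>dA)) \<noteq> top" using tot by simp
  qed simp
  have eq: "(\<Sum>n. ?t n x * harmonic_kernel x z) = sample f x * harmonic_kernel x z" if "x \<in> \<D>" for x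
    using sums_mult2[OF sm[OF that], of "harmonic_kernel x z"] by (rule sums_unique[symmetric])
  have "integrable dA (\<lambda>x. \<Sum>n. ?t n x * harmonic_kernel x z)" by (rule integrable_suminf[OF int ae sn])
  thus "integrable dA (\<lambda>x. sample f x * harmonic_kernel x z)"
    by (subst (asm) Bochner_Integration.integrable_cong[OF refl eq]) auto
  have tz: "(\<integral>x. ?t n x * harmonic_kernel x z \<partial>dA) = ?t n z" for n
  proof -
    have "(\<integral>x. ?t n x * harmonic_kernel x z \<partial>dA) = f (a n) * of_real (area n) * (\<integral>x. harmonic_kernel (a n) x * harmonic_kernel x z \<partial>dA)"
      unfolding mult.assoc by (simp only: integral_mult_right_zero)
    thus ?thesis by (simp only: harmonic_kernel_reproduced[OF a_in z, symmetric])
  qed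
  have "(\<integral>x. sample f x * harmonic_kernel x z \<partial>dA) = (\<integral>x. (\<Sum>n. ?t n x * harmonic_kernel x z) \<partial>dA)"
    by (intro Bochner_Integration.integral_cong eq[symmetric]) auto
  also have "\<dots> = (\<Sum>n. \<integral>x. ?t n x * harmonic_kernel x z \<partial>dA)" by (rule integral_suminf[OF int ae sn])
  also have "\<dots> = sample f z" by (simp only: tz sample_def)
  finally show "sample f z = (\<integral>x. sample f x * harmonic_kernel x z \<partial>dA)" by (rule sym)
qed

text \<open>Two successive applications of the positive operator, each multiplying the squared norm
  by at most \<open>op_const\<close>, put the square of \<open>op_const\<close> next to
  \<open>(540 * e)^2\<close>.\<close>

lemma residual_reproduced:
  assumes f: "reproduced f"
  shows "reproduced (\<lambda>z. f z - sample f z)"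
    "wnorm2 (nrm (\<lambda>z. f z - sample f z)) \<le> ennreal ((540 * e * op_const)\<^sup>2) * wnorm2 (nrm f)"
proof -
  have op0: "0 \<le> op_const" by (simp add: op_const_def)
  note [measurable] = reproducedD(4)[OF f]
  have "wnorm2 (nrm (\<lambda>z. f z - sample f z)) \<le> wnorm2 (\<lambda>z. ennreal (540 * e) * bergman_pos (maj f) z)"
    by (intro wnorm2_mono diff_sample_le f)
  also have "\<dots> = (ennreal (540 * e))\<^sup>2 * wnorm2 (bergman_pos (maj f))" by (rule wnorm2_cmult) measurable
  also have "\<dots> \<le> (ennreal (540 * e))\<^sup>2 * (ennreal op_const * (ennreal op_const * wnorm2 (nrm f)))"
    using bergman_pos_bounded[OF reproducedD(4,5)[OF f]] reproducedD(6)[OF f]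
    by (intro mult_left_mono) (auto elim!: order.trans intro: mult_left_mono)
  also have "\<dots> = ennreal ((540 * e * op_const)\<^sup>2) * wnorm2 (nrm f)"
  proof -
    have "ennreal ((540 * e * op_const)\<^sup>2) = (ennreal (540 * e))\<^sup>2 * (ennreal op_const)\<^sup>2"
      using e_pos op0 by (simp only: power_mult_distrib) (simp add: ennreal_mult ennreal_power power_mult_distrib)
    thus ?thesis by (simp add: power2_eq_square mult_ac)
  qed
  finally show le: "wnorm2 (nrm (\<lambda>z. f z - sample f z)) \<le> ennreal ((540 * e * op_const)\<^sup>2) * wnorm2 (nrm f)" .
  have "wnorm2 (nrm (\<lambda>z. f z - sample f z)) < \<infinity>"
    using le reproducedD(2)[OF f] by (elim le_less_trans) (simp add: ennreal_mult_less_top)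
  thus "reproduced (\<lambda>z. f z - sample f z)"
    by (intro reproduced_diff f sample_reproducing)
qed

end

lemma ennreal_le_mult_of_divide:
  fixes x y k :: ennreal
  assumes "x / y \<le> k" "y \<noteq> 0" "y \<noteq> top"
  shows "x \<le> k * y"
proof -
  have "x = x / y * y" using assms(2,3) by (simp add: ennreal_divide_times ennreal_divide_self less_top)
  also have "\<dots> \<le> k * y" using assms(1) by (rule mult_right_mono) simp
  finally show ?thesis .
qed

lemma ennreal_numeral_mult:
  "0 \<le> b \<Longrightarrow> 0 \<le> c \<Longrightarrow> numeral k * (ennreal b * ennreal c) = ennreal (numeral k * (b * c))"
  by (subst ennreal_mult[symmetric], assumption+, subst ennreal_numeral[symmetric], subst ennreal_mult[symmetric]) auto

section \<open>Square-summable coefficients\<close>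

context A2_lattice
begin

definition mD :: "nat \<Rightarrow> real"
  where "mD n = rmu (Dn n)"

text \<open>The sample \<open>f (a n) * area n\<close> divided by the normalising factor of the
  atom, as \<open>coef_times_scale\<close> confirms.\<close>

definition coef :: "(complex \<Rightarrow> complex) \<Rightarrow> nat \<Rightarrow> complex"
  where "coef f n = f (a n) * of_real (area n / (1 - (norm (a n))\<^sup>2)\<^sup>2 * mD n powr (1 / 2))"

lemma norm_a_less: "norm (a n) < 1"
  using a_in[of n] by simp

lemma mD_pos: "0 < mD n"
proof -
  have "0 < mu (Dn n)"
    using e_le by (intro weighted_measure_pos w_pos emeasure_pseudohyp_disk_pos e_pos a_in) auto
  thus ?thesis unfolding mD_def using finite_measures(1)[of "Dn n"] by (simp add: enn2real_positive_iff)
qed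

lemma scale_pos: "0 < (1 - (norm (a n))\<^sup>2)\<^sup>2"
proof -
  have "(norm (a n))\<^sup>2 < 1" using norm_a_less[of n] by (simp add: power_less_one_iff)
  thus ?thesis by simp
qed

text \<open>As \<open>3 * e < 1\<close>, the disk lies in the Euclidean ball of radius
  \<open>1 - |a n|\<close>, where the A2 bound applies; \<open>1 - |a n|\<close> is then enlarged to
  \<open>1 - |a n|^2\<close> to match the scale in \<open>coef\<close>.\<close>

lemma Dn_product: "mD n * rnu (Dn n) \<le> C * ((1 - (norm (a n))\<^sup>2)\<^sup>2)\<^sup>2"
proof -
  let ?A = "norm (a n)"
  have A: "0 \<le> ?A" "?A < 1" using norm_a_less by auto
  have sub: "Dn n \<subseteq> \<D> \<inter> ball (a n) (1 - ?A)"
  proof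
    fix x assume "x \<in> Dn n"
    hence x: "x \<in> \<D>" "pseudohyp_dist x (a n) < e" by (auto simp: pseudohyp_disk_def)
    have "norm (x - a n) \<le> 3 * e * (1 - ?A)" by (rule pseudohyp_close[OF x(1) a_in x(2) e_le])
    also have "\<dots> \<le> 3 / 8 * (1 - ?A)" using e_le A by (intro mult_right_mono) auto
    also have "\<dots> < 1 - ?A" using A by simp
    finally show "x \<in> \<D> \<inter> ball (a n) (1 - ?A)" using x by (simp add: dist_norm norm_minus_commute)
  qed
  have "mu (Dn n) * nu (Dn n) \<le> mu (\<D> \<inter> ball (a n) (1 - ?A)) * nu (\<D> \<inter> ball (a n) (1 - ?A))"
    using sub by (intro mult_mono weighted_measure_mono) auto
  also have "\<dots> \<le> ennreal (C * (1 - ?A) ^ 4)" using A by (intro A2 a_in) auto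
  finally have "enn2real (mu (Dn n) * nu (Dn n)) \<le> enn2real (ennreal (C * (1 - ?A) ^ 4))"
    by (intro enn2real_mono) auto
  hence "mD n * rnu (Dn n) \<le> C * (1 - ?A) ^ 4" using A C_pos by (simp add: enn2real_mult mD_def)
  also have "\<dots> \<le> C * (1 - ?A\<^sup>2) ^ 4"
    using A C_pos mult_left_le[of ?A ?A] by (intro mult_left_mono power_mono) (auto simp: power2_eq_square)
  also have "(1 - ?A\<^sup>2) ^ 4 = ((1 - ?A\<^sup>2)\<^sup>2)\<^sup>2" by simp
  finally show ?thesis .
qed

text \<open>Deliberately asymmetric: \<open>rmu (E n)\<close> stays on the cell because it is going
  to be summed, while the dual factor grows to the whole disk so as to pair with \<open>mD n\<close>
  in \<open>Dn_product\<close>.\<close>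

lemma area_le: "(area n)\<^sup>2 \<le> rmu (E n) * rnu (Dn n)"
proof -
  have "(emeasure dA (E n))\<^sup>2 \<le> mu (E n) * nu (E n)"
    by (intro emeasure_weighted_Cauchy_Schwarz w_pos) measurable
  also have "\<dots> \<le> mu (E n) * nu (Dn n)"
    using E_subset by (intro mult_left_mono weighted_measure_mono) auto
  finally have "enn2real ((emeasure dA (E n))\<^sup>2) \<le> enn2real (mu (E n) * nu (Dn n))"
    using finite_measures by (intro enn2real_mono) (auto simp: ennreal_mult_less_top)
  thus ?thesis by (simp add: enn2real_mult power2_eq_square area_def measure_def)
qed

text \<open>Cauchy--Schwarz on \<open>E n\<close> makes the bound additive over the disjoint cells, so that no lower
  bound on \<open>area n\<close> is needed.\<close>

lemma norm_coef_le: "(norm (coef f n))\<^sup>2 \<le> C * (norm (f (a n)))\<^sup>2 * rmu (E n)"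
proof -
  let ?S = "(1 - (norm (a n))\<^sup>2)\<^sup>2"
  have S: "0 < ?S" by (rule scale_pos)
  have sq: "(mD n powr (1 / 2))\<^sup>2 = mD n" using mD_pos[of n] by (simp add: powr_half_sqrt)
  have "(norm (coef f n))\<^sup>2 = (norm (f (a n)))\<^sup>2 * (area n / ?S * mD n powr (1 / 2))\<^sup>2"
    by (simp only: coef_def norm_mult norm_of_real power_mult_distrib power2_abs)
  also have "(area n / ?S * mD n powr (1 / 2))\<^sup>2 = (area n)\<^sup>2 / ?S\<^sup>2 * mD n"
    by (simp only: power_mult_distrib power_divide sq)
  also have "\<dots> \<le> (rmu (E n) * rnu (Dn n)) / ?S\<^sup>2 * mD n"
    using area_le[of n] mD_pos[of n] by (intro mult_right_mono divide_right_mono) auto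
  also have "\<dots> = rmu (E n) / ?S\<^sup>2 * (mD n * rnu (Dn n))" by simp
  also have "\<dots> \<le> rmu (E n) / ?S\<^sup>2 * (C * ?S\<^sup>2)" by (intro mult_left_mono Dn_product) auto
  also have "\<dots> = C * rmu (E n)" using S by simp
  finally have "(norm (coef f n))\<^sup>2 \<le> (norm (f (a n)))\<^sup>2 * (C * rmu (E n))" by (simp add: mult_left_mono)
  thus ?thesis by (simp add: mult_ac)
qed

text \<open>\<open>norm_coef_le\<close> attaches the node value to the mass of \<open>E n\<close>.
  With \<open>24 * maj f x\<close> in place of the node value the masses add up to an integral over
  the disk, and \<open>24^2 = 576\<close>.\<close>

lemma coef_suminf_le:
  assumes f: "reproduced f"
  shows "(\<Sum>n. ennreal ((norm (coef f n))\<^sup>2)) \<le> ennreal (576 * C * op_const) * wnorm2 (nrm f)"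
proof -
  note [measurable] = reproducedD(4)[OF f]
  have op0: "0 \<le> op_const" by (simp add: op_const_def)
  have "ennreal ((norm (coef f n))\<^sup>2) \<le> (\<integral>\<^sup>+x\<in>E n. ennreal (576 * C) * ((maj f x)\<^sup>2 * ennreal (w x)) \<partial>dA)" for n
  proof -
    have "ennreal ((norm (coef f n))\<^sup>2) \<le> ennreal (C * (norm (f (a n)))\<^sup>2 * rmu (E n))"
      by (intro ennreal_leI norm_coef_le)
    also have "\<dots> = ennreal (C * (norm (f (a n)))\<^sup>2) * mu (E n)"
      using C_pos finite_measures(1)[of "E n"] by (simp add: ennreal_mult)
    also have "\<dots> = (\<integral>\<^sup>+x. ennreal (C * (norm (f (a n)))\<^sup>2) * (ennreal (w x) * indicator (E n) x) \<partial>dA)"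
      unfolding weighted_measure_def by (rule nn_integral_cmult[symmetric]) measurable
    also have "\<dots> \<le> (\<integral>\<^sup>+x\<in>E n. ennreal (576 * C) * ((maj f x)\<^sup>2 * ennreal (w x)) \<partial>dA)"
    proof (rule nn_integral_mono)
      fix x assume "x \<in> space dA"
      show "ennreal (C * (norm (f (a n)))\<^sup>2) * (ennreal (w x) * indicator (E n) x)
        \<le> ennreal (576 * C) * ((maj f x)\<^sup>2 * ennreal (w x)) * indicator (E n) x"
      proof (cases "x \<in> E n")
        case True
        have x: "x \<in> \<D>" "pseudohyp_dist x (a n) < e" using in_E[OF True] by auto
        have "ennreal (C * (norm (f (a n)))\<^sup>2) = ennreal C * (nrm f (a n))\<^sup>2"
          using C_pos by (simp add: ennreal_mult ennreal_power)
        also have "\<dots> \<le> ennreal C * (24 * maj f x)\<^sup>2"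
          by (intro mult_left_mono power_mono reproduced_near_le_maj[OF f x(1) a_in x(2) e_le]) auto
        also have "\<dots> = (ennreal C * 24\<^sup>2) * (maj f x)\<^sup>2" by (simp only: power_mult_distrib mult.assoc)
        also have "ennreal C * 24\<^sup>2 = ennreal (576 * C)" using C_pos by (simp add: ennreal_mult mult.commute)
        finally have "ennreal (C * (norm (f (a n)))\<^sup>2) * ennreal (w x) \<le> ennreal (576 * C) * (maj f x)\<^sup>2 * ennreal (w x)"
          by (intro mult_right_mono) auto
        thus ?thesis using True by (simp add: mult.assoc)
      qed simp
    qed
    finally show ?thesis .
  qed
  hence "(\<Sum>n. ennreal ((norm (coef f n))\<^sup>2)) \<le> (\<Sum>n. \<integral>\<^sup>+x\<in>E n. ennreal (576 * C) * ((maj f x)\<^sup>2 * ennreal (w x)) \<partial>dA)"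
    by (intro suminf_le) auto
  also have "\<dots> = (\<integral>\<^sup>+x. ennreal (576 * C) * ((maj f x)\<^sup>2 * ennreal (w x)) \<partial>dA)"
    by (rule suminf_nn_integral_E) measurable
  also have "\<dots> = ennreal (576 * C) * wnorm2 (maj f)"
    unfolding wnorm2_def by (rule nn_integral_cmult) measurable
  also have "\<dots> \<le> ennreal (576 * C) * (ennreal op_const * wnorm2 (nrm f))"
    by (intro mult_left_mono reproducedD(6)[OF f]) auto
  also have "\<dots> = ennreal (576 * C * op_const) * wnorm2 (nrm f)"
    using C_pos op0 by (simp add: ennreal_mult mult.assoc)
  finally show ?thesis .
qed

lemma coef_times_scale:
  "coef f n * of_real ((1 - (norm (a n))\<^sup>2)\<^sup>2 * mD n powr (- (1 / 2))) = f (a n) * of_real (area n)"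
proof -
  have "mD n powr (1 / 2) * mD n powr (- (1 / 2)) = 1"
    using mD_pos[of n] by (simp add: powr_add[symmetric])
  hence "area n / (1 - (norm (a n))\<^sup>2)\<^sup>2 * mD n powr (1 / 2) * ((1 - (norm (a n))\<^sup>2)\<^sup>2 * mD n powr (- (1 / 2))) = area n"
    using scale_pos[of n] by (simp add: field_simps)
  thus ?thesis unfolding coef_def mult.assoc by (simp only: of_real_mult[symmetric] mult.assoc)
qed

lemma nn_integral_le_sqrt:
  assumes "h \<in> borel_measurable dA" "wnorm2 h \<le> ennreal y" "0 \<le> y"
  shows "(\<integral>\<^sup>+x. h x \<partial>dA) \<le> ennreal (sqrt (y * rnu \<D>))"
proof (rule ennreal_le_sqrtI)
  have "(\<integral>\<^sup>+x. h x \<partial>dA)\<^sup>2 \<le> wnorm2 h * nu \<D>" by (rule nn_integral_le_wnorm2) fact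
  also have "\<dots> \<le> ennreal y * nu \<D>" using assms(2) by (rule mult_right_mono) simp
  also have "\<dots> = ennreal (y * rnu \<D>)" using assms(3) finite_measures(2)[of \<D>] by (simp add: ennreal_mult)
  finally show "(\<integral>\<^sup>+x. h x \<partial>dA)\<^sup>2 \<le> ennreal (y * rnu \<D>)" .
qed (use assms(3) in simp)

text \<open>Makes decay of weighted norms usable at a point: both the value and the absolute sum of
  the sampling series at \<open>z\<close> are controlled by the square root of
  \<open>N\<close>.\<close>

lemma pointwise_bounds:
  assumes f: "reproduced f" and N: "wnorm2 (nrm f) \<le> ennreal N" "0 \<le> N" and z: "z \<in> \<D>"
  shows "norm (f z) \<le> 6 / (1 - norm z)\<^sup>2 * sqrt (N * rnu \<D>)"
    "(\<Sum>n. ennreal (norm (f (a n) * of_real (area n) * harmonic_kernel (a n) z)))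
      \<le> ennreal (576 / (1 - norm z)\<^sup>2 * sqrt (op_const * N * rnu \<D>))"
proof -
  have op0: "0 \<le> op_const" by (simp add: op_const_def)
  have "nrm f z \<le> 6 * bergman_pos (nrm f) z" using reproduced_le_maj[OF f z] by (simp add: maj_def)
  also have "\<dots> \<le> 6 * (ennreal (1 / (1 - norm z)\<^sup>2) * ennreal (sqrt (N * rnu \<D>)))"
    by (intro mult_left_mono order.trans[OF bergman_pos_le[OF reproducedD(3)[OF f] z]]
        nn_integral_le_sqrt[OF reproducedD(3)[OF f] N]) auto
  also have "\<dots> = ennreal (6 * (1 / (1 - norm z)\<^sup>2 * sqrt (N * rnu \<D>)))"
    using N by (intro ennreal_numeral_mult) auto
  finally show "norm (f z) \<le> 6 / (1 - norm z)\<^sup>2 * sqrt (N * rnu \<D>)" using N by simp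
  have "wnorm2 (maj f) \<le> ennreal op_const * wnorm2 (nrm f)" by (rule reproducedD(6)[OF f])
  also have "\<dots> \<le> ennreal op_const * ennreal N" by (intro mult_left_mono N) auto
  also have "\<dots> = ennreal (op_const * N)" using op0 N by (simp add: ennreal_mult)
  finally have M: "wnorm2 (maj f) \<le> ennreal (op_const * N)" .
  have "(\<Sum>n. ennreal (norm (f (a n) * of_real (area n) * harmonic_kernel (a n) z))) \<le> 576 * bergman_pos (maj f) z"
    by (rule sample_suminf_le[OF f z])
  also have "\<dots> \<le> 576 * (ennreal (1 / (1 - norm z)\<^sup>2) * ennreal (sqrt (op_const * N * rnu \<D>)))"
    using op0 N by (intro mult_left_mono order.trans[OF bergman_pos_le[OF reproducedD(4)[OF f] z]]
        nn_integral_le_sqrt[OF reproducedD(4)[OF f] M]) auto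
  also have "\<dots> = ennreal (576 * (1 / (1 - norm z)\<^sup>2 * sqrt (op_const * N * rnu \<D>)))"
    using op0 N by (intro ennreal_numeral_mult) auto
  finally show "(\<Sum>n. ennreal (norm (f (a n) * of_real (area n) * harmonic_kernel (a n) z)))
      \<le> ennreal (576 / (1 - norm z)\<^sup>2 * sqrt (op_const * N * rnu \<D>))" by simp
qed

section \<open>The Neumann series and its coefficients\<close>

definition residual :: "nat \<Rightarrow> (complex \<Rightarrow> complex) \<Rightarrow> complex \<Rightarrow> complex"
  where "residual k = (\<lambda>g z. g z - sample g z) ^^ k"

lemma residual_Suc: "residual (Suc k) f z = residual k f z - sample (residual k f) z"
  by (simp add: residual_def)

text \<open>A contraction factor of \<open>1/4\<close> in norm appears as \<open>1/16\<close>, since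
  \<open>wnorm2\<close> is a squared norm.\<close>

lemma residual_bound:
  assumes f: "reproduced f" and small: "540 * e * op_const \<le> 1 / 4" and N: "wnorm2 (nrm f) \<le> ennreal N" "0 \<le> N"
  shows "reproduced (residual k f)" "wnorm2 (nrm (residual k f)) \<le> ennreal (N / 16 ^ k)"
proof (induction k)
  case 0
  show "reproduced (residual 0 f)" "wnorm2 (nrm (residual 0 f)) \<le> ennreal (N / 16 ^ 0)"
    using f N by (simp_all add: residual_def)
next
  case (Suc k)
  have eq: "residual (Suc k) f = (\<lambda>z. residual k f z - sample (residual k f) z)"
    by (rule ext) (rule residual_Suc)
  show "reproduced (residual (Suc k) f)" unfolding eq by (rule residual_reproduced(1)[OF Suc.IH(1)])
  have "0 \<le> 540 * e * op_const" using e_pos by (simp add: op_const_def)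
  hence "(540 * e * op_const)\<^sup>2 \<le> (1 / 4)\<^sup>2" using small by (intro power_mono) auto
  hence q: "(540 * e * op_const)\<^sup>2 \<le> 1 / 16" by (simp add: power2_eq_square)
  have "wnorm2 (nrm (residual (Suc k) f)) \<le> ennreal ((540 * e * op_const)\<^sup>2) * wnorm2 (nrm (residual k f))"
    unfolding eq by (rule residual_reproduced(2)[OF Suc.IH(1)])
  also have "\<dots> \<le> ennreal (1 / 16) * ennreal (N / 16 ^ k)"
    using q by (intro mult_mono ennreal_leI Suc.IH(2)) auto
  also have "\<dots> = ennreal (1 / 16 * (N / 16 ^ k))" using N by (intro ennreal_mult[symmetric]) auto
  also have "1 / 16 * (N / 16 ^ k) = N / 16 ^ Suc k" by simp
  finally show "wnorm2 (nrm (residual (Suc k) f)) \<le> ennreal (N / 16 ^ Suc k)" .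
qed

lemma summable_inverse_four: "summable (\<lambda>k. K / 4 ^ k :: real)"
proof -
  have "summable (\<lambda>k. K * (1 / 4) ^ k :: real)" by (intro summable_mult summable_geometric) auto
  thus ?thesis by (simp add: power_divide)
qed

lemma sqrt_inverse_sixteen: "sqrt (K * (N / 16 ^ k) * R) = sqrt (K * N * R) / 4 ^ k"
proof -
  have "(16::real) ^ k = (4 ^ k)\<^sup>2" by (simp add: power2_eq_square flip: power_mult_distrib)
  thus ?thesis by (simp add: real_sqrt_divide real_sqrt_mult)
qed

lemma atomic_decomposition:
  assumes f: "reproduced f" and small: "540 * e * op_const \<le> 1 / 4"
  shows "\<exists>c. summable (\<lambda>n. (norm (c n))\<^sup>2) \<and>
    (\<forall>z\<in>\<D>. (\<lambda>n. c n * of_real ((1 - (norm (a n))\<^sup>2)\<^sup>2 * mD n powr (- (1 / 2))) * harmonic_kernel (a n) z) sums f z)"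
proof -
  have op0: "0 \<le> op_const" by (simp add: op_const_def)
  define N where "N = enn2real (wnorm2 (nrm f))"
  have N: "wnorm2 (nrm f) \<le> ennreal N" "0 \<le> N" using reproducedD(2)[OF f] by (auto simp: N_def)
  define r where "r k = residual k f" for k
  have r: "reproduced (r k)" "wnorm2 (nrm (r k)) \<le> ennreal (N / 16 ^ k)" for k
    unfolding r_def by (rule residual_bound[OF f small N])+
  have rN: "0 \<le> N / 16 ^ k" for k using N by simp
  define B where "B = 576 * C * op_const * N"
  have B: "0 \<le> B" using C_pos op0 N by (simp add: B_def)
  have coef_sum: "summable (\<lambda>n. (norm (coef (r k) n))\<^sup>2)" "(\<Sum>n. (norm (coef (r k) n))\<^sup>2) \<le> B / 16 ^ k" for k
  proof -
    have "(\<Sum>n. ennreal ((norm (coef (r k) n))\<^sup>2)) \<le> ennreal (576 * C * op_const) * wnorm2 (nrm (r k))"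
      by (rule coef_suminf_le[OF r(1)])
    also have "\<dots> \<le> ennreal (576 * C * op_const) * ennreal (N / 16 ^ k)" by (intro mult_left_mono r) auto
    also have "\<dots> = ennreal (B / 16 ^ k)"
      using C_pos op0 N by (subst ennreal_mult[symmetric]) (auto simp: B_def)
    finally have "(\<Sum>n. ennreal ((norm (coef (r k) n))\<^sup>2)) \<le> ennreal (B / 16 ^ k)" .
    thus "summable (\<lambda>n. (norm (coef (r k) n))\<^sup>2)" "(\<Sum>n. (norm (coef (r k) n))\<^sup>2) \<le> B / 16 ^ k"
      using B by (auto intro: summable_of_ennreal_suminf)
  qed
  \<comment> \<open>The squared coefficients decay like \<open>16^-k\<close>. The extra
    \<open>4^k\<close> still leaves a series summable in \<open>k\<close>, and its sum
    \<open>M n\<close> gives \<open>|coef (r k) n| \<le> sqrt (M n) * 2^-k\<close>. Hence the sum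
    over \<open>k\<close> converges and its squared norm is at most \<open>4 * M n\<close>.\<close>
  define x where "x n k = 4 ^ k * (norm (coef (r k) n))\<^sup>2" for n k
  have x0: "0 \<le> x n k" for n k by (simp add: x_def)
  have x1: "summable (\<lambda>n. norm (x n k))" "(\<Sum>n. norm (x n k)) \<le> B / 4 ^ k" for k
  proof -
    have nx: "norm (x n k) = 4 ^ k * (norm (coef (r k) n))\<^sup>2" for n by (simp add: x_def)
    show "summable (\<lambda>n. norm (x n k))" unfolding nx by (intro summable_mult coef_sum)
    have "(\<Sum>n. norm (x n k)) = 4 ^ k * (\<Sum>n. (norm (coef (r k) n))\<^sup>2)" unfolding nx by (rule suminf_mult[OF coef_sum(1)])
    also have "\<dots> \<le> 4 ^ k * (B / 16 ^ k)" by (intro mult_left_mono coef_sum) auto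
    also have "\<dots> = B / 4 ^ k"
    proof -
      have "(16::real) ^ k = 4 ^ k * 4 ^ k" by (simp flip: power_mult_distrib)
      thus ?thesis by simp
    qed
    finally show "(\<Sum>n. norm (x n k)) \<le> B / 4 ^ k" .
  qed
  define M where "M n = (\<Sum>k. x n k)" for n
  have M_sum: "summable M"
    using sums_swap(1)[OF x1 summable_inverse_four] by (simp add: M_def[abs_def] sums_iff)
  have xk: "summable (\<lambda>k. x n k)" for n
    using sums_swap(2)[OF x1 summable_inverse_four, of n] by (rule summable_norm_cancel)
  have M0: "0 \<le> M n" for n unfolding M_def by (intro suminf_nonneg xk x0)
  have coef_le: "norm (coef (r k) n) \<le> sqrt (M n) * (1 / 2) ^ k" for k n
  proof -
    have "x n k \<le> M n" unfolding M_def using sum_le_suminf[OF xk, of "{k}"] x0 by simp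
    hence "sqrt (x n k) \<le> sqrt (M n)" by simp
    moreover have "sqrt (x n k) = 2 ^ k * norm (coef (r k) n)"
    proof -
      have "x n k = (2 ^ k * norm (coef (r k) n))\<^sup>2"
        by (simp add: x_def power_mult_distrib power2_eq_square flip: power_mult_distrib)
      thus ?thesis by simp
    qed
    ultimately show ?thesis by (simp add: field_simps)
  qed
  have coef_summable: "summable (\<lambda>k. norm (coef (r k) n))" for n
    by (rule summable_comparison_test'[of "\<lambda>k. sqrt (M n) * (1 / 2) ^ k" 0])
      (use coef_le in \<open>auto intro!: summable_mult summable_geometric\<close>)
  define c where "c n = (\<Sum>k. coef (r k) n)" for n
  have c_le: "(norm (c n))\<^sup>2 \<le> 4 * M n" for n
  proof -
    have "norm (c n) \<le> (\<Sum>k. norm (coef (r k) n))" unfolding c_def by (rule summable_norm[OF coef_summable])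
    also have "\<dots> \<le> (\<Sum>k. sqrt (M n) * (1 / 2) ^ k)"
      by (intro suminf_le coef_le coef_summable summable_mult summable_geometric) auto
    also have "\<dots> = sqrt (M n) * 2" by (subst suminf_mult) (auto simp: suminf_geometric summable_geometric)
    finally have "(norm (c n))\<^sup>2 \<le> (sqrt (M n) * 2)\<^sup>2" by (intro power_mono) auto
    thus ?thesis using M0[of n] by (simp add: power_mult_distrib)
  qed
  have "summable (\<lambda>n. (norm (c n))\<^sup>2)"
    by (rule summable_comparison_test'[OF summable_mult[OF M_sum, of 4], of 0]) (use c_le in auto)
  moreover have "(\<lambda>n. c n * of_real ((1 - (norm (a n))\<^sup>2)\<^sup>2 * mD n powr (- (1 / 2))) * harmonic_kernel (a n) z) sums f z"
    if z: "z \<in> \<D>" for z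
  proof -
    define y where "y n k = r k (a n) * of_real (area n) * harmonic_kernel (a n) z" for n k
    define L where "L = 576 / (1 - norm z)\<^sup>2 * sqrt (op_const * N * rnu \<D>)"
    have y1: "summable (\<lambda>n. norm (y n k))" "(\<Sum>n. norm (y n k)) \<le> L / 4 ^ k" for k
    proof -
      have "(\<Sum>n. ennreal (norm (y n k))) \<le> ennreal (576 / (1 - norm z)\<^sup>2 * sqrt (op_const * (N / 16 ^ k) * rnu \<D>))"
        unfolding y_def by (rule pointwise_bounds(2)[OF r(1) r(2) rN z])
      also have "576 / (1 - norm z)\<^sup>2 * sqrt (op_const * (N / 16 ^ k) * rnu \<D>) = L / 4 ^ k"
        unfolding L_def sqrt_inverse_sixteen by simp
      finally have "(\<Sum>n. ennreal (norm (y n k))) \<le> ennreal (L / 4 ^ k)" .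
      moreover have "0 \<le> L / 4 ^ k" using op0 N by (simp add: L_def)
      ultimately show "summable (\<lambda>n. norm (y n k))" "(\<Sum>n. norm (y n k)) \<le> L / 4 ^ k"
        by (auto intro: summable_of_ennreal_suminf)
    qed
    have "(\<lambda>n. \<Sum>k. y n k) sums (\<Sum>k. \<Sum>n. y n k)" by (rule sums_swap(1)[OF y1 summable_inverse_four])
    moreover have "(\<Sum>k. y n k) = c n * of_real ((1 - (norm (a n))\<^sup>2)\<^sup>2 * mD n powr (- (1 / 2))) * harmonic_kernel (a n) z" for n
    proof -
      have "y n k = coef (r k) n * (of_real ((1 - (norm (a n))\<^sup>2)\<^sup>2 * mD n powr (- (1 / 2))) * harmonic_kernel (a n) z)" for k
        unfolding y_def coef_times_scale[symmetric] by (rule mult.assoc)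
      hence "(\<Sum>k. y n k) = (\<Sum>k. coef (r k) n * (of_real ((1 - (norm (a n))\<^sup>2)\<^sup>2 * mD n powr (- (1 / 2))) * harmonic_kernel (a n) z))"
        by (rule suminf_cong)
      also have "\<dots> = c n * (of_real ((1 - (norm (a n))\<^sup>2)\<^sup>2 * mD n powr (- (1 / 2))) * harmonic_kernel (a n) z)"
        unfolding c_def by (rule suminf_mult2[OF summable_norm_cancel[OF coef_summable], symmetric])
      finally show ?thesis by (simp only: mult.assoc)
    qed
    moreover have "(\<Sum>k. \<Sum>n. y n k) = f z"
    proof -
      \<comment> \<open>Sampling a residual yields its difference from the next one, so the double
        series telescopes; what remains is that the residuals tend to 0 at \<open>z\<close>.\<close>
      have tele: "(\<Sum>n. y n k) = r k z - r (Suc k) z" for k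
        by (simp add: r_def residual_Suc y_def sample_def)
      have "(\<lambda>k. r k z) \<longlonglongrightarrow> 0"
      proof (rule Lim_null_comparison)
        \<comment> \<open>The explicit factor \<open>1\<close> gives the root the shape that
          \<open>sqrt_inverse_sixteen\<close> rewrites.\<close>
        show "eventually (\<lambda>k. norm (r k z) \<le> (6 / (1 - norm z)\<^sup>2 * sqrt (1 * N * rnu \<D>)) / 4 ^ k) sequentially"
        proof (intro always_eventually allI)
          fix k
          have "norm (r k z) \<le> 6 / (1 - norm z)\<^sup>2 * sqrt (1 * (N / 16 ^ k) * rnu \<D>)"
            unfolding mult_1_left by (rule pointwise_bounds(1)[OF r(1) r(2) rN z])
          thus "norm (r k z) \<le> (6 / (1 - norm z)\<^sup>2 * sqrt (1 * N * rnu \<D>)) / 4 ^ k"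
            unfolding sqrt_inverse_sixteen by simp
        qed
        show "(\<lambda>k. (6 / (1 - norm z)\<^sup>2 * sqrt (1 * N * rnu \<D>)) / 4 ^ k) \<longlonglongrightarrow> 0"
          by (rule summable_LIMSEQ_zero[OF summable_inverse_four])
      qed
      from telescope_sums'[OF this] have "(\<lambda>k. r k z - r (Suc k) z) sums r 0 z" by simp
      thus ?thesis unfolding tele by (simp add: sums_iff r_def residual_def)
    qed
    ultimately show ?thesis by simp
  qed
  ultimately show ?thesis by blast
qed

end

text \<open>The weight is modified on a null set so that it is positive everywhere. Balls of radius at least 1,
  which the supremum in \<^const>\<open>A2_const\<close> leaves out, only cost a larger constant.\<close>

lemma A2_weight_locale:
  assumes "A2_weight \<omega>"
  shows "\<exists>w C. A2_disk_weight w C \<and> (AE z in dA. w z = \<omega> z)"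
proof -
  have int: "integrable dA \<omega>" and pos: "AE z in dA. 0 < \<omega> z" and A2: "A2_const \<omega> < \<infinity>"
    using assms by (auto simp: A2_weight_def)
  define w where "w z = (if 0 < \<omega> z then \<omega> z else 1)" for z
  have [measurable]: "\<omega> \<in> borel_measurable dA" using int by simp
  have wm [measurable]: "w \<in> borel_measurable dA" unfolding w_def[abs_def] by measurable
  have w_pos: "0 < w z" for z by (simp add: w_def)
  have ae: "AE z in dA. w z = \<omega> z" using pos by eventually_elim (simp add: w_def)
  have mu_eq: "weighted_measure w S = weighted_measure \<omega> S" for S
    unfolding weighted_measure_def using ae by (intro nn_integral_cong_AE) (auto elim!: eventually_mono)
  have nu_eq: "weighted_measure (\<lambda>z. inverse (w z)) S = weighted_measure (\<lambda>z. inverse (\<omega> z)) S" for S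
    unfolding weighted_measure_def using ae by (intro nn_integral_cong_AE) (auto elim!: eventually_mono)
  let ?mu = "weighted_measure w" and ?nu = "weighted_measure (\<lambda>z. inverse (w z))"
  define K where "K = enn2real (A2_const \<omega>)"
  have K: "A2_const \<omega> = ennreal K" "0 \<le> K" using A2 by (auto simp: K_def)
  have small: "?mu (\<D> \<inter> ball b r) * ?nu (\<D> \<inter> ball b r) \<le> ennreal (K * r ^ 4)" if b: "b \<in> \<D>" and r: "0 < r" "r < 1" for b r
  proof -
    let ?S = "\<D> \<inter> ball b r"
    have "?mu ?S * ?nu ?S / (emeasure dA ?S)\<^sup>2 \<le> ennreal K"
      unfolding K(1)[symmetric] A2_const_def mu_eq nu_eq by (rule SUP_upper2[of "(b, r)"]) (use b r in auto)
    \<comment> \<open>Clearing the denominator in the extended reals requires it to be nonzero; the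
      truncated ball contains a full ball around \<open>b\<close>.\<close>
    moreover have "(emeasure dA ?S)\<^sup>2 \<noteq> 0"
    proof -
      have "open ?S" "b \<in> ?S" using b r by auto
      then obtain d where d: "0 < d" "ball b d \<subseteq> ?S" using openE by blast
      have "0 < ennreal (d\<^sup>2)" using d by simp
      also have "ennreal (d\<^sup>2) = emeasure dA (ball b d)" using d by (intro emeasure_dA_ball[symmetric]) auto
      also have "\<dots> \<le> emeasure dA ?S" using d by (intro emeasure_mono borel_in_sets_dA) auto
      finally show ?thesis by simp
    qed
    moreover have S: "(emeasure dA ?S)\<^sup>2 \<le> ennreal (r ^ 4)"
    proof -
      have "(emeasure dA ?S)\<^sup>2 \<le> (ennreal (r\<^sup>2))\<^sup>2" using r by (intro power_mono emeasure_dA_ball_le) auto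
      also have "\<dots> = ennreal (r ^ 4)" by (simp add: ennreal_power flip: power_mult)
      finally show ?thesis .
    qed
    hence "(emeasure dA ?S)\<^sup>2 \<noteq> top" by (auto simp: top_unique)
    ultimately have "?mu ?S * ?nu ?S \<le> ennreal K * (emeasure dA ?S)\<^sup>2"
      by (rule ennreal_le_mult_of_divide)
    also have "\<dots> \<le> ennreal K * ennreal (r ^ 4)" by (intro mult_left_mono S) auto
    also have "\<dots> = ennreal (K * r ^ 4)" using K r by (simp add: ennreal_mult)
    finally show ?thesis .
  qed
  have disk: "(\<integral>\<^sup>+z\<in>\<D>. f z \<partial>dA) = (\<integral>\<^sup>+z. f z \<partial>dA)" for f :: "complex \<Rightarrow> ennreal"
    by (intro nn_integral_cong) simp
  have mu_fin: "?mu \<D> < \<infinity>"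
  proof -
    have "?mu \<D> = (\<integral>\<^sup>+z. ennreal (\<omega> z) \<partial>dA)" by (simp only: mu_eq) (simp add: weighted_measure_def disk)
    also have "\<dots> \<le> (\<integral>\<^sup>+z. ennreal (norm (\<omega> z)) \<partial>dA)" by (intro nn_integral_mono ennreal_leI) auto
    also have "\<dots> < \<infinity>" using int by (simp add: integrable_iff_bounded)
    finally show ?thesis .
  qed
  \<comment> \<open>Integrability of the dual weight, also near the circle: the A2 bound makes the
    product of the two masses finite, and the mass of \<open>w\<close> is positive.\<close>
  have nu_ball: "?nu (\<D> \<inter> ball b (1 / 2)) < \<infinity>" if b: "b \<in> \<D>" for b
  proof -
    let ?S = "\<D> \<inter> ball b (1 / 2)"
    have S: "?S \<in> sets dA" by (rule borel_in_sets_dA) auto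
    have "open ?S" "b \<in> ?S" using b by auto
    then obtain d where d: "0 < d" "ball b d \<subseteq> ?S" using openE by blast
    have "0 < ennreal (d\<^sup>2)" using d by simp
    also have "ennreal (d\<^sup>2) = emeasure dA (ball b d)" using d by (intro emeasure_dA_ball[symmetric]) auto
    also have "\<dots> \<le> emeasure dA ?S" using d S by (intro emeasure_mono) auto
    finally have "0 < ?mu ?S" using S w_pos by (intro weighted_measure_pos) auto
    moreover have "?mu ?S * ?nu ?S < \<infinity>" using small[OF b, of "1 / 2"] by (auto intro: le_less_trans)
    ultimately show ?thesis by (auto simp: ennreal_mult_less_top)
  qed
  have nu_fin: "?nu \<D> < \<infinity>"
  proof -
    \<comment> \<open>The closed disk is covered for the sake of compactness, while the centres must
      lie in the open disk; scaling by \<open>3/4\<close> moves a point by at most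
      \<open>1/4\<close>.\<close>
    have "cball 0 1 \<subseteq> (\<Union>b\<in>\<D>. ball b (1 / 2))"
    proof
      fix z :: complex assume z: "z \<in> cball 0 1"
      have "of_real (3 / 4) * z \<in> \<D>" using z by (simp add: norm_mult)
      moreover have "z - of_real (3 / 4) * z = of_real (1 / 4) * z" by (simp add: algebra_simps)
      hence "dist (of_real (3 / 4) * z) z < 1 / 2" using z by (simp only: dist_commute dist_norm norm_mult) simp
      ultimately show "z \<in> (\<Union>b\<in>\<D>. ball b (1 / 2))" by (intro UN_I[of "of_real (3 / 4) * z"]) auto
    qed
    then obtain F where F: "F \<subseteq> \<D>" "finite F" "cball 0 1 \<subseteq> (\<Union>b\<in>F. ball b (1 / 2))"
      using compactE_image[OF compact_cball, of \<D> "\<lambda>b. ball b (1 / 2)" 0 1] by blast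
    have "?nu \<D> \<le> (\<integral>\<^sup>+z. (\<Sum>b\<in>F. ennreal (inverse (w z)) * indicator (\<D> \<inter> ball b (1 / 2)) z) \<partial>dA)"
      unfolding weighted_measure_def
    proof (rule nn_integral_mono)
      fix z assume "z \<in> space dA"
      hence z: "z \<in> \<D>" by simp
      hence "z \<in> cball 0 1" by simp
      then obtain b where b: "b \<in> F" "z \<in> ball b (1 / 2)" using F(3) by blast
      have "ennreal (inverse (w z)) * indicator (\<D> \<inter> ball b (1 / 2)) z
        \<le> (\<Sum>b\<in>F. ennreal (inverse (w z)) * indicator (\<D> \<inter> ball b (1 / 2)) z)"
        using b F by (intro member_le_sum) auto
      thus "ennreal (inverse (w z)) * indicator \<D> z
        \<le> (\<Sum>b\<in>F. ennreal (inverse (w z)) * indicator (\<D> \<inter> ball b (1 / 2)) z)"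
        using b z by simp
    qed
    also have "\<dots> = (\<Sum>b\<in>F. ?nu (\<D> \<inter> ball b (1 / 2)))"
    proof -
      have [measurable]: "\<D> \<inter> ball b (1 / 2) \<in> sets dA" for b by (rule borel_in_sets_dA) auto
      show ?thesis unfolding weighted_measure_def by (intro nn_integral_sum) measurable
    qed
    also have "\<dots> < \<infinity>"
      using F(2,1) nu_ball by (induction F rule: finite_induct) simp_all
    finally show ?thesis .
  qed
  \<comment> \<open>The product of the total masses pays for radii \<open>r \<ge> 1\<close>, where
    \<open>r ^ 4 \<ge> 1\<close>; the entry 1 keeps \<open>C\<close> positive.\<close>
  define C where "C = max 1 (max K (enn2real (?mu \<D> * ?nu \<D>)))"
  have "A2_disk_weight w C"
  proof
    show "w \<in> borel_measurable dA" "\<And>z. 0 < w z" "?mu \<D> < \<infinity>" "?nu \<D> < \<infinity>"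
      by (fact wm w_pos mu_fin nu_fin)+
    show "0 < C" by (simp add: C_def)
    fix b :: complex and r :: real assume b: "b \<in> \<D>" and r: "0 < r"
    show "?mu (\<D> \<inter> ball b r) * ?nu (\<D> \<inter> ball b r) \<le> ennreal (C * r ^ 4)"
    proof (cases "r < 1")
      case True
      have "?mu (\<D> \<inter> ball b r) * ?nu (\<D> \<inter> ball b r) \<le> ennreal (K * r ^ 4)" by (rule small[OF b r True])
      also have "\<dots> \<le> ennreal (C * r ^ 4)" by (intro ennreal_leI mult_right_mono) (auto simp: C_def)
      finally show ?thesis .
    next
      case False
      have "?mu (\<D> \<inter> ball b r) * ?nu (\<D> \<inter> ball b r) \<le> ?mu \<D> * ?nu \<D>"
        by (intro mult_mono weighted_measure_mono) auto
      also have "\<dots> = ennreal (enn2real (?mu \<D> * ?nu \<D>))"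
        using mu_fin nu_fin by (simp add: ennreal_mult_less_top)
      also have "\<dots> \<le> ennreal (C * r ^ 4)"
      proof (rule ennreal_leI)
        have "1 \<le> r ^ 4" using False by (intro one_le_power) auto
        hence "C * 1 \<le> C * r ^ 4" by (intro mult_left_mono) (auto simp: C_def)
        moreover have "enn2real (?mu \<D> * ?nu \<D>) \<le> C" by (simp add: C_def)
        ultimately show "enn2real (?mu \<D> * ?nu \<D>) \<le> C * r ^ 4" by linarith
      qed
      finally show ?thesis .
    qed
  qed
  thus ?thesis using ae by blast
qed

text \<open>Splitting \<open>f\<close> into a holomorphic and an antiholomorphic part gives
  continuity, hence measurability; the weighted norm gives integrability, and the reproducing
  formula applies.\<close>

lemma (in A2_disk_weight) harmonic_L2_reproduced:
  assumes f: "f \<in> harmonic_L2 \<omega>" and ae: "AE z in dA. w z = \<omega> z"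
  shows "reproduced f"
proof -
  have h: "harmonic_on f \<D>" and fin: "(\<integral>\<^sup>+z. ennreal ((norm (f z))\<^sup>2 * \<omega> z) \<partial>dA) < \<infinity>"
    using f by (auto simp: harmonic_L2_def)
  obtain g k where gk: "g holomorphic_on \<D>" "k holomorphic_on \<D>" "\<And>z. z \<in> \<D> \<Longrightarrow> f z = g z + cnj (k z)"
    using harmonic_on_decompose[OF h] by blast
  have "continuous_on \<D> (\<lambda>z. g z + cnj (k z))"
    using gk by (intro continuous_intros holomorphic_on_imp_continuous_on)
  hence "continuous_on \<D> f" using gk(3) by (subst continuous_on_cong[OF refl, of _ _ "\<lambda>z. g z + cnj (k z)"]) auto
  hence fm [measurable]: "f \<in> borel_measurable dA" by (rule continuous_on_measurable_dA)
  have "wnorm2 (nrm f) = (\<integral>\<^sup>+z. ennreal ((norm (f z))\<^sup>2 * \<omega> z) \<partial>dA)"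
    unfolding wnorm2_def
  proof (rule nn_integral_cong_AE)
    show "AE z in dA. (nrm f z)\<^sup>2 * ennreal (w z) = ennreal ((norm (f z))\<^sup>2 * \<omega> z)"
      using ae
    proof eventually_elim
      case (elim z)
      thus ?case using w_pos[of z] by (simp add: ennreal_mult ennreal_power)
    qed
  qed
  hence fin': "wnorm2 (nrm f) < \<infinity>" using fin by simp
  have "integrable dA f"
    using nn_integral_finite[OF _ fin'] by (intro integrableI_bounded) auto
  thus ?thesis unfolding reproduced_def using fm fin' reproducing_formula[OF gk] by auto
qed

theorem theorem2p4:
  fixes \<omega> :: "complex \<Rightarrow> real"
  assumes "A2_weight \<omega>"
  shows "\<exists>\<epsilon>::real. 0 < \<epsilon> \<and> \<epsilon> < 1 \<and>
    (\<exists>a::nat \<Rightarrow> complex. is_lattice \<epsilon> a \<and>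
      (\<forall>f\<in>harmonic_L2 \<omega>.
        \<exists>c::nat \<Rightarrow> complex. summable (\<lambda>n. (norm (c n))\<^sup>2) \<and>
          (\<forall>z\<in>\<D>.
            (\<lambda>n. c n
                  * of_real ((1 - (norm (a n))\<^sup>2)\<^sup>2
                      * enn2real (weighted_measure \<omega> (pseudohyp_disk (a n) \<epsilon>)) powr (- (1 / 2)))
                  * harmonic_kernel (a n) z) sums f z)))"
proof -
  obtain w C where loc: "A2_disk_weight w C" and ae: "AE z in dA. w z = \<omega> z"
    using A2_weight_locale[OF assms] by blast
  interpret A2_disk_weight w C by (rule loc)
  have op0: "0 \<le> op_const" by (simp add: op_const_def)
  \<comment> \<open>\<open>2160 = 4 * 540\<close> produces the ratio \<open>1/4\<close>, the bound
    \<open>1/8\<close> comes from the kernel estimates, and the \<open>+ 1\<close> keeps the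
    denominator positive knowing only \<open>0 \<le> op_const\<close>.\<close>
  define \<epsilon> where "\<epsilon> = min (1 / 8) (1 / (2160 * (op_const + 1)))"
  have eps: "0 < \<epsilon>" "\<epsilon> \<le> 1 / 8" using op0 by (auto simp: \<epsilon>_def)
  have small: "540 * \<epsilon> * op_const \<le> 1 / 4"
  proof -
    have "\<epsilon> * op_const \<le> 1 / (2160 * (op_const + 1)) * (op_const + 1)"
      using op0 by (intro mult_mono) (auto simp: \<epsilon>_def)
    also have "\<dots> = 1 / 2160" using op0 by simp
    finally show ?thesis by simp
  qed
  obtain a where a: "is_lattice \<epsilon> a" using lattice_exists[OF eps] by blast
  interpret A2_lattice w C \<epsilon> a by unfold_locales (use eps a in auto)
  have mD_eq: "mD n = enn2real (weighted_measure \<omega> (pseudohyp_disk (a n) \<epsilon>))" for n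
  proof -
    have "weighted_measure w S = weighted_measure \<omega> S" for S
      unfolding weighted_measure_def using ae by (intro nn_integral_cong_AE) (auto elim!: eventually_mono)
    thus ?thesis by (simp add: mD_def)
  qed
  have "\<forall>f\<in>harmonic_L2 \<omega>. \<exists>c::nat \<Rightarrow> complex. summable (\<lambda>n. (norm (c n))\<^sup>2) \<and>
          (\<forall>z\<in>\<D>. (\<lambda>n. c n * of_real ((1 - (norm (a n))\<^sup>2)\<^sup>2
                      * enn2real (weighted_measure \<omega> (pseudohyp_disk (a n) \<epsilon>)) powr (- (1 / 2)))
                  * harmonic_kernel (a n) z) sums f z)"
    using atomic_decomposition[OF harmonic_L2_reproduced[OF _ ae] small] unfolding mD_eq by blast
  moreover have "\<epsilon> < 1" using eps by simp
  ultimately show ?thesis using eps(1) a by blast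
qed

end
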